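(* If $\mathcal{B}$ is a pre-Galois category, then there exists an admissible group $G$ such that $\mathcal{B}$ is equivalent to $\mathbf{S}(G)$.
   Context: In a category with finite co-products, write $\mathbf{0}$ for the initial object; an object is empty if it is isomorphic to $\mathbf{0}$. An object $X$ is an atom (atomic) if it is non-empty and, whenever $X \cong Y \amalg Z$, either $Y$ or $Z$ is empty. An essentially small category $\mathcal{B}$ is pre-Galois if: (a) $\mathcal{B}$ has finite co-products; (b) every object is isomorphic to a finite co-product of atoms; (c) for objects $X,Y,Z$ with $X$ atomic, the natural map $\mathrm{Hom}(X,Y)\amalg \mathrm{Hom}(X,Z)\to \mathrm{Hom}(X,Y\amalg Z)$ is a bijection; (d) $\mathcal{B}$ has fiber products and a final object $\mathbf{1}$; (e) any monomorphism of atoms is an isomorphism; (f) if $X\to Z$ and $Y\to Z$ are maps of atoms then $X\times_Z Y$ is non-empty; (g) $\mathbf{1}$ is atomic; (h) equivalence relations in $\mathcal{B}$ are effective: for every (internal) equivalence relation $R\subset X\times X$ on an object $X$, the quotient $X/R$ (the co-equalizer of $R\rightrightarrows X$) exists, and the kernel pair $X\times_{X/R}X$ of $X\to X/R$ is $R$. An admissible group is a topological group $G$ that is Hausdorff, non-archimedean (open subgroups form a neighborhood basis of the identity), and Roelcke pre-compact (for all open subgroups $U,V$ the set $V\backslash G/U$ is finite). An action of $G$ on a set is smooth if all stabilizers are open. $\mathbf{S}(G)$ is the category whose objects are sets with a smooth action of $G$ having finitely many orbits, and whose morphisms are $G$-equivariant maps. *)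

theory Defs
  imports
    "HOL-Algebra.Group_Action"
    "HOL-Analysis.T1_Spaces"
begin

section \<open>Categories\<close>

record ('o, 'a) cat =
  Obj :: "'o set"
  Arr :: "'a set"
  Dom :: "'a \<Rightarrow> 'o"
  Cod :: "'a \<Rightarrow> 'o"
  Ide :: "'o \<Rightarrow> 'a"
  Comp :: "'a \<Rightarrow> 'a \<Rightarrow> 'a"  (infixr \<open>\<cdot>\<index>\<close> 70)

text \<open>As usual, \<open>g \<cdot>\<^bsub>C\<^esub> f\<close> means ``first \<open>f\<close>, then \<open>g\<close>''.\<close>

definition Hom :: "('o, 'a, 'm) cat_scheme \<Rightarrow> 'o \<Rightarrow> 'o \<Rightarrow> 'a set" where
  "Hom C X Y = {f \<in> Arr C. Dom C f = X \<and> Cod C f = Y}"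

locale category =
  fixes C :: "('o, 'a, 'm) cat_scheme" (structure)
  assumes Dom_in_Obj: "f \<in> Arr C \<Longrightarrow> Dom C f \<in> Obj C"
    and Cod_in_Obj: "f \<in> Arr C \<Longrightarrow> Cod C f \<in> Obj C"
    and Ide_in_Hom: "X \<in> Obj C \<Longrightarrow> Ide C X \<in> Hom C X X"
    and Comp_in_Hom: "\<lbrakk>f \<in> Hom C X Y; g \<in> Hom C Y Z\<rbrakk> \<Longrightarrow> g \<cdot> f \<in> Hom C X Z"
    and Comp_assoc:
      "\<lbrakk>f \<in> Hom C W X; g \<in> Hom C X Y; h \<in> Hom C Y Z\<rbrakk> \<Longrightarrow> (h \<cdot> g) \<cdot> f = h \<cdot> (g \<cdot> f)"
    and Comp_Ide: "f \<in> Hom C X Y \<Longrightarrow> f \<cdot> Ide C X = f"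
    and Ide_Comp: "f \<in> Hom C X Y \<Longrightarrow> Ide C Y \<cdot> f = f"

definition is_iso :: "('o, 'a, 'm) cat_scheme \<Rightarrow> 'a \<Rightarrow> bool" where
  "is_iso C f \<longleftrightarrow> f \<in> Arr C \<and>
     (\<exists>g \<in> Hom C (Cod C f) (Dom C f).
        g \<cdot>\<^bsub>C\<^esub> f = Ide C (Dom C f) \<and> f \<cdot>\<^bsub>C\<^esub> g = Ide C (Cod C f))"

definition isomorphic :: "('o, 'a, 'm) cat_scheme \<Rightarrow> 'o \<Rightarrow> 'o \<Rightarrow> bool" where
  "isomorphic C X Y \<longleftrightarrow> (\<exists>f \<in> Hom C X Y. is_iso C f)"

definition is_monic :: "('o, 'a, 'm) cat_scheme \<Rightarrow> 'a \<Rightarrow> bool" where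
  "is_monic C f \<longleftrightarrow> f \<in> Arr C \<and>
     (\<forall>T \<in> Obj C. \<forall>u \<in> Hom C T (Dom C f). \<forall>v \<in> Hom C T (Dom C f).
        f \<cdot>\<^bsub>C\<^esub> u = f \<cdot>\<^bsub>C\<^esub> v \<longrightarrow> u = v)"

text \<open>
  The categories of this development live on HOL types, so ``set-sized'' only has a meaning
  relative to a bound: the type \<open>'u\<close> plays the role of a set, and \<open>C\<close> is essentially small
  when the full subcategory on some set of representatives of the isomorphism classes has its
  arrows (hence also its objects) parametrized by \<open>'u\<close>. For \<open>'u = 'a\<close> the condition is void.
\<close>

definition essentially_small :: "'u itself \<Rightarrow> ('o, 'a, 'm) cat_scheme \<Rightarrow> bool" where
  "essentially_small (_ :: 'u itself) C \<longleftrightarrow>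
     (\<exists>S \<subseteq> Obj C. (\<forall>X \<in> Obj C. \<exists>Y \<in> S. isomorphic C X Y) \<and>
        (\<exists>e :: 'a \<Rightarrow> 'u. inj_on e {f \<in> Arr C. Dom C f \<in> S \<and> Cod C f \<in> S}))"

subsection \<open>Limits and colimits\<close>

definition is_initial :: "('o, 'a, 'm) cat_scheme \<Rightarrow> 'o \<Rightarrow> bool" where
  "is_initial C X \<longleftrightarrow> X \<in> Obj C \<and> (\<forall>Y \<in> Obj C. \<exists>!f. f \<in> Hom C X Y)"

definition is_final :: "('o, 'a, 'm) cat_scheme \<Rightarrow> 'o \<Rightarrow> bool" where
  "is_final C X \<longleftrightarrow> X \<in> Obj C \<and> (\<forall>Y \<in> Obj C. \<exists>!f. f \<in> Hom C Y X)"

definition is_coproduct ::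
  "('o, 'a, 'm) cat_scheme \<Rightarrow> 'i set \<Rightarrow> ('i \<Rightarrow> 'o) \<Rightarrow> 'o \<Rightarrow> ('i \<Rightarrow> 'a) \<Rightarrow> bool" where
  "is_coproduct C I X W \<iota> \<longleftrightarrow>
     W \<in> Obj C \<and> (\<forall>k \<in> I. X k \<in> Obj C \<and> \<iota> k \<in> Hom C (X k) W) \<and>
     (\<forall>T \<in> Obj C. \<forall>f. (\<forall>k \<in> I. f k \<in> Hom C (X k) T) \<longrightarrow>
        (\<exists>!h. h \<in> Hom C W T \<and> (\<forall>k \<in> I. h \<cdot>\<^bsub>C\<^esub> \<iota> k = f k)))"

definition is_coproduct2 ::
  "('o, 'a, 'm) cat_scheme \<Rightarrow> 'o \<Rightarrow> 'o \<Rightarrow> 'o \<Rightarrow> 'a \<Rightarrow> 'a \<Rightarrow> bool" where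
  "is_coproduct2 C X Y W i j \<longleftrightarrow>
     X \<in> Obj C \<and> Y \<in> Obj C \<and> W \<in> Obj C \<and> i \<in> Hom C X W \<and> j \<in> Hom C Y W \<and>
     (\<forall>T \<in> Obj C. \<forall>f \<in> Hom C X T. \<forall>g \<in> Hom C Y T.
        \<exists>!h. h \<in> Hom C W T \<and> h \<cdot>\<^bsub>C\<^esub> i = f \<and> h \<cdot>\<^bsub>C\<^esub> j = g)"

definition is_product2 ::
  "('o, 'a, 'm) cat_scheme \<Rightarrow> 'o \<Rightarrow> 'o \<Rightarrow> 'o \<Rightarrow> 'a \<Rightarrow> 'a \<Rightarrow> bool" where
  "is_product2 C X Y P p q \<longleftrightarrow>
     X \<in> Obj C \<and> Y \<in> Obj C \<and> P \<in> Obj C \<and> p \<in> Hom C P X \<and> q \<in> Hom C P Y \<and>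
     (\<forall>T \<in> Obj C. \<forall>f \<in> Hom C T X. \<forall>g \<in> Hom C T Y.
        \<exists>!h. h \<in> Hom C T P \<and> p \<cdot>\<^bsub>C\<^esub> h = f \<and> q \<cdot>\<^bsub>C\<^esub> h = g)"

definition is_pullback ::
  "('o, 'a, 'm) cat_scheme \<Rightarrow> 'a \<Rightarrow> 'a \<Rightarrow> 'o \<Rightarrow> 'a \<Rightarrow> 'a \<Rightarrow> bool" where
  "is_pullback C f g P p q \<longleftrightarrow>
     f \<in> Arr C \<and> g \<in> Arr C \<and> Cod C f = Cod C g \<and>
     p \<in> Hom C P (Dom C f) \<and> q \<in> Hom C P (Dom C g) \<and> f \<cdot>\<^bsub>C\<^esub> p = g \<cdot>\<^bsub>C\<^esub> q \<and>
     (\<forall>T \<in> Obj C. \<forall>u \<in> Hom C T (Dom C f). \<forall>v \<in> Hom C T (Dom C g).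
        f \<cdot>\<^bsub>C\<^esub> u = g \<cdot>\<^bsub>C\<^esub> v \<longrightarrow>
        (\<exists>!h. h \<in> Hom C T P \<and> p \<cdot>\<^bsub>C\<^esub> h = u \<and> q \<cdot>\<^bsub>C\<^esub> h = v))"

definition is_coequalizer ::
  "('o, 'a, 'm) cat_scheme \<Rightarrow> 'a \<Rightarrow> 'a \<Rightarrow> 'o \<Rightarrow> 'a \<Rightarrow> bool" where
  "is_coequalizer C f g Q c \<longleftrightarrow>
     f \<in> Arr C \<and> g \<in> Arr C \<and> Dom C f = Dom C g \<and> Cod C f = Cod C g \<and>
     c \<in> Hom C (Cod C f) Q \<and> c \<cdot>\<^bsub>C\<^esub> f = c \<cdot>\<^bsub>C\<^esub> g \<and>
     (\<forall>T \<in> Obj C. \<forall>u \<in> Hom C (Cod C f) T. u \<cdot>\<^bsub>C\<^esub> f = u \<cdot>\<^bsub>C\<^esub> g \<longrightarrow>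
        (\<exists>!h. h \<in> Hom C Q T \<and> h \<cdot>\<^bsub>C\<^esub> c = u))"

definition has_finite_coproducts :: "('o, 'a, 'm) cat_scheme \<Rightarrow> bool" where
  "has_finite_coproducts C \<longleftrightarrow>
     (\<forall>(n :: nat) X. (\<forall>k<n. X k \<in> Obj C) \<longrightarrow> (\<exists>W \<iota>. is_coproduct C {..<n} X W \<iota>))"

definition has_fiber_products :: "('o, 'a, 'm) cat_scheme \<Rightarrow> bool" where
  "has_fiber_products C \<longleftrightarrow>
     (\<forall>f \<in> Arr C. \<forall>g \<in> Arr C. Cod C f = Cod C g \<longrightarrow> (\<exists>P p q. is_pullback C f g P p q))"

subsection \<open>Internal equivalence relations\<close>

text \<open>
  \<open>P\<close> with projections \<open>a\<close>, \<open>b\<close> is a product \<open>X \<times> X\<close>, and the monomorphism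
  \<open>m : R \<rightarrow> P\<close> is a subobject of it that is internally reflexive, symmetric and transitive.
  In the last clause \<open>K\<close> is the object \<open>R \<times>\<^sub>X R\<close> of composable pairs of related elements.
\<close>

definition is_equiv_relation ::
  "('o, 'a, 'm) cat_scheme \<Rightarrow> 'o \<Rightarrow> 'o \<Rightarrow> 'a \<Rightarrow> 'a \<Rightarrow> 'o \<Rightarrow> 'a \<Rightarrow> bool" where
  "is_equiv_relation C X P a b R m \<longleftrightarrow>
     is_product2 C X X P a b \<and> m \<in> Hom C R P \<and> is_monic C m \<and>
     (let p = a \<cdot>\<^bsub>C\<^esub> m; q = b \<cdot>\<^bsub>C\<^esub> m in
        (\<exists>r \<in> Hom C X R. p \<cdot>\<^bsub>C\<^esub> r = Ide C X \<and> q \<cdot>\<^bsub>C\<^esub> r = Ide C X) \<and>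
        (\<exists>s \<in> Hom C R R. p \<cdot>\<^bsub>C\<^esub> s = q \<and> q \<cdot>\<^bsub>C\<^esub> s = p) \<and>
        (\<forall>K u v. is_pullback C q p K u v \<longrightarrow>
           (\<exists>t \<in> Hom C K R. p \<cdot>\<^bsub>C\<^esub> t = p \<cdot>\<^bsub>C\<^esub> u \<and> q \<cdot>\<^bsub>C\<^esub> t = q \<cdot>\<^bsub>C\<^esub> v)))"

definition equiv_relations_effective :: "('o, 'a, 'm) cat_scheme \<Rightarrow> bool" where
  "equiv_relations_effective C \<longleftrightarrow>
     (\<forall>X P a b R m. is_equiv_relation C X P a b R m \<longrightarrow>
        (\<exists>Q c. is_coequalizer C (a \<cdot>\<^bsub>C\<^esub> m) (b \<cdot>\<^bsub>C\<^esub> m) Q c \<and>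
               is_pullback C c c R (a \<cdot>\<^bsub>C\<^esub> m) (b \<cdot>\<^bsub>C\<^esub> m)))"

subsection \<open>Functors and equivalences\<close>

definition is_functor ::
  "('o, 'a, 'm) cat_scheme \<Rightarrow> ('p, 'b, 'n) cat_scheme \<Rightarrow> ('o \<Rightarrow> 'p) \<Rightarrow> ('a \<Rightarrow> 'b) \<Rightarrow> bool" where
  "is_functor C D Fo Fa \<longleftrightarrow>
     (\<forall>X \<in> Obj C. Fo X \<in> Obj D \<and> Fa (Ide C X) = Ide D (Fo X)) \<and>
     (\<forall>f \<in> Arr C. Fa f \<in> Hom D (Fo (Dom C f)) (Fo (Cod C f))) \<and>
     (\<forall>f \<in> Arr C. \<forall>g \<in> Arr C. Cod C f = Dom C g \<longrightarrow> Fa (g \<cdot>\<^bsub>C\<^esub> f) = Fa g \<cdot>\<^bsub>D\<^esub> Fa f)"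

definition is_natural_iso ::
  "('o, 'a, 'm) cat_scheme \<Rightarrow> ('p, 'b, 'n) cat_scheme \<Rightarrow> ('o \<Rightarrow> 'p) \<Rightarrow> ('a \<Rightarrow> 'b) \<Rightarrow>
   ('o \<Rightarrow> 'p) \<Rightarrow> ('a \<Rightarrow> 'b) \<Rightarrow> ('o \<Rightarrow> 'b) \<Rightarrow> bool" where
  "is_natural_iso C D Fo Fa Go Ga \<eta> \<longleftrightarrow>
     (\<forall>X \<in> Obj C. \<eta> X \<in> Hom D (Fo X) (Go X) \<and> is_iso D (\<eta> X)) \<and>
     (\<forall>f \<in> Arr C. \<eta> (Cod C f) \<cdot>\<^bsub>D\<^esub> Fa f = Ga f \<cdot>\<^bsub>D\<^esub> \<eta> (Dom C f))"

definition equivalent_categories ::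
  "('o, 'a, 'm) cat_scheme \<Rightarrow> ('p, 'b, 'n) cat_scheme \<Rightarrow> bool" where
  "equivalent_categories C D \<longleftrightarrow>
     (\<exists>Fo Fa Go Ga \<eta> \<epsilon>.
        is_functor C D Fo Fa \<and> is_functor D C Go Ga \<and>
        is_natural_iso C C (\<lambda>X. X) (\<lambda>f. f) (\<lambda>X. Go (Fo X)) (\<lambda>f. Ga (Fa f)) \<eta> \<and>
        is_natural_iso D D (\<lambda>Y. Fo (Go Y)) (\<lambda>g. Fa (Ga g)) (\<lambda>Y. Y) (\<lambda>g. g) \<epsilon>)"

section \<open>Pre-Galois categories\<close>

definition is_empty_obj :: "('o, 'a, 'm) cat_scheme \<Rightarrow> 'o \<Rightarrow> bool" where
  "is_empty_obj C X \<longleftrightarrow> (\<exists>Z. is_initial C Z \<and> isomorphic C X Z)"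

definition is_atom :: "('o, 'a, 'm) cat_scheme \<Rightarrow> 'o \<Rightarrow> bool" where
  "is_atom C X \<longleftrightarrow> X \<in> Obj C \<and> \<not> is_empty_obj C X \<and>
     (\<forall>Y Z W i j. is_coproduct2 C Y Z W i j \<and> isomorphic C X W \<longrightarrow>
        is_empty_obj C Y \<or> is_empty_obj C Z)"

locale pre_galois = category B
  for u :: "'u itself" and B :: "('o, 'a, 'm) cat_scheme" (structure) +
  assumes essentially_small: "essentially_small u B"
    and finite_coproducts: "has_finite_coproducts B"
    and atomic_decomposition:
      "X \<in> Obj B \<Longrightarrow>
         \<exists>(n :: nat) A W \<iota>. (\<forall>k<n. is_atom B (A k)) \<and> is_coproduct B {..<n} A W \<iota> \<and>
           isomorphic B X W"
    and Hom_atom_coproduct: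
      "\<lbrakk>is_atom B X; is_coproduct2 B Y Z W i j\<rbrakk> \<Longrightarrow>
         bij_betw (case_sum (\<lambda>f. i \<cdot> f) (\<lambda>g. j \<cdot> g)) (Hom B X Y <+> Hom B X Z) (Hom B X W)"
    and fiber_products: "has_fiber_products B"
    and final_exists: "\<exists>T. is_final B T"
    and monic_atoms_iso:
      "\<lbrakk>is_atom B X; is_atom B Y; f \<in> Hom B X Y; is_monic B f\<rbrakk> \<Longrightarrow> is_iso B f"
    and fiber_product_atoms_nonempty:
      "\<lbrakk>is_atom B X; is_atom B Y; is_atom B Z; f \<in> Hom B X Z; g \<in> Hom B Y Z;
        is_pullback B f g P p q\<rbrakk> \<Longrightarrow> \<not> is_empty_obj B P"
    and final_atom: "is_final B T \<Longrightarrow> is_atom B T"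
    and effective: "equiv_relations_effective B"

section \<open>Admissible groups\<close>

definition topological_group :: "('g, 'm) monoid_scheme \<Rightarrow> 'g topology \<Rightarrow> bool" where
  "topological_group G \<tau> \<longleftrightarrow>
     group G \<and> topspace \<tau> = carrier G \<and>
     continuous_map (prod_topology \<tau> \<tau>) \<tau> (\<lambda>(x, y). x \<otimes>\<^bsub>G\<^esub> y) \<and>
     continuous_map \<tau> \<tau> (\<lambda>x. inv\<^bsub>G\<^esub> x)"

definition open_subgroup :: "('g, 'm) monoid_scheme \<Rightarrow> 'g topology \<Rightarrow> 'g set \<Rightarrow> bool" where
  "open_subgroup G \<tau> U \<longleftrightarrow> subgroup U G \<and> openin \<tau> U"

definition non_archimedean :: "('g, 'm) monoid_scheme \<Rightarrow> 'g topology \<Rightarrow> bool" where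
  "non_archimedean G \<tau> \<longleftrightarrow>
     (\<forall>N. openin \<tau> N \<and> \<one>\<^bsub>G\<^esub> \<in> N \<longrightarrow> (\<exists>U. open_subgroup G \<tau> U \<and> U \<subseteq> N))"

definition roelcke_precompact :: "('g, 'm) monoid_scheme \<Rightarrow> 'g topology \<Rightarrow> bool" where
  "roelcke_precompact G \<tau> \<longleftrightarrow>
     (\<forall>U V. open_subgroup G \<tau> U \<and> open_subgroup G \<tau> V \<longrightarrow>
        finite {V <#>\<^bsub>G\<^esub> (g <#\<^bsub>G\<^esub> U) | g. g \<in> carrier G})"

definition admissible_group :: "('g, 'm) monoid_scheme \<Rightarrow> 'g topology \<Rightarrow> bool" where
  "admissible_group G \<tau> \<longleftrightarrow>
     topological_group G \<tau> \<and> Hausdorff_space \<tau> \<and> non_archimedean G \<tau> \<and> roelcke_precompact G \<tau>"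

section \<open>The category of finitary smooth sets\<close>

text \<open>
  A \<open>G\<close>-set is a pair of a carrier \<open>E\<close> and an action \<open>\<phi>\<close>. Actions are required to be
  extensional on \<open>carrier G\<close>, and the underlying functions of morphisms on their domain, so that
  equality of objects and of morphisms is the intended one.
\<close>

type_synonym ('g, 'x) gset = "'x set \<times> ('g \<Rightarrow> 'x \<Rightarrow> 'x)"
type_synonym ('g, 'x) gmap = "('g, 'x) gset \<times> ('x \<Rightarrow> 'x) \<times> ('g, 'x) gset"

definition smooth_gsets :: "('g, 'm) monoid_scheme \<Rightarrow> 'g topology \<Rightarrow> ('g, 'x) gset set" where
  "smooth_gsets G \<tau> =
     {(E, \<phi>). group_action G E \<phi> \<and> \<phi> \<in> extensional (carrier G) \<and>
        (\<forall>x \<in> E. openin \<tau> (stabilizer G \<phi> x)) \<and> finite (orbits G E \<phi>)}"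

definition equivariant ::
  "('g, 'm) monoid_scheme \<Rightarrow> ('g, 'x) gset \<Rightarrow> ('g, 'y) gset \<Rightarrow> ('x \<Rightarrow> 'y) \<Rightarrow> bool" where
  "equivariant G X Y f \<longleftrightarrow>
     f \<in> fst X \<rightarrow>\<^sub>E fst Y \<and>
     (\<forall>g \<in> carrier G. \<forall>x \<in> fst X. f (snd X g x) = snd Y g (f x))"

definition SG ::
  "('g, 'm) monoid_scheme \<Rightarrow> 'g topology \<Rightarrow> (('g, 'x) gset, ('g, 'x) gmap) cat" where
  "SG G \<tau> = \<lparr>
     Obj = smooth_gsets G \<tau>,
     Arr = {(X, f, Y). X \<in> smooth_gsets G \<tau> \<and> Y \<in> smooth_gsets G \<tau> \<and> equivariant G X Y f},
     Dom = (\<lambda>(X, f, Y). X),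
     Cod = (\<lambda>(X, f, Y). Y),
     Ide = (\<lambda>X. (X, \<lambda>x \<in> fst X. x, X)),
     Comp = (\<lambda>(Y, g, Z) (X, f, Y'). (X, compose (fst X) g f, Z))\<rparr>"

lemma category_SG: "category (SG G \<tau> :: (('g, 'x) gset, ('g, 'x) gmap) cat)"
proof -
  have closed: "\<phi> g x \<in> E"
    if "(E, \<phi>) \<in> smooth_gsets G \<tau>" "g \<in> carrier G" "x \<in> E" for E :: "'x set" and \<phi> g x
    using that group_action.element_image[of G E \<phi> g x "\<phi> g x"] by (simp add: smooth_gsets_def)
  have "equivariant G X X (\<lambda>x \<in> fst X. x)" if "X \<in> smooth_gsets G \<tau>" for X :: "('g, 'x) gset"
    using that closed by (cases X) (auto simp: equivariant_def)
  moreover have "equivariant G X Z (compose (fst X) g f)"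
    if "X \<in> smooth_gsets G \<tau>" "equivariant G X Y f" "equivariant G Y Z g"
    for X Y Z :: "('g, 'x) gset" and f g
    using that closed
    by (cases X, cases Y, cases Z) (auto simp: equivariant_def PiE_iff compose_def)
  moreover have "compose (fst X) f (\<lambda>x \<in> fst X. x) = f" "compose (fst X) (\<lambda>x \<in> fst Y. x) f = f"
    if "equivariant G X Y f" for X Y :: "('g, 'x) gset" and f
    using that by (auto simp: equivariant_def compose_def fun_eq_iff PiE_iff extensional_def)
  moreover have "compose (fst X) (compose (fst Y) h g) f = compose (fst X) h (compose (fst X) g f)"
    if "equivariant G X Y f" for X Y :: "('g, 'x) gset" and f g h
    using that by (auto simp: equivariant_def compose_def fun_eq_iff PiE_iff)
  ultimately show ?thesis
    by unfold_locales (auto simp: SG_def Hom_def)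
qed

text \<open>
  The carriers of the objects of \<^const>\<open>SG\<close> are subsets of a fixed type \<open>'x\<close>. The type
  \<open>'g set \<times> nat\<close> is large enough: a \<open>G\<close>-set with finitely many orbits is a finite
  disjoint union of coset spaces, so every smooth one, on whatever type, has an isomorphic copy
  there.
\<close>

lemma smooth_gset_copy:
  fixes X :: "('g, 'y) gset"
  assumes "X \<in> smooth_gsets G \<tau>"
  shows "\<exists>Y \<in> (smooth_gsets G \<tau> :: ('g, 'g set \<times> nat) gset set).
           \<exists>f. equivariant G X Y f \<and> bij_betw f (fst X) (fst Y)"
proof -
  obtain E \<phi> where X: "X = (E, \<phi>)" by fastforce
  interpret group_action G E \<phi> using assms X by (simp add: smooth_gsets_def)
  have smooth: "\<And>x. x \<in> E \<Longrightarrow> openin \<tau> (stabilizer G \<phi> x)" and fin: "finite (orbits G E \<phi>)"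
    using assms X by (auto simp: smooth_gsets_def)
  interpret G: group G using group_hom by (simp add: group_hom_def)
  obtain e :: "'y set \<Rightarrow> nat" where e: "inj_on e (orbits G E \<phi>)"
    using finite_imp_inj_to_nat_seg[OF fin] by blast
  define r where "r x = (SOME y. y \<in> orbit G \<phi> x)" for x
  define f where "f = (\<lambda>x\<in>E. ({g \<in> carrier G. \<phi> g (r x) = x}, e (orbit G \<phi> x)))"
  have r: "\<exists>g \<in> carrier G. \<phi> g (r x) = x" if x: "x \<in> E" for x
  proof -
    have "x \<in> orbit G \<phi> x" using x orbit_refl by blast
    then have "r x \<in> orbit G \<phi> x" unfolding r_def by (rule someI)
    then obtain g where g: "g \<in> carrier G" "r x = \<phi> g x" by (auto simp: orbit_def)
    then show ?thesis using orbit_sym_aux[OF g(1) x] by (metis G.inv_closed)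
  qed
  have inj: "inj_on f E"
  proof (rule inj_onI)
    fix x y assume xy: "x \<in> E" "y \<in> E" "f x = f y"
    then have "orbit G \<phi> x = orbit G \<phi> y"
      using e by (auto simp: f_def inj_on_def orbits_def)
    then have "r x = r y" by (simp add: r_def)
    with xy r[OF xy(1)] show "x = y" by (auto simp: f_def)
  qed
  define E' where "E' = f ` E"
  define h where "h = inv_into E f"
  have hf: "h (f x) = x" if "x \<in> E" for x using inj that by (simp add: h_def)
  have E': "\<And>y. y \<in> E' \<Longrightarrow> h y \<in> E \<and> f (h y) = y" by (auto simp: E'_def hf)
  have closed: "\<phi> g x \<in> E" if "g \<in> carrier G" "x \<in> E" for g x
    using element_image that by blast
  define \<psi> where "\<psi> = (\<lambda>g\<in>carrier G. \<lambda>y\<in>E'. f (\<phi> g (h y)))"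
  have \<psi>: "\<psi> g y = f (\<phi> g (h y))" if "g \<in> carrier G" "y \<in> E'" for g y
    using that by (simp add: \<psi>_def)
  have \<psi>_closed: "\<psi> g y \<in> E'" if "g \<in> carrier G" "y \<in> E'" for g y
    using that E' closed by (simp add: \<psi> E'_def)
  have mult: "\<psi> (a \<otimes>\<^bsub>G\<^esub> b) y = \<psi> a (\<psi> b y)"
    if "a \<in> carrier G" "b \<in> carrier G" "y \<in> E'" for a b y
    using that E' closed \<psi>_closed by (simp add: \<psi> hf composition_rule)
  have one: "\<psi> \<one>\<^bsub>G\<^esub> y = y" if "y \<in> E'" for y
    using that E' id_eq_one by (metis G.one_closed \<psi> restrict_apply')
  have bij: "\<psi> g \<in> Bij E'" if g: "g \<in> carrier G" for g
  proof -
    have "bij_betw (\<psi> g) E' E'"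
      by (rule bij_betw_byWitness[where f' = "\<psi> (inv\<^bsub>G\<^esub> g)"])
        (use g in \<open>auto simp: \<psi>_closed one simp flip: mult\<close>)
    moreover have "\<psi> g \<in> extensional E'" using g by (simp add: \<psi>_def)
    ultimately show ?thesis by (simp add: Bij_def)
  qed
  have act: "group_action G E' \<psi>"
  proof -
    have "\<psi> (a \<otimes>\<^bsub>G\<^esub> b) = compose E' (\<psi> a) (\<psi> b)" if "a \<in> carrier G" "b \<in> carrier G" for a b
    proof (rule extensionalityI[where A = E'])
      show "\<psi> (a \<otimes>\<^bsub>G\<^esub> b) \<in> extensional E'"
        using bij that by (simp add: Bij_def)
      show "compose E' (\<psi> a) (\<psi> b) \<in> extensional E'" by (rule compose_extensional)
    qed (simp add: compose_def mult that)
    then have "\<psi> \<in> Group.hom G (BijGroup E')"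
      by (auto simp: Group.hom_def BijGroup_def bij)
    then show ?thesis
      by (simp add: group_action_def group_hom_def group_hom_axioms_def group_BijGroup
          G.is_group)
  qed
  have stab: "stabilizer G \<psi> (f x) = stabilizer G \<phi> x" if x: "x \<in> E" for x
  proof -
    have "f x \<in> E'" using x by (simp add: E'_def)
    then show ?thesis
      using x closed inj unfolding stabilizer_def by (auto simp: \<psi> hf inj_on_eq_iff)
  qed
  have orb: "orbit G \<psi> (f x) = f ` orbit G \<phi> x" if x: "x \<in> E" for x
  proof -
    have "f x \<in> E'" using x by (simp add: E'_def)
    then show ?thesis
      using x by (simp add: orbit_def Setcompr_eq_image image_image \<psi> hf)
  qed
  have "orbits G E' \<psi> \<subseteq> image f ` orbits G E \<phi>"
    by (auto simp: orbits_def E'_def orb)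
  then have "finite (orbits G E' \<psi>)" using fin finite_surj by blast
  then have Y: "(E', \<psi>) \<in> smooth_gsets G \<tau>"
    using act smooth by (auto simp: smooth_gsets_def E'_def stab) (simp add: \<psi>_def)
  have "bij_betw f E E'" using inj by (simp add: bij_betw_def E'_def)
  moreover have "equivariant G X (E', \<psi>) f"
    using closed by (auto simp: equivariant_def X E'_def \<psi> hf) (simp add: f_def)
  ultimately show ?thesis using Y X by (intro bexI[of _ "(E', \<psi>)"]) auto
qed

end

(*
  Fix a set At of representatives of the atoms. Suppose given sets F A for A in At, functorial in A,
  with a group G acting transitively and naturally on each of them, such that any two points are images
  of a third one and f is determined by its value at a single point. Then F extends to all objects by
  E X = colim Hom(A, X), the colimit being taken over the points (A, a) of F. This E is fully faithful,
  because a map of atoms is the quotient by its kernel pair, and each finitary smooth G-set is a quotient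
  of some E X by an equivalence relation, which is effective. The topology of G has the stabilizers of
  points as a basis at the identity.

  It remains to construct F and G. Points are named by pairs (w, A) of a formal word w and A in At. The
  letters of the words, called symbols, are to act as automorphisms, and a symbol (h, f, g, k) with
  f : Z -> X, g : Z -> Y, k : Z -> Q is to satisfy: if some z has f z = (1, X) and g z = (h, Y), then
  such a z exists with k z equal to the image of (1, Q) under the symbol. With f = g = 1 this
  makes G transitive, and with k = 1 it puts two points below a third one. For a finite set T of
  names, a model is an atom Z with an arrow Z -> A for each name (w, A) in T. Models are enlarged by one
  name at a time by means of fibre products of atoms, and F is the limit of models along an
  ultrafilter. Since there are finitely many components of X x Y, the ultrafilter picks one of them.
*)

theory Submission
  imports Defs
begin

section \<open>Pre-Galois categories\<close>

text \<open>\<open>At\<close> need not be countable, so a homogeneous F cannot be reached by going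
  back and forth, and a limit of models alone need not have automorphisms. Making the automorphisms
  part of the language, as Skolem functions, leaves only finite satisfiability to show. This rests
  on amalgamation of atoms, that is (d), (f), (g), and on the fact that arrows of atoms are epi
  (\<open>atom_epi\<close>, through (e)): an arrow is determined by its value at a point, and a
  partial automorphism of a tuple is a pair of arrows from its atom Z to one atom W. A symbol only
  treats pairs whose first entry is a base point (1, X), because words move any pair to such a one;
  the second entry enters through its word h, which is why letters contain words. Its property is
  conditional, so it does not prescribe in which component of X x Y the pair lies; that is left to
  the ultrafilter. The universe shapes the rest: points must live in \<open>'u set\<close>. Names
  are finite expressions in arrows of \<open>At\<close>, hence they can be coded in
  \<open>'u\<close> once this is infinite, and a point is the set of codes of its names.\<close>

context category
begin

lemma Hom_simps:
  assumes "f \<in> Hom C X Y"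
  shows "f \<in> Arr C" "Dom C f = X" "Cod C f = Y" "X \<in> Obj C" "Y \<in> Obj C"
  using assms Dom_in_Obj Cod_in_Obj by (auto simp: Hom_def)

lemma cat_simps:
  "f \<in> Hom C X Y \<longleftrightarrow> f \<in> Arr C \<and> Dom C f = X \<and> Cod C f = Y"
  "\<lbrakk>f \<in> Arr C; g \<in> Arr C; Cod C f = Dom C g\<rbrakk> \<Longrightarrow> g \<cdot> f \<in> Arr C"
  "\<lbrakk>f \<in> Arr C; g \<in> Arr C; Cod C f = Dom C g\<rbrakk> \<Longrightarrow> Dom C (g \<cdot> f) = Dom C f"
  "\<lbrakk>f \<in> Arr C; g \<in> Arr C; Cod C f = Dom C g\<rbrakk> \<Longrightarrow> Cod C (g \<cdot> f) = Cod C g"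
  "\<lbrakk>f \<in> Arr C; g \<in> Arr C; h \<in> Arr C; Cod C f = Dom C g; Cod C g = Dom C h\<rbrakk> \<Longrightarrow>
    (h \<cdot> g) \<cdot> f = h \<cdot> (g \<cdot> f)"
  "X \<in> Obj C \<Longrightarrow> Ide C X \<in> Arr C"
  "X \<in> Obj C \<Longrightarrow> Dom C (Ide C X) = X"
  "X \<in> Obj C \<Longrightarrow> Cod C (Ide C X) = X"
  "\<lbrakk>f \<in> Arr C; Dom C f = X\<rbrakk> \<Longrightarrow> f \<cdot> Ide C X = f"
  "\<lbrakk>f \<in> Arr C; Cod C f = X\<rbrakk> \<Longrightarrow> Ide C X \<cdot> f = f"
  "f \<in> Arr C \<Longrightarrow> Dom C f \<in> Obj C"
  "f \<in> Arr C \<Longrightarrow> Cod C f \<in> Obj C"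
  using Comp_in_Hom[of f "Dom C f" "Cod C f" g "Cod C g"] Ide_in_Hom[of X]
    Comp_assoc[of f "Dom C f" "Cod C f" g "Cod C g" h "Cod C h"]
    Comp_Ide[of f "Dom C f" "Cod C f"] Ide_Comp[of f "Dom C f" "Cod C f"] Dom_in_Obj Cod_in_Obj
  by (auto simp: Hom_def)

text \<open>Composites are kept nested to the right, where an equation for
  \<open>g \<cdot> f\<close> no longer matches once \<open>f\<close> is composed with a further
  arrow \<open>s\<close>; this is its form in that position.\<close>

lemma Comp_extend:
  assumes "g \<cdot> f = r" "f \<in> Hom C X Y" "g \<in> Hom C Y Z" "s \<in> Hom C W X"
  shows "g \<cdot> (f \<cdot> s) = r \<cdot> s"
  using Comp_assoc[OF assms(4,2,3)] assms(1) by simp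

lemma isomorphicE:
  assumes "isomorphic C X Y"
  obtains f g where "f \<in> Hom C X Y" "g \<in> Hom C Y X" "g \<cdot> f = Ide C X" "f \<cdot> g = Ide C Y"
  using assms by (auto simp: isomorphic_def is_iso_def Hom_def)

lemma isomorphicI:
  assumes "f \<in> Hom C X Y" "g \<in> Hom C Y X" "g \<cdot> f = Ide C X" "f \<cdot> g = Ide C Y"
  shows "isomorphic C X Y"
  using assms by (auto simp: isomorphic_def is_iso_def Hom_def)

lemma isomorphic_refl: "X \<in> Obj C \<Longrightarrow> isomorphic C X X"
  by (rule isomorphicI[of "Ide C X" _ _ "Ide C X"]) (auto simp: cat_simps)

lemma isomorphic_sym: "isomorphic C X Y \<Longrightarrow> isomorphic C Y X"
  by (meson isomorphicE isomorphicI)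

lemma isomorphic_trans:
  assumes "isomorphic C X Y" "isomorphic C Y Z"
  shows "isomorphic C X Z"
proof -
  obtain f f' where f: "f \<in> Hom C X Y" "f' \<in> Hom C Y X" "f' \<cdot> f = Ide C X" "f \<cdot> f' = Ide C Y"
    using assms(1) by (rule isomorphicE)
  obtain g g' where g: "g \<in> Hom C Y Z" "g' \<in> Hom C Z Y" "g' \<cdot> g = Ide C Y" "g \<cdot> g' = Ide C Z"
    using assms(2) by (rule isomorphicE)
  have "(f' \<cdot> g') \<cdot> (g \<cdot> f) = Ide C X"
    using f g Comp_extend[OF g(3,1,2) f(1)] by (simp add: cat_simps)
  moreover have "(g \<cdot> f) \<cdot> (f' \<cdot> g') = Ide C Z"
    using f g Comp_extend[OF f(4,2,1) g(2)] by (simp add: cat_simps)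
  ultimately show ?thesis
    using f g by (intro isomorphicI[of "g \<cdot> f" X Z "f' \<cdot> g'"]) (auto simp: Comp_in_Hom)
qed

lemma is_atom_isomorphic:
  assumes "is_atom C X" "isomorphic C X Y"
  shows "is_atom C Y"
proof -
  have "Y \<in> Obj C" using assms(2) by (metis isomorphicE Hom_simps(5))
  then show ?thesis
    using assms isomorphic_trans unfolding is_atom_def is_empty_obj_def by meson
qed

lemma coproduct_eqI:
  assumes "is_coproduct C I A W \<iota>" "u \<in> Hom C W T" "v \<in> Hom C W T"
    and "\<And>k. k \<in> I \<Longrightarrow> u \<cdot> \<iota> k = v \<cdot> \<iota> k"
  shows "u = v"
proof -
  have "\<forall>k\<in>I. u \<cdot> \<iota> k \<in> Hom C (A k) T" "T \<in> Obj C"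
    using assms by (auto simp: is_coproduct_def intro: Comp_in_Hom Hom_simps)
  then have "\<exists>!h. h \<in> Hom C W T \<and> (\<forall>k \<in> I. h \<cdot> \<iota> k = u \<cdot> \<iota> k)"
    using assms(1) by (auto simp: is_coproduct_def)
  then show ?thesis using assms by metis
qed

lemma coproduct_desc:
  assumes "is_coproduct C I A W \<iota>" "\<And>k. k \<in> I \<Longrightarrow> f k \<in> Hom C (A k) T" "T \<in> Obj C"
  obtains h where "h \<in> Hom C W T" "\<And>k. k \<in> I \<Longrightarrow> h \<cdot> \<iota> k = f k"
  using assms unfolding is_coproduct_def by metis

lemma coproduct_inj_Hom:
  assumes "is_coproduct C I A W \<iota>" "k \<in> I"
  shows "\<iota> k \<in> Hom C (A k) W"
  using assms by (auto simp: is_coproduct_def)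

text \<open>Allows decompositions to be taken with the given object itself as vertex, and with all
  summands in \<open>At\<close>.\<close>

lemma coproduct_isomorphic:
  assumes W: "is_coproduct C I A W \<iota>"
    and f: "f \<in> Hom C W X" "f' \<in> Hom C X W" "f' \<cdot> f = Ide C W" "f \<cdot> f' = Ide C X"
    and g: "\<And>k. k \<in> I \<Longrightarrow> isomorphic C (A' k) (A k)"
  shows "\<exists>\<kappa>. is_coproduct C I A' X \<kappa>"
proof -
  have "\<exists>g h. g \<in> Hom C (A' k) (A k) \<and> h \<in> Hom C (A k) (A' k) \<and>
      h \<cdot> g = Ide C (A' k) \<and> g \<cdot> h = Ide C (A k)" if "k \<in> I" for k
    using g[OF that] by (metis isomorphicE)
  then obtain g h where gh: "g k \<in> Hom C (A' k) (A k)" "h k \<in> Hom C (A k) (A' k)"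
      "h k \<cdot> g k = Ide C (A' k)" "g k \<cdot> h k = Ide C (A k)" if "k \<in> I" for k
    by metis
  note \<iota> = coproduct_inj_Hom[OF W]
  have eq: "(\<forall>k\<in>I. u \<cdot> (f \<cdot> \<iota> k \<cdot> g k) = t k) \<longleftrightarrow> (\<forall>k\<in>I. (u \<cdot> f) \<cdot> \<iota> k = t k \<cdot> h k)"
    if t: "\<forall>k\<in>I. t k \<in> Hom C (A' k) T" and u: "u \<in> Hom C X T" for t u T
  proof (intro ball_cong refl)
    fix k assume k: "k \<in> I"
    have "(f \<cdot> \<iota> k \<cdot> g k) \<cdot> h k = f \<cdot> \<iota> k"
      using gh[OF k] \<iota>[OF k] f(1) by (simp add: cat_simps)
    then have 1: "(u \<cdot> (f \<cdot> \<iota> k \<cdot> g k)) \<cdot> h k = (u \<cdot> f) \<cdot> \<iota> k"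
      using gh[OF k] \<iota>[OF k] f(1) u by (simp add: cat_simps)
    have 2: "((u \<cdot> f) \<cdot> \<iota> k) \<cdot> g k = u \<cdot> (f \<cdot> \<iota> k \<cdot> g k)"
      using gh[OF k] \<iota>[OF k] f(1) u by (simp add: cat_simps)
    have 3: "(t k \<cdot> h k) \<cdot> g k = t k"
      using gh[OF k] t k by (simp add: cat_simps)
    show "(u \<cdot> (f \<cdot> \<iota> k \<cdot> g k) = t k) = ((u \<cdot> f) \<cdot> \<iota> k = t k \<cdot> h k)"
      using 1 2 3 by metis
  qed
  have "is_coproduct C I A' X (\<lambda>k. f \<cdot> \<iota> k \<cdot> g k)"
    unfolding is_coproduct_def
  proof (intro conjI ballI allI impI)
    show "X \<in> Obj C" using f Hom_simps by blast
    show "A' k \<in> Obj C" "f \<cdot> \<iota> k \<cdot> g k \<in> Hom C (A' k) X" if "k \<in> I" for k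
      using gh[OF that] \<iota>[OF that] f by (auto intro!: Comp_in_Hom dest: Hom_simps)
    fix T t assume T: "T \<in> Obj C" and t: "\<forall>k\<in>I. t k \<in> Hom C (A' k) T"
    have th: "t k \<cdot> h k \<in> Hom C (A k) T" if "k \<in> I" for k
      using t gh that by (auto intro: Comp_in_Hom)
    obtain u where u: "u \<in> Hom C W T" "\<And>k. k \<in> I \<Longrightarrow> u \<cdot> \<iota> k = t k \<cdot> h k"
      using coproduct_desc[OF W th T] by blast
    have uf: "u \<cdot> f' \<in> Hom C X T" "(u \<cdot> f') \<cdot> f = u"
      using u f by (auto simp: cat_simps)
    show "\<exists>!h. h \<in> Hom C X T \<and> (\<forall>k\<in>I. h \<cdot> f \<cdot> \<iota> k \<cdot> g k = t k)"
    proof (intro ex1I conjI)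
      show "\<forall>k\<in>I. (u \<cdot> f') \<cdot> f \<cdot> \<iota> k \<cdot> g k = t k" using eq[OF t uf(1)] uf(2) u by simp
      fix v assume v: "v \<in> Hom C X T \<and> (\<forall>k\<in>I. v \<cdot> f \<cdot> \<iota> k \<cdot> g k = t k)"
      then have "\<forall>k\<in>I. (v \<cdot> f) \<cdot> \<iota> k = t k \<cdot> h k" using eq[OF t] by auto
      then have "v \<cdot> f = u" using coproduct_eqI[OF W] u f v Comp_in_Hom by metis
      then show "v = u \<cdot> f'" using f v by (auto simp: cat_simps)
    qed (fact uf(1))
  qed
  then show ?thesis by blast
qed

lemma product2_pair:
  assumes "is_product2 C X Y P a b" "f \<in> Hom C T X" "g \<in> Hom C T Y"
  obtains h where "h \<in> Hom C T P" "a \<cdot> h = f" "b \<cdot> h = g"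
  using assms Hom_simps(4)[OF assms(2)] unfolding is_product2_def by meson

lemma product2_eqI:
  assumes P: "is_product2 C X Y P a b" and "u \<in> Hom C T P" "v \<in> Hom C T P"
    "a \<cdot> u = a \<cdot> v" "b \<cdot> u = b \<cdot> v"
  shows "u = v"
proof -
  have "a \<cdot> u \<in> Hom C T X" "b \<cdot> u \<in> Hom C T Y" "T \<in> Obj C"
    using assms Hom_simps(4)[OF assms(2)] by (auto simp: is_product2_def intro: Comp_in_Hom)
  then have "\<exists>!h. h \<in> Hom C T P \<and> a \<cdot> h = a \<cdot> u \<and> b \<cdot> h = b \<cdot> u"
    using P unfolding is_product2_def by auto
  then show ?thesis using assms by metis
qed

lemma pullback_lift:
  assumes "is_pullback C f g P p q" "u \<in> Hom C T (Dom C f)" "v \<in> Hom C T (Dom C g)"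
    "f \<cdot> u = g \<cdot> v"
  obtains h where "h \<in> Hom C T P" "p \<cdot> h = u" "q \<cdot> h = v"
  using assms Hom_simps(4)[OF assms(2)] unfolding is_pullback_def by meson

lemma pullback_eqI:
  assumes P: "is_pullback C f g P p q" and u: "u \<in> Hom C T P" and v: "v \<in> Hom C T P"
    and "p \<cdot> u = p \<cdot> v" "q \<cdot> u = q \<cdot> v"
  shows "u = v"
proof -
  have P': "f \<in> Hom C (Dom C f) (Cod C f)" "g \<in> Hom C (Dom C g) (Cod C f)"
    "p \<in> Hom C P (Dom C f)" "q \<in> Hom C P (Dom C g)" "f \<cdot> p = g \<cdot> q"
    using P by (auto simp: is_pullback_def Hom_def)
  have "p \<cdot> u \<in> Hom C T (Dom C f)" "q \<cdot> u \<in> Hom C T (Dom C g)" "T \<in> Obj C"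
    using P' u Hom_simps(4)[OF u] by (auto intro: Comp_in_Hom)
  moreover have "f \<cdot> (p \<cdot> u) = g \<cdot> (q \<cdot> u)"
    using P' u by (simp add: cat_simps Comp_extend[OF P'(5,3,1) u])
  ultimately have "\<exists>!h. h \<in> Hom C T P \<and> p \<cdot> h = p \<cdot> u \<and> q \<cdot> h = q \<cdot> u"
    using P unfolding is_pullback_def by auto
  then show ?thesis using assms by metis
qed

lemma pullbackD:
  assumes "is_pullback C f g P p q" "f \<in> Hom C X Z" "g \<in> Hom C Y Z"
  shows "p \<in> Hom C P X" "q \<in> Hom C P Y" "f \<cdot> p = g \<cdot> q"
  using assms by (auto simp: is_pullback_def Hom_def)

lemma monicD:
  assumes "is_monic C m" "m \<in> Hom C X Y" "u \<in> Hom C T X" "v \<in> Hom C T X" "m \<cdot> u = m \<cdot> v"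
  shows "u = v"
  using assms Hom_simps(4)[OF assms(3)] by (auto simp: is_monic_def Hom_def)

lemma coequalizer_epi:
  assumes Q: "is_coequalizer C f g Q c" and v: "v \<in> Hom C Q T" and w: "w \<in> Hom C Q T"
    and e: "v \<cdot> c = w \<cdot> c"
  shows "v = w"
proof -
  have c: "f \<in> Hom C (Dom C f) (Cod C f)" "g \<in> Hom C (Dom C f) (Cod C f)"
    "c \<in> Hom C (Cod C f) Q" "c \<cdot> f = c \<cdot> g"
    using Q by (auto simp: is_coequalizer_def Hom_def)
  have "v \<cdot> c \<in> Hom C (Cod C f) T" "(v \<cdot> c) \<cdot> f = (v \<cdot> c) \<cdot> g" "T \<in> Obj C"
    using v c Hom_simps(5)[OF v] by (simp_all add: cat_simps)
  then have "\<exists>!h. h \<in> Hom C Q T \<and> h \<cdot> c = v \<cdot> c"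
    using Q unfolding is_coequalizer_def by blast
  then show ?thesis using v w e by metis
qed

end

section \<open>Arrows out of atoms, and arrows between atoms\<close>

context pre_galois
begin

text \<open>An initial W is a coproduct of two copies of itself, both injections being the identity,
  so axiom (c) would count \<open>x\<close> twice, once in each copy.\<close>

lemma no_Hom_atom_initial:
  assumes "is_atom B A" "is_coproduct B {} X W \<iota>" "x \<in> Hom B A W"
  shows False
proof -
  have W: "W \<in> Obj B" using assms by (auto simp: is_coproduct_def)
  have eq: "f = g" if "f \<in> Hom B W T" "g \<in> Hom B W T" for f g T
    using coproduct_eqI[OF assms(2) that] by simp
  have "is_coproduct2 B W W W (Ide B W) (Ide B W)"
    unfolding is_coproduct2_def using W eq
    by (auto simp: Ide_in_Hom Comp_Ide intro!: ex1I[of _ ])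
  from Hom_atom_coproduct[OF assms(1) this]
  have "inj_on (case_sum (\<lambda>f. Ide B W \<cdot> f) (\<lambda>g. Ide B W \<cdot> g)) (Hom B A W <+> Hom B A W)"
    by (simp add: bij_betw_def)
  from inj_onD[OF this, of "Inl x" "Inr x"] show False using assms(3) by auto
qed

text \<open>Axiom (c) speaks of binary coproducts only; splitting off the last summand carries it
  over to n summands by induction.\<close>

lemma coproduct_split:
  assumes W: "is_coproduct B {..<Suc n} X W \<iota>"
  obtains W' \<iota>' j where "is_coproduct B {..<n} X W' \<iota>'" "j \<in> Hom B W' W"
    "is_coproduct2 B W' (X n) W j (\<iota> n)" "\<And>k. k < n \<Longrightarrow> j \<cdot> \<iota>' k = \<iota> k"
proof -
  have X: "X k \<in> Obj B" "\<iota> k \<in> Hom B (X k) W" if "k < Suc n" for k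
    using W that by (auto simp: is_coproduct_def)
  have WO: "W \<in> Obj B" using W by (auto simp: is_coproduct_def)
  obtain W' \<iota>' where W': "is_coproduct B {..<n} X W' \<iota>'"
    using finite_coproducts X unfolding has_finite_coproducts_def by (metis less_SucI)
  have W'O: "W' \<in> Obj B" using W' by (auto simp: is_coproduct_def)
  obtain j where j: "j \<in> Hom B W' W" "\<And>k. k \<in> {..<n} \<Longrightarrow> j \<cdot> \<iota>' k = \<iota> k"
    using coproduct_desc[OF W', of \<iota> W] X WO by auto
  note \<iota>' = coproduct_inj_Hom[OF W']
  have "\<exists>!h. h \<in> Hom B W T \<and> h \<cdot> j = f \<and> h \<cdot> \<iota> n = g"
    if T: "T \<in> Obj B" and f: "f \<in> Hom B W' T" and g: "g \<in> Hom B (X n) T" for T f g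
  proof -
    have "(if k = n then g else f \<cdot> \<iota>' k) \<in> Hom B (X k) T" if "k \<in> {..<Suc n}" for k
      using that f g \<iota>'[of k] Comp_in_Hom by auto
    from coproduct_desc[OF W this T] obtain h where
      h: "h \<in> Hom B W T" "\<And>k. k \<in> {..<Suc n} \<Longrightarrow> h \<cdot> \<iota> k = (if k = n then g else f \<cdot> \<iota>' k)"
      by auto
    have hj: "h \<cdot> j = f"
    proof (rule coproduct_eqI[OF W' _ f])
      show "h \<cdot> j \<in> Hom B W' T" using h j Comp_in_Hom by blast
      fix k assume k: "k \<in> {..<n}"
      then show "(h \<cdot> j) \<cdot> \<iota>' k = f \<cdot> \<iota>' k"
        using h(2)[of k] h(1) j \<iota>'[OF k] by (simp add: Comp_assoc)
    qed
    show ?thesis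
    proof (intro ex1I conjI)
      show "h \<cdot> \<iota> n = g" using h(2)[of n] by simp
      fix h' assume h': "h' \<in> Hom B W T \<and> h' \<cdot> j = f \<and> h' \<cdot> \<iota> n = g"
      show "h' = h"
      proof (rule coproduct_eqI[OF W])
        fix k assume k: "k \<in> {..<Suc n}"
        show "h' \<cdot> \<iota> k = h \<cdot> \<iota> k"
        proof (cases "k = n")
          case False
          then have "k \<in> {..<n}" using k by auto
          then have "(h' \<cdot> j) \<cdot> \<iota>' k = h' \<cdot> \<iota> k"
            using Comp_assoc[OF \<iota>'[of k] j(1), of h' T] h' j(2)[of k] by simp
          then show ?thesis using h(2)[OF k] h' False by simp
        qed (use h(2)[OF k] h' in simp)
      qed (use h h' in auto)
    qed (use h hj in auto)
  qed
  then have "is_coproduct2 B W' (X n) W j (\<iota> n)"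
    unfolding is_coproduct2_def using X j WO W'O by auto
  then show thesis using that[OF W' j(1)] j(2) by auto
qed

lemma atom_coproduct2_cases:
  assumes "is_atom B A" "is_coproduct2 B Y Z W i j" "x \<in> Hom B A W"
  shows "(\<exists>v\<in>Hom B A Y. x = i \<cdot> v) \<or> (\<exists>v\<in>Hom B A Z. x = j \<cdot> v)"
proof -
  have "x \<in> case_sum (\<lambda>f. i \<cdot> f) (\<lambda>g. j \<cdot> g) ` (Hom B A Y <+> Hom B A Z)"
    using Hom_atom_coproduct[OF assms(1,2)] assms(3) by (simp add: bij_betw_def)
  then show ?thesis by auto
qed

lemma atom_coproduct2_inj:
  assumes "is_atom B A" "is_coproduct2 B Y Z W i j"
  shows "\<lbrakk>x \<in> Hom B A Y; v \<in> Hom B A Y; i \<cdot> x = i \<cdot> v\<rbrakk> \<Longrightarrow> x = v"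
    and "\<lbrakk>x \<in> Hom B A Z; v \<in> Hom B A Z; j \<cdot> x = j \<cdot> v\<rbrakk> \<Longrightarrow> x = v"
    and "\<lbrakk>x \<in> Hom B A Y; v \<in> Hom B A Z; i \<cdot> x = j \<cdot> v\<rbrakk> \<Longrightarrow> False"
proof -
  have inj: "inj_on (case_sum (\<lambda>f. i \<cdot> f) (\<lambda>g. j \<cdot> g)) (Hom B A Y <+> Hom B A Z)"
    using Hom_atom_coproduct[OF assms(1,2)] by (simp add: bij_betw_def)
  show "\<lbrakk>x \<in> Hom B A Y; v \<in> Hom B A Y; i \<cdot> x = i \<cdot> v\<rbrakk> \<Longrightarrow> x = v"
    using inj_onD[OF inj, of "Inl x" "Inl v"] by auto
  show "\<lbrakk>x \<in> Hom B A Z; v \<in> Hom B A Z; j \<cdot> x = j \<cdot> v\<rbrakk> \<Longrightarrow> x = v"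
    using inj_onD[OF inj, of "Inr x" "Inr v"] by auto
  show "\<lbrakk>x \<in> Hom B A Y; v \<in> Hom B A Z; i \<cdot> x = j \<cdot> v\<rbrakk> \<Longrightarrow> False"
    using inj_onD[OF inj, of "Inl x" "Inr v"] by auto
qed

lemma atom_coproduct_factor:
  fixes n :: nat
  assumes "is_atom B A" "is_coproduct B {..<n} X W \<iota>" "x \<in> Hom B A W"
  obtains k v where "k < n" "v \<in> Hom B A (X k)" "x = \<iota> k \<cdot> v"
proof -
  have "\<exists>k<n. \<exists>v\<in>Hom B A (X k). x = \<iota> k \<cdot> v"
    using assms(2,3)
  proof (induction n arbitrary: W \<iota> x)
    case 0
    then show ?case using no_Hom_atom_initial[OF assms(1), of X W \<iota> x] by simp
  next
    case (Suc n)
    obtain W' \<iota>' j where W': "is_coproduct B {..<n} X W' \<iota>'" "j \<in> Hom B W' W"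
      "is_coproduct2 B W' (X n) W j (\<iota> n)" "\<And>k. k < n \<Longrightarrow> j \<cdot> \<iota>' k = \<iota> k"
      using coproduct_split[OF Suc.prems(1)] by blast
    consider v where "v \<in> Hom B A W'" "x = j \<cdot> v" | v where "v \<in> Hom B A (X n)" "x = \<iota> n \<cdot> v"
      using atom_coproduct2_cases[OF assms(1) W'(3) Suc.prems(2)] by blast
    then show ?case
    proof cases
      case 1
      obtain k w where kw: "k < n" "w \<in> Hom B A (X k)" "v = \<iota>' k \<cdot> w"
        using Suc.IH[OF W'(1) 1(1)] by blast
      then have "x = \<iota> k \<cdot> w"
        using 1 W'(2) coproduct_inj_Hom[OF W'(1), of k] W'(4)[of k, symmetric]
        by (simp add: cat_simps)
      then show ?thesis using kw by (intro exI[of _ k]) auto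
    qed auto
  qed
  then show thesis using that by blast
qed

lemma atom_coproduct_inj:
  fixes n :: nat
  assumes "is_atom B A" "is_coproduct B {..<n} X W \<iota>" "k < n" "l < n"
    "x \<in> Hom B A (X k)" "v \<in> Hom B A (X l)" "\<iota> k \<cdot> x = \<iota> l \<cdot> v"
  shows "k = l \<and> x = v"
  using assms(2-)
proof (induction n arbitrary: W \<iota>)
  case (Suc n)
  obtain W' \<iota>' j where W': "is_coproduct B {..<n} X W' \<iota>'" "j \<in> Hom B W' W"
    "is_coproduct2 B W' (X n) W j (\<iota> n)" "\<And>k. k < n \<Longrightarrow> j \<cdot> \<iota>' k = \<iota> k"
    using coproduct_split[OF Suc.prems(1)] by blast
  have *: "\<iota> m \<cdot> w = j \<cdot> (\<iota>' m \<cdot> w)" "\<iota>' m \<cdot> w \<in> Hom B A W'"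
    if "m < n" "w \<in> Hom B A (X m)" for m w
    using that W'(2) coproduct_inj_Hom[OF W'(1), of m] W'(4)[of m, symmetric]
    by (simp_all add: cat_simps)
  note inj = atom_coproduct2_inj[OF assms(1) W'(3)]
  consider "k < n" "l < n" | "k < n" "l = n" | "k = n" "l < n" | "k = n" "l = n"
    using Suc.prems by linarith
  then show ?case
  proof cases
    case 1
    have "\<iota>' k \<cdot> x = \<iota>' l \<cdot> v"
      using inj(1)[OF *(2)[OF 1(1) Suc.prems(4)] *(2)[OF 1(2) Suc.prems(5)]]
        *(1)[OF 1(1) Suc.prems(4)] *(1)[OF 1(2) Suc.prems(5)] Suc.prems(6) by simp
    then show ?thesis using Suc.IH[OF W'(1) 1] Suc.prems by simp
  next
    case 2
    then show ?thesis using inj(3) * Suc.prems by metis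
  next
    case 3
    then show ?thesis using inj(3) * Suc.prems by metis
  next
    case 4
    then show ?thesis using inj(2) Suc.prems by metis
  qed
qed simp

lemma decomposition:
  assumes "X \<in> Obj B"
  obtains n A \<iota> where "\<And>k. k < (n::nat) \<Longrightarrow> is_atom B (A k)" "is_coproduct B {..<n} A X \<iota>"
proof -
  obtain n :: nat and A W \<iota> where A: "\<forall>k<n. is_atom B (A k)" "is_coproduct B {..<n} A W \<iota>"
    "isomorphic B X W"
    using atomic_decomposition[OF assms] by blast
  obtain f g where "f \<in> Hom B X W" "g \<in> Hom B W X" "g \<cdot> f = Ide B X" "f \<cdot> g = Ide B W"
    using A(3) by (rule isomorphicE)
  moreover have "isomorphic B (A k) (A k)" if "k \<in> {..<n}" for k
    using A(1) that by (auto simp: is_atom_def intro: isomorphic_refl)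
  ultimately show thesis
    using coproduct_isomorphic[OF A(2), of g X f A] A(1) that by blast
qed

lemma atom_cover_eqI:
  assumes "x \<in> Hom B X Y" "v \<in> Hom B X Y"
    and "\<And>A s. is_atom B A \<Longrightarrow> s \<in> Hom B A X \<Longrightarrow> x \<cdot> s = v \<cdot> s"
  shows "x = v"
proof -
  obtain n A \<iota> where "\<And>k. k < (n::nat) \<Longrightarrow> is_atom B (A k)" "is_coproduct B {..<n} A X \<iota>"
    using decomposition Hom_simps(4)[OF assms(1)] by metis
  then show ?thesis
    using coproduct_eqI[OF _ assms(1,2)] assms(3) coproduct_inj_Hom by (metis lessThan_iff)
qed

text \<open>Atoms jointly cover every object, hence cancellation need only be tested on arrows out
  of atoms.\<close>

lemma monic_atomI:
  assumes m: "m \<in> Hom B X Y"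
    and inj: "\<And>A x v. \<lbrakk>is_atom B A; x \<in> Hom B A X; v \<in> Hom B A X; m \<cdot> x = m \<cdot> v\<rbrakk> \<Longrightarrow> x = v"
  shows "is_monic B m"
  unfolding is_monic_def
proof (intro conjI ballI impI)
  show "m \<in> Arr B" using m Hom_simps by blast
  fix T x v assume *: "T \<in> Obj B" "x \<in> Hom B T (Dom B m)" "v \<in> Hom B T (Dom B m)" "m \<cdot> x = m \<cdot> v"
  have uv: "x \<in> Hom B T X" "v \<in> Hom B T X" using * m Hom_simps by auto
  then show "x = v"
  proof (rule atom_cover_eqI)
    fix A s assume A: "is_atom B A" "s \<in> Hom B A T"
    have "m \<cdot> (x \<cdot> s) = m \<cdot> (v \<cdot> s)"
      using Comp_extend[OF *(4) uv(1) m A(2)] m uv A(2) by (simp add: cat_simps)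
    then show "x \<cdot> s = v \<cdot> s" using inj[OF A(1)] uv A(2) Comp_in_Hom by blast
  qed
qed

lemma nonempty_atom:
  assumes "X \<in> Obj B" "\<not> is_empty_obj B X"
  obtains A s where "is_atom B A" "s \<in> Hom B A X"
proof -
  obtain n A \<iota> where A: "\<And>k. k < (n::nat) \<Longrightarrow> is_atom B (A k)" "is_coproduct B {..<n} A X \<iota>"
    using decomposition[OF assms(1)] by metis
  have "n \<noteq> 0"
  proof
    assume "n = 0"
    then have "is_coproduct B {} A X \<iota>" using A(2) by simp
    then have "is_initial B X" unfolding is_coproduct_def is_initial_def by simp
    moreover have "isomorphic B X X"
      using assms(1) by (rule isomorphic_refl)
    ultimately show False using assms(2) by (auto simp: is_empty_obj_def)
  qed
  then show thesis using that[of "A 0" "\<iota> 0"] A coproduct_inj_Hom[OF A(2), of 0] by auto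
qed

lemma pullback_exists:
  assumes "f \<in> Hom B X Z" "g \<in> Hom B Y Z"
  obtains P p q where "is_pullback B f g P p q"
  using fiber_products assms unfolding has_fiber_products_def by (metis Hom_simps(1,3))

text \<open>By (f) the fibre product is non-empty, and a non-empty object receives an arrow from an
  atom, since an empty decomposition would make it initial.\<close>

lemma atom_amalgamation:
  assumes "is_atom B X" "is_atom B Y" "is_atom B Z" "f \<in> Hom B X Z" "g \<in> Hom B Y Z"
  obtains A p q where "is_atom B A" "p \<in> Hom B A X" "q \<in> Hom B A Y" "f \<cdot> p = g \<cdot> q"
proof -
  obtain P p q where P: "is_pullback B f g P p q" using pullback_exists[OF assms(4,5)] .
  note pq = pullbackD[OF P assms(4,5)]
  have "\<not> is_empty_obj B P" using fiber_product_atoms_nonempty[OF assms P] .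
  then obtain A s where "is_atom B A" "s \<in> Hom B A P"
    using nonempty_atom Hom_simps(4)[OF pq(1)] by metis
  then show thesis using that[of A "p \<cdot> s" "q \<cdot> s"] pq assms
    by (simp add: cat_simps Comp_extend[OF pq(3,1) assms(4)])
qed

text \<open>Amalgamation over the final object, which is an atom by (g).\<close>

lemma atom_joint_cover:
  assumes "is_atom B X" "is_atom B Y"
  obtains A p q where "is_atom B A" "p \<in> Hom B A X" "q \<in> Hom B A Y"
proof -
  obtain T where T: "is_final B T" using final_exists by blast
  moreover obtain f g where "f \<in> Hom B X T" "g \<in> Hom B Y T"
    using T assms unfolding is_final_def is_atom_def by metis
  ultimately show thesis using atom_amalgamation[OF assms final_atom[OF T]] that by metis
qed

lemma product_exists:
  assumes "X \<in> Obj B" "Y \<in> Obj B"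
  obtains P a b where "is_product2 B X Y P a b"
proof -
  obtain T where T: "is_final B T" using final_exists by blast
  obtain f g where f: "f \<in> Hom B X T" and g: "g \<in> Hom B Y T"
    using T assms unfolding is_final_def by metis
  obtain P p q where P: "is_pullback B f g P p q" using pullback_exists[OF f g] .
  have "f \<cdot> x = g \<cdot> v" if "x \<in> Hom B S X" "v \<in> Hom B S Y" for S x v
    using T f g that Comp_in_Hom unfolding is_final_def by (metis Hom_simps(4))
  then have "is_product2 B X Y P p q"
    using P f g assms unfolding is_pullback_def is_product2_def
    by (auto simp: Hom_simps dest: Hom_simps)
  then show thesis using that by blast
qed

text \<open>A summand of Q is again mapped monically to A, so (e) makes this map invertible and
  yields a section of \<open>h\<close>; a monomorphism with a section is an isomorphism. The arrow
  \<open>t\<close> serves to show that Q has a summand.\<close>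

lemma monic_onto_atom:
  assumes h: "h \<in> Hom B Q A" "is_monic B h" and A: "is_atom B A"
    and t: "is_atom B T" "t \<in> Hom B T Q"
  obtains s where "s \<in> Hom B A Q" "s \<cdot> h = Ide B Q" "h \<cdot> s = Ide B A"
proof -
  have Q: "Q \<in> Obj B" using Hom_simps(4)[OF h(1)] .
  obtain n D \<iota> where D: "\<And>k. k < (n::nat) \<Longrightarrow> is_atom B (D k)" "is_coproduct B {..<n} D Q \<iota>"
    using decomposition[OF Q] by metis
  obtain k where k: "k < n" using atom_coproduct_factor[OF t(1) D(2) t(2)] by blast
  have \<iota>: "\<iota> k \<in> Hom B (D k) Q" using coproduct_inj_Hom[OF D(2)] k by simp
  have h\<iota>: "h \<cdot> \<iota> k \<in> Hom B (D k) A" using Comp_in_Hom[OF \<iota> h(1)] .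
  have "is_monic B (h \<cdot> \<iota> k)"
  proof (rule monic_atomI[OF h\<iota>])
    fix T r s assume T: "is_atom B T" "r \<in> Hom B T (D k)" "s \<in> Hom B T (D k)"
      "(h \<cdot> \<iota> k) \<cdot> r = (h \<cdot> \<iota> k) \<cdot> s"
    then have "h \<cdot> (\<iota> k \<cdot> r) = h \<cdot> (\<iota> k \<cdot> s)"
      using Comp_assoc[OF T(2) \<iota> h(1)] Comp_assoc[OF T(3) \<iota> h(1)] by simp
    then have "\<iota> k \<cdot> r = \<iota> k \<cdot> s"
      using monicD[OF h(2,1) Comp_in_Hom[OF T(2) \<iota>] Comp_in_Hom[OF T(3) \<iota>]] by simp
    then show "r = s" using atom_coproduct_inj[OF T(1) D(2) k k T(2,3)] by simp
  qed
  then have "is_iso B (h \<cdot> \<iota> k)" using monic_atoms_iso[OF D(1)[OF k] A h\<iota>] by simp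
  then obtain r where r: "r \<in> Hom B A (D k)" "(h \<cdot> \<iota> k) \<cdot> r = Ide B A"
    using h\<iota> by (auto simp: is_iso_def Hom_simps)
  have s: "\<iota> k \<cdot> r \<in> Hom B A Q" "h \<cdot> (\<iota> k \<cdot> r) = Ide B A"
    using r Comp_in_Hom[OF r(1) \<iota>] Comp_assoc[OF r(1) \<iota> h(1)] by simp_all
  have "h \<cdot> ((\<iota> k \<cdot> r) \<cdot> h) = h \<cdot> Ide B Q"
    using Comp_extend[OF s(2,1) h(1,1)] Ide_Comp[OF h(1)] Comp_Ide[OF h(1)] by simp
  then have "(\<iota> k \<cdot> r) \<cdot> h = Ide B Q"
    using monicD[OF h(2,1) Comp_in_Hom[OF h(1) s(1)] Ide_in_Hom[OF Q]] by simp
  then show thesis using that s by blast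
qed

text \<open>The equalizer of \<open>f\<close> and \<open>g\<close> is a subobject of the atom \<open>W\<close>; once non-empty, it is all
  of \<open>W\<close>.\<close>

lemma atom_epi:
  assumes Z: "is_atom B Z" and W: "is_atom B W" and \<alpha>: "\<alpha> \<in> Hom B Z W"
    and f: "f \<in> Hom B W X" and g: "g \<in> Hom B W X" and eq: "f \<cdot> \<alpha> = g \<cdot> \<alpha>"
  shows "f = g"
proof -
  have O: "W \<in> Obj B" "X \<in> Obj B" using f Hom_simps by blast+
  \<comment> \<open>The equalizer is formed as the fibre product of the graphs F = (1, f) and H =
    (1, g) in W x X; composing with \<open>a\<close> shows that its two projections
    coincide.\<close>
  obtain P a b where P: "is_product2 B W X P a b" using product_exists[OF O] .
  have ab: "a \<in> Hom B P W" "b \<in> Hom B P X" using P by (auto simp: is_product2_def)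
  note I = Ide_in_Hom[OF O(1)]
  obtain F where F: "F \<in> Hom B W P" "a \<cdot> F = Ide B W" "b \<cdot> F = f" using product2_pair[OF P I f] .
  obtain H where H: "H \<in> Hom B W P" "a \<cdot> H = Ide B W" "b \<cdot> H = g" using product2_pair[OF P I g] .
  obtain K p q where K: "is_pullback B F H K p q" using pullback_exists[OF F(1) H(1)] .
  note pq = pullbackD[OF K F(1) H(1)]
  have pq_eq: "p = q"
    using pq ab F(1) H(1) Comp_extend[OF F(2,1) ab(1) pq(1)] Comp_extend[OF H(2,1) ab(1) pq(2)]
    by (simp add: cat_simps)
  have fg: "f \<cdot> p = g \<cdot> p"
    using pq ab F(1) H(1) Comp_extend[OF F(3,1) ab(2) pq(1)] Comp_extend[OF H(3,1) ab(2) pq(2)] pq_eq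
    by (simp add: cat_simps)
  have "F \<cdot> \<alpha> = H \<cdot> \<alpha>"
    by (rule product2_eqI[OF P]) (use F(1) H(1) \<alpha> eq Comp_extend[OF F(2,1) ab(1) \<alpha>]
        Comp_extend[OF H(2,1) ab(1) \<alpha>]
        Comp_extend[OF F(3,1) ab(2) \<alpha>] Comp_extend[OF H(3,1) ab(2) \<alpha>]
        in \<open>auto simp: cat_simps\<close>)
  then obtain h where h: "h \<in> Hom B Z K"
    using pullback_lift[OF K, of \<alpha> Z \<alpha>] \<alpha> F H Hom_simps by metis
  have "is_monic B p"
    by (rule monic_atomI[OF pq(1)]) (use pullback_eqI[OF K] pq_eq in blast)
  then obtain s where s: "s \<in> Hom B W K" "p \<cdot> s = Ide B W"
    using monic_onto_atom[OF pq(1) _ W Z h] by metis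
  show ?thesis
    using Comp_extend[OF fg pq(1) f s(1)] Comp_assoc[OF s(1) pq(1) g] s(2) Comp_Ide[OF f] Comp_Ide[OF g]
    by simp
qed

text \<open>The coproduct of n copies of the final object receives n distinct arrows from it by (c),
  so there are infinitely many arrows between representatives, and \<open>'u\<close>, into which
  they inject, is infinite. This leaves room for coding words.\<close>

lemma infinite_universe:
  obtains S e where "S \<subseteq> Obj B" "\<forall>X \<in> Obj B. \<exists>Y \<in> S. isomorphic B X Y"
    "inj_on (e :: 'a \<Rightarrow> 'u) {f \<in> Arr B. Dom B f \<in> S \<and> Cod B f \<in> S}" "infinite (UNIV :: 'u set)"
proof -
  obtain S and e :: "'a \<Rightarrow> 'u" where S: "S \<subseteq> Obj B" "\<forall>X \<in> Obj B. \<exists>Y \<in> S. isomorphic B X Y"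
    "inj_on e {f \<in> Arr B. Dom B f \<in> S \<and> Cod B f \<in> S}"
    using essentially_small unfolding essentially_small_def by blast
  let ?M = "{f \<in> Arr B. Dom B f \<in> S \<and> Cod B f \<in> S}"
  have "infinite ?M"
  proof
    assume fin: "finite ?M"
    \<comment> \<open>One copy more than there would be arrows between representatives.\<close>
    define n where "n = Suc (card ?M)"
    obtain T where T: "is_final B T" using final_exists by blast
    then have TO: "T \<in> Obj B" by (simp add: is_final_def)
    obtain W \<iota> where W: "is_coproduct B {..<n} (\<lambda>_. T) W \<iota>"
      using finite_coproducts TO unfolding has_finite_coproducts_def by metis
    have "W \<in> Obj B" using W by (simp add: is_coproduct_def)
    then obtain Y V where Y: "Y \<in> S" "isomorphic B W Y" and V: "V \<in> S" "isomorphic B T V"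
      using S TO by meson
    obtain f f' where f: "f \<in> Hom B W Y" "f' \<in> Hom B Y W" "f' \<cdot> f = Ide B W"
      using Y(2) isomorphicE by metis
    obtain g g' where g: "g \<in> Hom B T V" "g' \<in> Hom B V T" "g' \<cdot> g = Ide B T"
      using V(2) isomorphicE by metis
    have \<iota>: "\<iota> k \<in> Hom B T W" if "k < n" for k using coproduct_inj_Hom[OF W] that by simp
    have "inj_on (\<lambda>k. f \<cdot> (\<iota> k \<cdot> g')) {..<n}"
    proof (rule inj_onI)
      fix k l assume kl: "k \<in> {..<n}" "l \<in> {..<n}" "f \<cdot> (\<iota> k \<cdot> g') = f \<cdot> (\<iota> l \<cdot> g')"
      have "f' \<cdot> (f \<cdot> (\<iota> m \<cdot> g')) = \<iota> m \<cdot> g'" if "m < n" for m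
        using f(1,2) \<iota>[OF that] g(2) Comp_extend[OF f(3,1,2), of "\<iota> m \<cdot> g'"]
        by (simp add: cat_simps)
      then have "\<iota> k \<cdot> g' = \<iota> l \<cdot> g'" using kl by (metis lessThan_iff)
      then show "k = l"
        using atom_coproduct_inj[OF is_atom_isomorphic[OF final_atom[OF T] V(2)] W, of k l g' g'] kl g
        by simp
    qed
    moreover have "(\<lambda>k. f \<cdot> (\<iota> k \<cdot> g')) ` {..<n} \<subseteq> ?M"
    proof safe
      fix k assume "k < n"
      then have "f \<cdot> (\<iota> k \<cdot> g') \<in> Hom B V Y" using f g \<iota> Comp_in_Hom by metis
      then show "f \<cdot> \<iota> k \<cdot> g' \<in> Arr B" "Dom B (f \<cdot> \<iota> k \<cdot> g') \<in> S" "Cod B (f \<cdot> \<iota> k \<cdot> g') \<in> S"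
        using Y V by (auto simp: Hom_def)
    qed
    ultimately have "card {..<n} \<le> card ?M" by (rule card_inj_on_le[OF _ _ fin])
    then show False by (simp add: n_def)
  qed
  then have "infinite (e ` ?M)" using S(3) by (simp add: finite_image_iff)
  then have "infinite (UNIV :: 'u set)" using finite_subset[OF subset_UNIV] by blast
  then show thesis using that[OF S] by blast
qed

end

text \<open>Several members of \<open>At\<close> may be isomorphic. Points are attached to members
  of \<open>At\<close> only, which keeps the names within what \<open>'u\<close> can code.\<close>

locale atom_representatives = pre_galois u B
  for u :: "'u itself" and B :: "('o, 'a, 'm) cat_scheme" (structure) +
  fixes At :: "'o set"
  assumes At_atom: "A \<in> At \<Longrightarrow> is_atom B A"
    and At_rep: "is_atom B X \<Longrightarrow> \<exists>A \<in> At. isomorphic B X A"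
begin

lemma At_decomposition:
  assumes X: "X \<in> Obj B"
  obtains n A \<iota> where "\<And>k. k < (n::nat) \<Longrightarrow> A k \<in> At" "is_coproduct B {..<n} A X \<iota>"
proof -
  obtain n A \<iota> where A: "\<And>k. k < (n::nat) \<Longrightarrow> is_atom B (A k)" "is_coproduct B {..<n} A X \<iota>"
    using decomposition[OF X] by metis
  have "\<forall>k. \<exists>C. k < n \<longrightarrow> C \<in> At \<and> isomorphic B (A k) C" using At_rep A(1) by blast
  then obtain A' where A': "\<forall>k. k < n \<longrightarrow> A' k \<in> At \<and> isomorphic B (A k) (A' k)"
    by metis
  have "isomorphic B (A' k) (A k)" if "k \<in> {..<n}" for k using A' that isomorphic_sym by auto
  from coproduct_isomorphic[OF A(2) _ _ _ _ this, of "Ide B X" X "Ide B X"] X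
  obtain \<kappa> where "is_coproduct B {..<n} A' X \<kappa>" by (auto simp: cat_simps)
  then show thesis using that A' by blast
qed

lemma At_Obj: "A \<in> At \<Longrightarrow> A \<in> Obj B"
  using At_atom by (auto simp: is_atom_def)

end

section \<open>Equivalences and sets with group action\<close>

text \<open>The inverse functor chooses a preimage of each object and conjugates arrows by the
  chosen isomorphisms. Equations in C are checked after applying the faithful functor.\<close>

lemma equivalent_categoriesI:
  fixes C :: "('o, 'a, 'm) cat_scheme" and D :: "('p, 'b, 'n) cat_scheme"
  assumes C: "category C" and D: "category D" and func: "is_functor C D Fo Fa"
    and faithful: "\<And>X Y f g. \<lbrakk>f \<in> Hom C X Y; g \<in> Hom C X Y; Fa f = Fa g\<rbrakk> \<Longrightarrow> f = g"
    and full: "\<And>X Y h. \<lbrakk>X \<in> Obj C; Y \<in> Obj C; h \<in> Hom D (Fo X) (Fo Y)\<rbrakk> \<Longrightarrow> \<exists>f \<in> Hom C X Y. Fa f = h"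
    and ess_surj: "\<And>Y. Y \<in> Obj D \<Longrightarrow> \<exists>X \<in> Obj C. isomorphic D (Fo X) Y"
  shows "equivalent_categories C D"
proof -
  interpret C: category C by (rule C)
  interpret D: category D by (rule D)
  have Fo: "Fo X \<in> Obj D" "Fa (Ide C X) = Ide D (Fo X)" if "X \<in> Obj C" for X
    using func that by (auto simp: is_functor_def)
  have Fa: "Fa f \<in> Hom D (Fo X) (Fo Y)" if "f \<in> Hom C X Y" for f X Y
    using func that by (auto simp: is_functor_def Hom_def)
  have Fa_Comp: "Fa (g \<cdot>\<^bsub>C\<^esub> f) = Fa g \<cdot>\<^bsub>D\<^esub> Fa f" if "f \<in> Hom C X Y" "g \<in> Hom C Y Z" for f g X Y Z
    using func that by (auto simp: is_functor_def Hom_def)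
  have "\<forall>Y. \<exists>X e e'. Y \<in> Obj D \<longrightarrow> X \<in> Obj C \<and> e \<in> Hom D (Fo X) Y \<and> e' \<in> Hom D Y (Fo X) \<and>
      e' \<cdot>\<^bsub>D\<^esub> e = Ide D (Fo X) \<and> e \<cdot>\<^bsub>D\<^esub> e' = Ide D Y"
    using ess_surj D.isomorphicE by metis
  then obtain Go e e' where "\<forall>Y. Y \<in> Obj D \<longrightarrow> Go Y \<in> Obj C \<and> e Y \<in> Hom D (Fo (Go Y)) Y \<and>
      e' Y \<in> Hom D Y (Fo (Go Y)) \<and> e' Y \<cdot>\<^bsub>D\<^esub> e Y = Ide D (Fo (Go Y)) \<and> e Y \<cdot>\<^bsub>D\<^esub> e' Y = Ide D Y"
    by metis
  then have Go: "Go Y \<in> Obj C" and e: "e Y \<in> Hom D (Fo (Go Y)) Y" "e' Y \<in> Hom D Y (Fo (Go Y))"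
      "e' Y \<cdot>\<^bsub>D\<^esub> e Y = Ide D (Fo (Go Y))" "e Y \<cdot>\<^bsub>D\<^esub> e' Y = Ide D Y" if "Y \<in> Obj D" for Y
    using that by auto
  define Ga where "Ga g = (SOME f. f \<in> Hom C (Go (Dom D g)) (Go (Cod D g)) \<and>
      Fa f = e' (Cod D g) \<cdot>\<^bsub>D\<^esub> (g \<cdot>\<^bsub>D\<^esub> e (Dom D g)))" for g
  have Ga: "Ga g \<in> Hom C (Go Y) (Go Z)" "Fa (Ga g) = e' Z \<cdot>\<^bsub>D\<^esub> (g \<cdot>\<^bsub>D\<^esub> e Y)"
    if g: "g \<in> Hom D Y Z" for g Y Z
  proof -
    have O: "Y \<in> Obj D" "Z \<in> Obj D" using D.Hom_simps g by blast+
    have "e' Z \<cdot>\<^bsub>D\<^esub> (g \<cdot>\<^bsub>D\<^esub> e Y) \<in> Hom D (Fo (Go Y)) (Fo (Go Z))"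
      using e(1)[OF O(1)] e(2)[OF O(2)] g by (simp add: D.cat_simps)
    then have "\<exists>f. f \<in> Hom C (Go Y) (Go Z) \<and> Fa f = e' Z \<cdot>\<^bsub>D\<^esub> (g \<cdot>\<^bsub>D\<^esub> e Y)"
      using full Go O by blast
    from someI_ex[OF this]
    show "Ga g \<in> Hom C (Go Y) (Go Z)" "Fa (Ga g) = e' Z \<cdot>\<^bsub>D\<^esub> (g \<cdot>\<^bsub>D\<^esub> e Y)"
      using g by (auto simp: Ga_def D.Hom_simps)
  qed
  have "\<exists>h. h \<in> Hom C X (Go (Fo X)) \<and> Fa h = e' (Fo X)" if "X \<in> Obj C" for X
    using full[OF that Go[OF Fo(1)[OF that]] e(2)[OF Fo(1)[OF that]]] by blast
  then obtain \<eta> where \<eta>: "\<And>X. X \<in> Obj C \<Longrightarrow> \<eta> X \<in> Hom C X (Go (Fo X)) \<and> Fa (\<eta> X) = e' (Fo X)"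
    by metis
  have "\<exists>h. h \<in> Hom C (Go (Fo X)) X \<and> Fa h = e (Fo X)" if "X \<in> Obj C" for X
    using full[OF Go[OF Fo(1)[OF that]] that e(1)[OF Fo(1)[OF that]]] by blast
  then obtain \<eta>' where \<eta>': "\<And>X. X \<in> Obj C \<Longrightarrow> \<eta>' X \<in> Hom C (Go (Fo X)) X \<and> Fa (\<eta>' X) = e (Fo X)"
    by metis
  have G_functor: "is_functor D C Go Ga"
    unfolding is_functor_def
  proof (intro conjI ballI impI)
    fix Y assume Y: "Y \<in> Obj D"
    show "Go Y \<in> Obj C" by (rule Go[OF Y])
    have I: "Ide D Y \<in> Hom D Y Y" by (rule D.Ide_in_Hom[OF Y])
    show "Ga (Ide D Y) = Ide C (Go Y)"
      by (rule faithful[OF Ga(1)[OF I] C.Ide_in_Hom[OF Go[OF Y]]])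
        (use Ga(2)[OF I] e[OF Y] Fo Go[OF Y] D.Ide_Comp in simp)
  next
    fix g assume g: "g \<in> Arr D"
    then show "Ga g \<in> Hom C (Go (Dom D g)) (Go (Cod D g))" using Ga(1)[of g] by (simp add: Hom_def)
    fix h assume h: "h \<in> Arr D" "Cod D g = Dom D h"
    have g': "g \<in> Hom D (Dom D g) (Cod D g)" and h': "h \<in> Hom D (Cod D g) (Cod D h)"
      using g h by (simp_all add: Hom_def)
    have O: "Dom D g \<in> Obj D" "Cod D g \<in> Obj D" "Cod D h \<in> Obj D" using g h
        by (simp_all add: D.cat_simps)
    have hg: "h \<cdot>\<^bsub>D\<^esub> g \<in> Hom D (Dom D g) (Cod D h)" by (rule D.Comp_in_Hom[OF g' h'])
    have ge: "g \<cdot>\<^bsub>D\<^esub> e (Dom D g) \<in> Hom D (Fo (Go (Dom D g))) (Cod D g)"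
      using D.Comp_in_Hom[OF e(1)[OF O(1)] g'] .
    show "Ga (h \<cdot>\<^bsub>D\<^esub> g) = Ga h \<cdot>\<^bsub>C\<^esub> Ga g"
    proof (rule faithful[OF Ga(1)[OF hg] C.Comp_in_Hom[OF Ga(1)[OF g'] Ga(1)[OF h']]])
      have "Fa (Ga h \<cdot>\<^bsub>C\<^esub> Ga g) =
          e' (Cod D h) \<cdot>\<^bsub>D\<^esub> (h \<cdot>\<^bsub>D\<^esub> (e (Cod D g) \<cdot>\<^bsub>D\<^esub> (e' (Cod D g) \<cdot>\<^bsub>D\<^esub> (g \<cdot>\<^bsub>D\<^esub> e (Dom D g)))))"
        using Fa_Comp[OF Ga(1)[OF g'] Ga(1)[OF h']] Ga(2)[OF g'] Ga(2)[OF h'] e[OF O(1)] e[OF O(2)]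
          e[OF O(3)] g' h' by (simp add: D.cat_simps)
      also have "e (Cod D g) \<cdot>\<^bsub>D\<^esub> (e' (Cod D g) \<cdot>\<^bsub>D\<^esub> (g \<cdot>\<^bsub>D\<^esub> e (Dom D g))) = g \<cdot>\<^bsub>D\<^esub> e (Dom D g)"
        using D.Comp_extend[OF e(4,2,1)[OF O(2)] ge] D.Ide_Comp[OF ge] by simp
      finally show "Fa (Ga (h \<cdot>\<^bsub>D\<^esub> g)) = Fa (Ga h \<cdot>\<^bsub>C\<^esub> Ga g)"
        using Ga(2)[OF hg] D.Comp_assoc[OF e(1)[OF O(1)] g' h'] by simp
    qed
  qed
  have \<eta>_iso: "is_iso C (\<eta> X)" if X: "X \<in> Obj C" for X
  proof -
    note h = \<eta>[OF X, THEN conjunct1] \<eta>'[OF X, THEN conjunct1]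
    note O = Fo(1)[OF X]
    have "\<eta>' X \<cdot>\<^bsub>C\<^esub> \<eta> X = Ide C X"
      by (rule faithful[OF C.Comp_in_Hom[OF h] C.Ide_in_Hom[OF X]])
        (use Fa_Comp[OF h] \<eta>[OF X] \<eta>'[OF X] e[OF O] Fo[OF X] in simp)
    moreover have "\<eta> X \<cdot>\<^bsub>C\<^esub> \<eta>' X = Ide C (Go (Fo X))"
      by (rule faithful[OF C.Comp_in_Hom[OF h(2,1)] C.Ide_in_Hom[OF Go[OF O]]])
        (use Fa_Comp[OF h(2,1)] \<eta>[OF X] \<eta>'[OF X] e[OF O] Fo(2)[OF Go[OF O]] in simp)
    ultimately show ?thesis using h by (auto simp: is_iso_def Hom_def)
  qed
  have "is_natural_iso C C (\<lambda>X. X) (\<lambda>f. f) (\<lambda>X. Go (Fo X)) (\<lambda>f. Ga (Fa f)) \<eta>"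
    unfolding is_natural_iso_def
  proof (intro conjI ballI)
    fix f assume f: "f \<in> Arr C"
    have f': "f \<in> Hom C (Dom C f) (Cod C f)" using f by (simp add: Hom_def)
    have O: "Dom C f \<in> Obj C" "Cod C f \<in> Obj C" using f by (simp_all add: C.cat_simps)
    note \<eta>1 = \<eta>[OF O(1), THEN conjunct1] and \<eta>2 = \<eta>[OF O(2), THEN conjunct1]
    note Ff = Fa[OF f'] and O' = Fo(1)[OF O(1)] Fo(1)[OF O(2)]
    show "\<eta> (Cod C f) \<cdot>\<^bsub>C\<^esub> f = Ga (Fa f) \<cdot>\<^bsub>C\<^esub> \<eta> (Dom C f)"
    proof (rule faithful[OF C.Comp_in_Hom[OF f' \<eta>2] C.Comp_in_Hom[OF \<eta>1 Ga(1)[OF Ff]]])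
      have "Fa (Ga (Fa f) \<cdot>\<^bsub>C\<^esub> \<eta> (Dom C f)) =
          e' (Fo (Cod C f)) \<cdot>\<^bsub>D\<^esub> (Fa f \<cdot>\<^bsub>D\<^esub> (e (Fo (Dom C f)) \<cdot>\<^bsub>D\<^esub> e' (Fo (Dom C f))))"
        using Fa_Comp[OF \<eta>1 Ga(1)[OF Ff]] Ga(2)[OF Ff] \<eta>[OF O(1)] Ff e(1,2)[OF O'(1)] e(2)[OF O'(2)]
        by (simp add: D.cat_simps)
      also have "\<dots> = Fa (\<eta> (Cod C f) \<cdot>\<^bsub>C\<^esub> f)"
        using Fa_Comp[OF f' \<eta>2] \<eta>[OF O(2)] e(4)[OF O'(1)] D.Comp_Ide[OF Ff] by simp
      finally show "Fa (\<eta> (Cod C f) \<cdot>\<^bsub>C\<^esub> f) = Fa (Ga (Fa f) \<cdot>\<^bsub>C\<^esub> \<eta> (Dom C f))" by simp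
    qed
  qed (use \<eta> \<eta>_iso in auto)
  moreover have "is_natural_iso D D (\<lambda>Y. Fo (Go Y)) (\<lambda>g. Fa (Ga g)) (\<lambda>Y. Y) (\<lambda>g. g) e"
    unfolding is_natural_iso_def
  proof (intro conjI ballI)
    fix Y assume Y: "Y \<in> Obj D"
    show "e Y \<in> Hom D (Fo (Go Y)) Y" by (rule e(1)[OF Y])
    show "is_iso D (e Y)" using e[OF Y] by (auto simp: is_iso_def Hom_def)
  next
    fix g assume g: "g \<in> Arr D"
    have g': "g \<in> Hom D (Dom D g) (Cod D g)" using g by (simp add: Hom_def)
    have O: "Dom D g \<in> Obj D" "Cod D g \<in> Obj D" using g by (simp_all add: D.cat_simps)
    note ge = D.Comp_in_Hom[OF e(1)[OF O(1)] g']
    show "e (Cod D g) \<cdot>\<^bsub>D\<^esub> Fa (Ga g) = g \<cdot>\<^bsub>D\<^esub> e (Dom D g)"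
      using D.Comp_extend[OF e(4,2,1)[OF O(2)] ge] D.Ide_Comp[OF ge] Ga(2)[OF g'] by simp
  qed
  ultimately show ?thesis
    unfolding equivalent_categories_def using func G_functor by blast
qed

lemma SG_isomorphicI:
  assumes X: "X \<in> smooth_gsets G \<tau>" and Y: "Y \<in> smooth_gsets G \<tau>"
    and f: "equivariant G X Y f" "bij_betw f (fst X) (fst Y)"
  shows "isomorphic (SG G \<tau>) X Y"
proof -
  interpret S: category "SG G \<tau>" by (rule category_SG)
  define h where "h = (\<lambda>y\<in>fst Y. inv_into (fst X) f y)"
  have h: "h y \<in> fst X" "f (h y) = y" if "y \<in> fst Y" for y
    using f(2) that by (auto simp: h_def bij_betw_def inv_into_into f_inv_into_f)
  have hf: "h (f x) = x" if "x \<in> fst X" for x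
    using f(2) that by (auto simp: h_def bij_betw_def)
  have fY: "f x \<in> fst Y" if "x \<in> fst X" for x using f(1) that by (auto simp: equivariant_def)
  have Xc: "snd X g x \<in> fst X" if "g \<in> carrier G" "x \<in> fst X" for g x
    using X that group_action.element_image[of G "fst X" "snd X" g x]
    by (auto simp: smooth_gsets_def split_beta)
  have "h (snd Y g y) = snd X g (h y)" if "g \<in> carrier G" "y \<in> fst Y" for g y
  proof -
    have "f (snd X g (h y)) = snd Y g y" using f(1) h that by (auto simp: equivariant_def)
    then show ?thesis using hf[OF Xc[OF that(1) h(1)[OF that(2)]]] by simp
  qed
  then have eh: "equivariant G Y X h" using h by (auto simp: equivariant_def h_def)
  show ?thesis
  proof (rule S.isomorphicI[of "(X, f, Y)" _ _ "(Y, h, X)"])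
    show "(X, f, Y) \<in> Hom (SG G \<tau>) X Y" "(Y, h, X) \<in> Hom (SG G \<tau>) Y X"
      using X Y f eh by (auto simp: Hom_def SG_def)
    show "(Y, h, X) \<cdot>\<^bsub>SG G \<tau>\<^esub> (X, f, Y) = Ide (SG G \<tau>) X"
      using hf by (auto simp: SG_def compose_def restrict_def)
    show "(X, f, Y) \<cdot>\<^bsub>SG G \<tau>\<^esub> (Y, h, X) = Ide (SG G \<tau>) Y"
      using h by (auto simp: SG_def compose_def restrict_def)
  qed
qed

text \<open>Actions arise below as total functions on a type, whereas the objects of
  \<open>SG\<close> need them extensional on the group and on the set.\<close>

lemma group_action_restrict:
  assumes "group G"
    and closed: "\<And>g x. \<lbrakk>g \<in> carrier G; x \<in> S\<rbrakk> \<Longrightarrow> a g x \<in> S"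
    and mult: "\<And>g h x. \<lbrakk>g \<in> carrier G; h \<in> carrier G; x \<in> S\<rbrakk> \<Longrightarrow> a (g \<otimes>\<^bsub>G\<^esub> h) x = a g (a h x)"
    and one: "\<And>x. x \<in> S \<Longrightarrow> a \<one>\<^bsub>G\<^esub> x = x"
  shows "group_action G S (\<lambda>g\<in>carrier G. \<lambda>x\<in>S. a g x)"
proof -
  interpret G: group G by fact
  have inv: "a g (a (inv\<^bsub>G\<^esub> g) x) = x" "a (inv\<^bsub>G\<^esub> g) (a g x) = x" if "g \<in> carrier G" "x \<in> S" for g x
    using that by (simp_all add: one flip: mult)
  have "(\<lambda>x\<in>S. a g x) \<in> Bij S" if g: "g \<in> carrier G" for g
    unfolding Bij_def
  proof (intro IntI CollectI)
    show "bij_betw (\<lambda>x\<in>S. a g x) S S"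
      by (rule bij_betw_byWitness[where f' = "a (inv\<^bsub>G\<^esub> g)"]) (use g closed inv in auto)
  qed auto
  moreover have "(\<lambda>x\<in>S. a (g \<otimes>\<^bsub>G\<^esub> h) x) = compose S (\<lambda>x\<in>S. a g x) (\<lambda>x\<in>S. a h x)"
    if "g \<in> carrier G" "h \<in> carrier G" for g h
    using that closed mult by (auto simp: compose_def fun_eq_iff restrict_def)
  ultimately have "(\<lambda>g\<in>carrier G. \<lambda>x\<in>S. a g x) \<in> Group.hom G (BijGroup S)"
    by (auto simp: Group.hom_def BijGroup_def)
  then show ?thesis
    by (simp add: group_action_def group_hom_def group_hom_axioms_def group_BijGroup G.is_group)
qed

section \<open>The fibre functor of a homogeneous system of points\<close>

text \<open>\<open>app_free\<close> and \<open>joint\<close> say that the points (A, x), with the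
  arrows that carry one to another, form a codirected preorder, so that the colimit defining E is
  computed by common refinement. \<open>act_faithful\<close> is what makes the topology
  Hausdorff.\<close>

locale point_functor = atom_representatives u B At
  for u :: "'u itself" and B :: "('o, 'a, 'm) cat_scheme" (structure) and At :: "'o set" +
  fixes F :: "'o \<Rightarrow> 'p set" and app :: "'a \<Rightarrow> 'p \<Rightarrow> 'p"
    and G :: "('g, 'k) monoid_scheme" and act :: "'g \<Rightarrow> 'p \<Rightarrow> 'p"
  assumes app_closed: "\<lbrakk>A \<in> At; A' \<in> At; f \<in> Hom B A A'; x \<in> F A\<rbrakk> \<Longrightarrow> app f x \<in> F A'"
    and app_Ide: "\<lbrakk>A \<in> At; x \<in> F A\<rbrakk> \<Longrightarrow> app (Ide B A) x = x"
    and app_Comp: "\<lbrakk>A \<in> At; A' \<in> At; A'' \<in> At; f \<in> Hom B A A'; f' \<in> Hom B A' A''; x \<in> F A\<rbrakk> \<Longrightarrow>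
        app (f' \<cdot> f) x = app f' (app f x)"
    and app_free: "\<lbrakk>A \<in> At; A' \<in> At; f \<in> Hom B A A'; f' \<in> Hom B A A'; x \<in> F A; app f x = app f' x\<rbrakk>
        \<Longrightarrow> f = f'"
    and joint: "\<lbrakk>A \<in> At; A' \<in> At; x \<in> F A; y \<in> F A'\<rbrakk> \<Longrightarrow>
        \<exists>C \<in> At. \<exists>z \<in> F C. \<exists>p \<in> Hom B C A. \<exists>q \<in> Hom B C A'. app p z = x \<and> app q z = y"
    and F_nonempty: "A \<in> At \<Longrightarrow> F A \<noteq> {}"
    and group_G: "group G"
    and act_closed: "\<lbrakk>g \<in> carrier G; A \<in> At; x \<in> F A\<rbrakk> \<Longrightarrow> act g x \<in> F A"
    and act_mult: "\<lbrakk>g \<in> carrier G; h \<in> carrier G; A \<in> At; x \<in> F A\<rbrakk> \<Longrightarrow>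
        act (g \<otimes>\<^bsub>G\<^esub> h) x = act g (act h x)"
    and act_one: "\<lbrakk>A \<in> At; x \<in> F A\<rbrakk> \<Longrightarrow> act \<one>\<^bsub>G\<^esub> x = x"
    and act_app: "\<lbrakk>g \<in> carrier G; A \<in> At; A' \<in> At; f \<in> Hom B A A'; x \<in> F A\<rbrakk> \<Longrightarrow>
        app f (act g x) = act g (app f x)"
    and transitive: "\<lbrakk>A \<in> At; x \<in> F A; y \<in> F A\<rbrakk> \<Longrightarrow> \<exists>g \<in> carrier G. act g x = y"
    and act_faithful: "\<lbrakk>g \<in> carrier G; h \<in> carrier G; \<And>A x. \<lbrakk>A \<in> At; x \<in> F A\<rbrakk> \<Longrightarrow> act g x = act h x\<rbrakk>
        \<Longrightarrow> g = h"
begin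

section \<open>Germs: the elements of the colimit \<open>E X\<close>\<close>

definition germ_eq :: "'p \<times> 'a \<Rightarrow> 'p \<times> 'a \<Rightarrow> bool" where
  "germ_eq = (\<lambda>(a, f) (b, g). \<exists>C \<in> At. \<exists>c \<in> F C. \<exists>p \<in> Hom B C (Dom B f). \<exists>q \<in> Hom B C (Dom B g).
     app p c = a \<and> app q c = b \<and> f \<cdot> p = g \<cdot> q)"

text \<open>The conditions on \<open>(b, g)\<close> are those under which \<open>germ_eq\<close> is
  transitive; they make germs equal as sets as soon as they are equivalent.\<close>

definition germ :: "'p \<Rightarrow> 'a \<Rightarrow> ('p \<times> 'a) set" where
  "germ a f = {(b, g). g \<in> Arr B \<and> Dom B g \<in> At \<and> b \<in> F (Dom B g) \<and> Cod B g = Cod B f \<and>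
     germ_eq (a, f) (b, g)}"

definition E :: "'o \<Rightarrow> ('p \<times> 'a) set set" where
  "E X = {germ a f | A a f. A \<in> At \<and> a \<in> F A \<and> f \<in> Hom B A X}"

definition E_map :: "'a \<Rightarrow> ('p \<times> 'a) set \<Rightarrow> ('p \<times> 'a) set" where
  "E_map h x = (case (SOME af. af \<in> x) of (a, f) \<Rightarrow> germ a (h \<cdot> f))"

definition E_act :: "'g \<Rightarrow> ('p \<times> 'a) set \<Rightarrow> ('p \<times> 'a) set" where
  "E_act g x = (case (SOME af. af \<in> x) of (a, f) \<Rightarrow> germ (act g a) f)"

lemma germ_eqE:
  assumes "germ_eq (a, f) (b, g)" "f \<in> Hom B A X" "g \<in> Hom B A' X"
  obtains C c p q where "C \<in> At" "c \<in> F C" "p \<in> Hom B C A" "q \<in> Hom B C A'"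
    "app p c = a" "app q c = b" "f \<cdot> p = g \<cdot> q"
  using assms by (auto simp: germ_eq_def Hom_simps)

lemma germ_eqI:
  assumes "C \<in> At" "c \<in> F C" "p \<in> Hom B C A" "q \<in> Hom B C A'"
    "app p c = a" "app q c = b" "f \<cdot> p = g \<cdot> q" "f \<in> Hom B A X" "g \<in> Hom B A' X"
  shows "germ_eq (a, f) (b, g)"
  using assms by (auto simp: germ_eq_def Hom_simps)

lemma germ_eq_refl:
  assumes "A \<in> At" "a \<in> F A" "f \<in> Hom B A X"
  shows "germ_eq (a, f) (a, f)"
  using assms Hom_simps(4)[OF assms(3)]
  by (intro germ_eqI[of A a "Ide B A" A "Ide B A" A]) (auto simp: app_Ide Ide_in_Hom)

lemma germ_eq_sym:
  "germ_eq (a, f) (b, g) \<Longrightarrow> germ_eq (b, g) (a, f)"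
  unfolding germ_eq_def by (clarsimp, metis)

text \<open>A point \<open>m\<close> above both intermediate points gives two arrows from M to A'
  with the same value at \<open>m\<close>, and \<open>app_free\<close> makes them equal.\<close>

lemma germ_eq_trans:
  assumes "germ_eq (a, f) (b, g)" "germ_eq (b, g) (c, h)"
    and A: "A \<in> At" "A' \<in> At" "A'' \<in> At"
    and f: "f \<in> Hom B A X" and g: "g \<in> Hom B A' X" and h: "h \<in> Hom B A'' X"
  shows "germ_eq (a, f) (c, h)"
proof -
  obtain C z p q where 1: "C \<in> At" "z \<in> F C" "p \<in> Hom B C A" "q \<in> Hom B C A'"
    "app p z = a" "app q z = b" "f \<cdot> p = g \<cdot> q"
    using germ_eqE[OF assms(1) f g] .
  obtain C' z' p' q' where 2: "C' \<in> At" "z' \<in> F C'" "p' \<in> Hom B C' A'" "q' \<in> Hom B C' A''"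
    "app p' z' = b" "app q' z' = c" "g \<cdot> p' = h \<cdot> q'"
    using germ_eqE[OF assms(2) g h] .
  obtain M m r s where M: "M \<in> At" "m \<in> F M" "r \<in> Hom B M C" "s \<in> Hom B M C'"
    "app r m = z" "app s m = z'"
    using joint[OF 1(1) 2(1) 1(2) 2(2)] by blast
  have "app (q \<cdot> r) m = app (p' \<cdot> s) m"
    using app_Comp[OF M(1) 1(1) A(2) M(3) 1(4) M(2)] app_Comp[OF M(1) 2(1) A(2) M(4) 2(3) M(2)]
      1 2 M by simp
  then have eq: "q \<cdot> r = p' \<cdot> s"
    using app_free[OF M(1) A(2) _ _ M(2)] 1 2 M Comp_in_Hom by metis
  show ?thesis
  proof (rule germ_eqI[OF M(1,2)])
    show "p \<cdot> r \<in> Hom B M A" "q' \<cdot> s \<in> Hom B M A''" using 1 2 M by (auto simp: cat_simps)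
    show "app (p \<cdot> r) m = a" using app_Comp[OF M(1) 1(1) A(1) M(3) 1(3) M(2)] M 1 by simp
    show "app (q' \<cdot> s) m = c" using app_Comp[OF M(1) 2(1) A(3) M(4) 2(4) M(2)] M 2 by simp
    have "f \<cdot> (p \<cdot> r) = g \<cdot> (q \<cdot> r)"
      using Comp_extend[OF 1(7,3) f M(3)] 1 g M by (simp add: cat_simps)
    also have "\<dots> = h \<cdot> (q' \<cdot> s)"
      unfolding eq using Comp_extend[OF 2(7,3) g M(4)] 2 h M by (simp add: cat_simps)
    finally show "f \<cdot> (p \<cdot> r) = h \<cdot> (q' \<cdot> s)" .
  qed (fact f h)+
qed

lemma germ_eq_iff:
  assumes "A \<in> At" "A' \<in> At" "a \<in> F A" "b \<in> F A'" and f: "f \<in> Hom B A X" and g: "g \<in> Hom B A' X"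
  shows "germ a f = germ b g \<longleftrightarrow> germ_eq (a, f) (b, g)"
proof
  assume "germ a f = germ b g"
  moreover have "(b, g) \<in> germ b g"
    using assms germ_eq_refl[OF assms(2,4) g] by (auto simp: germ_def Hom_simps)
  ultimately show "germ_eq (a, f) (b, g)" by (auto simp: germ_def)
next
  assume *: "germ_eq (a, f) (b, g)"
  have "germ_eq (a, f) (c, h) \<longleftrightarrow> germ_eq (b, g) (c, h)"
    if h: "h \<in> Arr B" "Dom B h \<in> At" "Cod B h = X" for c h
  proof -
    have h': "h \<in> Hom B (Dom B h) X" using h by (simp add: Hom_def)
    show ?thesis
      using germ_eq_trans[OF * _ assms(1,2) h(2) f g h']
        germ_eq_trans[OF germ_eq_sym[OF *] _ assms(2,1) h(2) g f h'] by blast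
  qed
  then show "germ a f = germ b g"
    using Hom_simps[OF f] Hom_simps[OF g] by (auto simp: germ_def)
qed

text \<open>The gluing relation of the colimit.\<close>

lemma germ_app:
  assumes "C \<in> At" "A \<in> At" "c \<in> F C" "p \<in> Hom B C A" "f \<in> Hom B A X"
  shows "germ (app p c) f = germ c (f \<cdot> p)"
proof -
  have O: "C \<in> Obj B" using assms Hom_simps by blast
  have fp: "f \<cdot> p \<in> Hom B C X" using assms by (simp add: cat_simps)
  have "germ_eq (app p c, f) (c, f \<cdot> p)"
    by (rule germ_eqI[OF assms(1,3,4) Ide_in_Hom[OF O] refl _ _ assms(5) fp])
      (use assms app_Ide O in \<open>auto simp: cat_simps\<close>)
  then show ?thesis
    using germ_eq_iff[OF assms(2,1) app_closed[OF assms(1,2,4,3)] assms(3,5) fp] by simp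
qed

text \<open>Arrows of atoms are epi, so the transition maps Hom(A, X) -> Hom(C, X) of the colimit
  are injective.\<close>

lemma germ_inject:
  assumes A: "A \<in> At" "a \<in> F A" and f: "f \<in> Hom B A X" and g: "g \<in> Hom B A X"
  shows "germ a f = germ a g \<longleftrightarrow> f = g"
proof
  assume "germ a f = germ a g"
  then have "germ_eq (a, f) (a, g)" using germ_eq_iff[OF A(1,1,2,2) f g] by simp
  then obtain C c p q where 1: "C \<in> At" "c \<in> F C" "p \<in> Hom B C A" "q \<in> Hom B C A"
    "app p c = a" "app q c = a" "f \<cdot> p = g \<cdot> q"
    using germ_eqE f g by metis
  have "p = q" using app_free[OF 1(1) A(1) 1(3,4,2)] 1 by simp
  then show "f = g" using atom_epi[OF At_atom[OF 1(1)] At_atom[OF A(1)] 1(3) f g] 1(7) by simp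
qed simp

lemma germ_in_E: "\<lbrakk>A \<in> At; a \<in> F A; f \<in> Hom B A X\<rbrakk> \<Longrightarrow> germ a f \<in> E X"
  by (auto simp: E_def)

lemma E_cases:
  assumes "x \<in> E X"
  obtains A a f where "A \<in> At" "a \<in> F A" "f \<in> Hom B A X" "x = germ a f"
  using assms by (auto simp: E_def)

text \<open>\<open>joint\<close> puts both elements over one point, which turns statements about
  pairs of elements into statements about pairs of arrows out of one atom.\<close>

lemma E_cases2:
  assumes "x \<in> E X" "y \<in> E Y"
  obtains A a f g where "A \<in> At" "a \<in> F A" "f \<in> Hom B A X" "g \<in> Hom B A Y"
    "x = germ a f" "y = germ a g"
proof -
  obtain A a f where A: "A \<in> At" "a \<in> F A" "f \<in> Hom B A X" "x = germ a f"
    using E_cases[OF assms(1)] .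
  obtain A' b g where A': "A' \<in> At" "b \<in> F A'" "g \<in> Hom B A' Y" "y = germ b g"
    using E_cases[OF assms(2)] .
  obtain C c p q where C: "C \<in> At" "c \<in> F C" "p \<in> Hom B C A" "q \<in> Hom B C A'"
    "app p c = a" "app q c = b"
    using joint[OF A(1) A'(1) A(2) A'(2)] by blast
  show thesis
  proof (rule that[OF C(1,2)])
    show "f \<cdot> p \<in> Hom B C X" "g \<cdot> q \<in> Hom B C Y" using A A' C by (simp_all add: cat_simps)
    show "x = germ c (f \<cdot> p)" "y = germ c (g \<cdot> q)"
      using A A' C germ_app[OF C(1) A(1) C(2,3) A(3)] germ_app[OF C(1) A'(1) C(2,4) A'(3)] by simp_all
  qed
qed

lemma some_in_germ:
  assumes "A \<in> At" "a \<in> F A" "f \<in> Hom B A X"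
  obtains A' b g where "A' \<in> At" "b \<in> F A'" "g \<in> Hom B A' X"
    "(SOME bg. bg \<in> germ a f) = (b, g)" "germ_eq (a, f) (b, g)"
proof -
  have "(a, f) \<in> germ a f"
    using assms germ_eq_refl[OF assms] by (auto simp: germ_def Hom_simps)
  then have "(SOME bg. bg \<in> germ a f) \<in> germ a f" by (rule someI)
  moreover obtain b g where bg: "(SOME bg. bg \<in> germ a f) = (b, g)" by fastforce
  ultimately have "(b, g) \<in> germ a f" by simp
  then show thesis using that[of "Dom B g" b g] bg assms by (auto simp: germ_def Hom_def)
qed

lemma E_map_germ:
  assumes "A \<in> At" "a \<in> F A" and f: "f \<in> Hom B A X" and h: "h \<in> Hom B X Y"
  shows "E_map h (germ a f) = germ a (h \<cdot> f)"
proof -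
  obtain A' b g where bg: "A' \<in> At" "b \<in> F A'" "g \<in> Hom B A' X"
    "(SOME bg. bg \<in> germ a f) = (b, g)" "germ_eq (a, f) (b, g)"
    using some_in_germ[OF assms(1-3)] .
  obtain C c p q where 1: "C \<in> At" "c \<in> F C" "p \<in> Hom B C A" "q \<in> Hom B C A'"
    "app p c = a" "app q c = b" "f \<cdot> p = g \<cdot> q"
    using germ_eqE[OF bg(5) f bg(3)] .
  have hf: "h \<cdot> f \<in> Hom B A Y" "h \<cdot> g \<in> Hom B A' Y" using f h bg by (simp_all add: cat_simps)
  have "(h \<cdot> f) \<cdot> p = (h \<cdot> g) \<cdot> q" using 1 f h bg by (simp add: cat_simps)
  then have "germ_eq (a, h \<cdot> f) (b, h \<cdot> g)" using germ_eqI[OF 1(1-6) _ hf] by simp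
  then have "germ a (h \<cdot> f) = germ b (h \<cdot> g)"
    using germ_eq_iff[OF assms(1) bg(1) assms(2) bg(2) hf] by simp
  then show ?thesis by (simp add: E_map_def bg(4))
qed

lemma E_act_germ:
  assumes "A \<in> At" "a \<in> F A" and f: "f \<in> Hom B A X" and h: "h \<in> carrier G"
  shows "E_act h (germ a f) = germ (act h a) f"
proof -
  obtain A' b g where bg: "A' \<in> At" "b \<in> F A'" "g \<in> Hom B A' X"
    "(SOME bg. bg \<in> germ a f) = (b, g)" "germ_eq (a, f) (b, g)"
    using some_in_germ[OF assms(1-3)] .
  obtain C c p q where 1: "C \<in> At" "c \<in> F C" "p \<in> Hom B C A" "q \<in> Hom B C A'"
    "app p c = a" "app q c = b" "f \<cdot> p = g \<cdot> q"
    using germ_eqE[OF bg(5) f bg(3)] .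
  have "germ_eq (act h a, f) (act h b, g)"
    by (rule germ_eqI[OF 1(1) act_closed[OF h 1(1,2)] 1(3,4) _ _ 1(7) f bg(3)])
      (use 1 h act_app assms bg in auto)
  then have "germ (act h a) f = germ (act h b) g"
    using germ_eq_iff[OF assms(1) bg(1) act_closed[OF h assms(1,2)] act_closed[OF h bg(1,2)] f bg(3)]
    by simp
  then show ?thesis by (simp add: E_act_def bg(4))
qed

lemma E_map_closed:
  assumes "h \<in> Hom B X Y" "x \<in> E X"
  shows "E_map h x \<in> E Y"
  using assms(2) by (rule E_cases) (use assms(1) in \<open>auto simp: E_map_germ intro: germ_in_E Comp_in_Hom\<close>)

lemma E_map_Comp:
  assumes "h \<in> Hom B X Y" "k \<in> Hom B Y Z" "x \<in> E X"
  shows "E_map (k \<cdot> h) x = E_map k (E_map h x)"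
proof -
  obtain A a f where A: "A \<in> At" "a \<in> F A" "f \<in> Hom B A X" "x = germ a f"
    using E_cases[OF assms(3)] .
  then show ?thesis
    using E_map_germ[OF A(1-3), of h Y] E_map_germ[OF A(1-3), of "k \<cdot> h" Z]
      E_map_germ[OF A(1,2), of "h \<cdot> f" Y k Z] assms
    by (simp add: cat_simps)
qed

lemma E_map_Ide:
  assumes "x \<in> E X"
  shows "E_map (Ide B X) x = x"
  using assms(1) by (rule E_cases)
    (use Hom_simps in \<open>auto simp: E_map_germ[OF _ _ _ Ide_in_Hom] Ide_Comp\<close>)

lemma E_act_closed:
  assumes "g \<in> carrier G" "x \<in> E X"
  shows "E_act g x \<in> E X"
  using assms(2) by (rule E_cases) (use assms(1) in \<open>auto simp: E_act_germ act_closed intro: germ_in_E\<close>)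

lemma E_act_mult:
  assumes "g \<in> carrier G" "h \<in> carrier G" "x \<in> E X"
  shows "E_act (g \<otimes>\<^bsub>G\<^esub> h) x = E_act g (E_act h x)"
  using assms(3) by (rule E_cases)
    (use assms(1,2) group_G in \<open>auto simp: E_act_germ act_closed act_mult group.is_monoid monoid.m_closed\<close>)

lemma E_act_one:
  assumes "x \<in> E X"
  shows "E_act \<one>\<^bsub>G\<^esub> x = x"
  using assms(1) by (rule E_cases)
    (use group_G in \<open>auto simp: E_act_germ act_one group.is_monoid monoid.one_closed\<close>)

lemma E_map_act:
  assumes h: "h \<in> Hom B X Y" and g: "g \<in> carrier G" and x: "x \<in> E X"
  shows "E_map h (E_act g x) = E_act g (E_map h x)"
proof -
  obtain A a f where A: "A \<in> At" "a \<in> F A" "f \<in> Hom B A X" "x = germ a f"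
    using E_cases[OF x] .
  have "h \<cdot> f \<in> Hom B A Y" using A h by (simp add: cat_simps)
  then show ?thesis
    using E_map_germ[OF A(1) act_closed[OF g A(1,2)] A(3) h] E_act_germ[OF A(1-3) g]
      E_map_germ[OF A(1-3) h] E_act_germ[OF A(1,2) _ g] A(4) by simp
qed

section \<open>E on monomorphisms, fibre products, coproducts and epimorphisms\<close>

lemma At_cover_eqI:
  assumes "f \<in> Hom B X Y" "g \<in> Hom B X Y"
    and "\<And>A s. A \<in> At \<Longrightarrow> s \<in> Hom B A X \<Longrightarrow> f \<cdot> s = g \<cdot> s"
  shows "f = g"
proof -
  obtain n A \<iota> where A: "\<And>k. k < (n::nat) \<Longrightarrow> A k \<in> At" "is_coproduct B {..<n} A X \<iota>"
    using At_decomposition[OF Hom_simps(4)[OF assms(1)]] by metis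
  show ?thesis
    by (rule coproduct_eqI[OF A(2) assms(1,2)]) (use A assms(3) coproduct_inj_Hom[OF A(2)] in auto)
qed

text \<open>One point on each atom is enough, because \<open>germ_inject\<close> recovers an arrow
  from its germ at that point.\<close>

lemma E_faithful:
  assumes f: "f \<in> Hom B X Y" and g: "g \<in> Hom B X Y" and eq: "\<And>x. x \<in> E X \<Longrightarrow> E_map f x = E_map g x"
  shows "f = g"
proof (rule At_cover_eqI[OF f g])
  fix A s assume A: "A \<in> At" "s \<in> Hom B A X"
  obtain a where a: "a \<in> F A" using F_nonempty[OF A(1)] by blast
  have "germ a (f \<cdot> s) = germ a (g \<cdot> s)"
    using eq[OF germ_in_E[OF A(1) a A(2)]] E_map_germ[OF A(1) a A(2)] f g by simp
  then show "f \<cdot> s = g \<cdot> s"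
    using germ_inject[OF A(1) a, of "f \<cdot> s" Y "g \<cdot> s"] A f g by (simp add: cat_simps)
qed

lemma monic_E_iff:
  assumes m: "m \<in> Hom B X Y"
  shows "is_monic B m \<longleftrightarrow> inj_on (E_map m) (E X)"
proof
  assume mon: "is_monic B m"
  show "inj_on (E_map m) (E X)"
  proof (rule inj_onI)
    fix x y assume xy: "x \<in> E X" "y \<in> E X" "E_map m x = E_map m y"
    obtain A a f g where A: "A \<in> At" "a \<in> F A" "f \<in> Hom B A X" "g \<in> Hom B A X"
      "x = germ a f" "y = germ a g"
      using E_cases2[OF xy(1,2)] .
    have "germ a (m \<cdot> f) = germ a (m \<cdot> g)" using xy(3) A m by (simp add: E_map_germ)
    then have "m \<cdot> f = m \<cdot> g"
      using germ_inject[OF A(1,2), of "m \<cdot> f" Y "m \<cdot> g"] A m by (simp add: cat_simps)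
    then show "x = y" using monicD[OF mon m A(3,4)] A by simp
  qed
next
  assume inj: "inj_on (E_map m) (E X)"
  show "is_monic B m"
  proof (rule monic_atomI[OF m])
    fix A v w assume A: "is_atom B A" "v \<in> Hom B A X" "w \<in> Hom B A X" "m \<cdot> v = m \<cdot> w"
    show "v = w"
    proof (rule E_faithful[OF A(2,3)])
      fix x assume x: "x \<in> E A"
      have "E_map m (E_map v x) = E_map m (E_map w x)"
        using E_map_Comp[OF A(2) m x] E_map_Comp[OF A(3) m x] A(4) by simp
      then show "E_map v x = E_map w x"
        using inj_onD[OF inj] E_map_closed[OF A(2) x] E_map_closed[OF A(3) x] by blast
    qed
  qed
qed

text \<open>Only the surjectivity of \<open>E P\<close> onto the fibre product of sets is recorded.
  Both elements are represented over one atom, and the lift is made there.\<close>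

lemma E_pullback:
  assumes P: "is_pullback B f g P p q" and f: "f \<in> Hom B X Z" and g: "g \<in> Hom B Y Z"
    and x: "x \<in> E X" and y: "y \<in> E Y" and eq: "E_map f x = E_map g y"
  obtains z where "z \<in> E P" "E_map p z = x" "E_map q z = y"
proof -
  note pq = pullbackD[OF P f g]
  obtain A a r s where A: "A \<in> At" "a \<in> F A" "r \<in> Hom B A X" "s \<in> Hom B A Y"
    "x = germ a r" "y = germ a s"
    using E_cases2[OF x y] .
  have "germ a (f \<cdot> r) = germ a (g \<cdot> s)" using eq A f g by (simp add: E_map_germ)
  then have "f \<cdot> r = g \<cdot> s"
    using germ_inject[OF A(1,2), of "f \<cdot> r" Z "g \<cdot> s"] A f g by (simp add: cat_simps)
  then obtain h where h: "h \<in> Hom B A P" "p \<cdot> h = r" "q \<cdot> h = s"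
    using pullback_lift[OF P, of r A s] A f g by (auto simp: Hom_simps)
  show thesis
    by (rule that[OF germ_in_E[OF A(1,2) h(1)]])
      (use E_map_germ[OF A(1,2) h(1)] pq h A in auto)
qed

lemma E_product:
  assumes P: "is_product2 B X Y P p q" and x: "x \<in> E X" and y: "y \<in> E Y"
  obtains z where "z \<in> E P" "E_map p z = x" "E_map q z = y"
proof -
  have pq: "p \<in> Hom B P X" "q \<in> Hom B P Y" using P by (auto simp: is_product2_def)
  obtain A a r s where A: "A \<in> At" "a \<in> F A" "r \<in> Hom B A X" "s \<in> Hom B A Y"
    "x = germ a r" "y = germ a s"
    using E_cases2[OF x y] .
  obtain h where h: "h \<in> Hom B A P" "p \<cdot> h = r" "q \<cdot> h = s"
    using product2_pair[OF P A(3,4)] .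
  show thesis
    by (rule that[OF germ_in_E[OF A(1,2) h(1)]])
      (use E_map_germ[OF A(1,2) h(1)] pq h A in auto)
qed

context
  fixes n :: nat and A X \<iota>
  assumes A: "\<And>k. k < n \<Longrightarrow> A k \<in> At" and X: "is_coproduct B {..<n} A X \<iota>"
begin

text \<open>Together with \<open>germ_coproduct_inject\<close> this makes \<open>E X\<close> the
  disjoint union of the sets \<open>F (A k)\<close>, each of which is a single orbit.\<close>

lemma E_coproduct_cases:
  assumes "x \<in> E X"
  obtains k a where "k < n" "a \<in> F (A k)" "x = germ a (\<iota> k)"
proof -
  obtain C c f where C: "C \<in> At" "c \<in> F C" "f \<in> Hom B C X" "x = germ c f"
    using E_cases[OF assms] .
  obtain k v where k: "k < n" "v \<in> Hom B C (A k)" "f = \<iota> k \<cdot> v"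
    using atom_coproduct_factor[OF At_atom[OF C(1)] X C(3)] .
  show thesis
    by (rule that[OF k(1), of "app v c"])
      (use C k A app_closed germ_app[OF C(1) A[OF k(1)] C(2) k(2)] coproduct_inj_Hom[OF X, of k] in auto)
qed

lemma germ_coproduct_inject:
  assumes "k < n" "l < n" "a \<in> F (A k)" "b \<in> F (A l)" "germ a (\<iota> k) = germ b (\<iota> l)"
  shows "k = l \<and> a = b"
proof -
  have \<iota>: "\<iota> k \<in> Hom B (A k) X" "\<iota> l \<in> Hom B (A l) X"
    using coproduct_inj_Hom[OF X] assms by auto
  have "germ_eq (a, \<iota> k) (b, \<iota> l)"
    using germ_eq_iff[OF A[OF assms(1)] A[OF assms(2)] assms(3,4) \<iota>] assms(5) by simp
  then obtain C c p q where 1: "C \<in> At" "c \<in> F C" "p \<in> Hom B C (A k)" "q \<in> Hom B C (A l)"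
    "app p c = a" "app q c = b" "\<iota> k \<cdot> p = \<iota> l \<cdot> q"
    using germ_eqE \<iota> by metis
  then show ?thesis
    using atom_coproduct_inj[OF At_atom[OF 1(1)] X assms(1,2) 1(3,4,7)] by blast
qed

lemma E_act_coproduct:
  assumes "k < n" "a \<in> F (A k)" "g \<in> carrier G"
  shows "E_act g (germ a (\<iota> k)) = germ (act g a) (\<iota> k)"
  using E_act_germ[OF A assms(2) coproduct_inj_Hom[OF X]] assms by auto

end

text \<open>If a component of \<open>Q\<close> were missed by \<open>c\<close>, then \<open>c\<close> would not distinguish the inclusion
  \<open>Q \<rightarrow> Q \<amalg> Q\<close> from the map that moves this component to the second copy.\<close>

lemma E_epi:
  assumes c: "c \<in> Hom B X Q"
    and epi: "\<And>T v w. \<lbrakk>v \<in> Hom B Q T; w \<in> Hom B Q T; v \<cdot> c = w \<cdot> c\<rbrakk> \<Longrightarrow> v = w"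
  shows "E_map c ` E X = E Q"
proof
  show "E_map c ` E X \<subseteq> E Q" using E_map_closed[OF c] by blast
  have O: "X \<in> Obj B" "Q \<in> Obj B" using c Hom_simps by blast+
  obtain n A \<iota> where A: "\<And>k. k < (n::nat) \<Longrightarrow> A k \<in> At" "is_coproduct B {..<n} A Q \<iota>"
    using At_decomposition[OF O(2)] by metis
  note \<iota> = coproduct_inj_Hom[OF A(2), simplified]
  show "E Q \<subseteq> E_map c ` E X"
  proof (rule ccontr)
    assume "\<not> E Q \<subseteq> E_map c ` E X"
    then obtain y where y: "y \<in> E Q" "y \<notin> E_map c ` E X" by blast
    obtain k a where k: "k < n" "a \<in> F (A k)" "y = germ a (\<iota> k)"
      using E_coproduct_cases[OF A y(1)] .
    obtain T \<kappa> where T: "is_coproduct B {..<2::nat} (\<lambda>_. Q) T \<kappa>"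
      using finite_coproducts O unfolding has_finite_coproducts_def by metis
    have \<kappa>: "\<kappa> 0 \<in> Hom B Q T" "\<kappa> 1 \<in> Hom B Q T" using coproduct_inj_Hom[OF T] by auto
    have TO: "T \<in> Obj B" using \<kappa> Hom_simps by blast
    have "\<kappa> (if l = k then 1 else 0) \<cdot> \<iota> l \<in> Hom B (A l) T" if "l \<in> {..<n}" for l
      using Comp_in_Hom[OF \<iota>[of l] \<kappa>(1)] Comp_in_Hom[OF \<iota>[of l] \<kappa>(2)] that by auto
    from coproduct_desc[OF A(2) this TO] obtain h where h: "h \<in> Hom B Q T"
      "\<And>l. l < n \<Longrightarrow> h \<cdot> \<iota> l = \<kappa> (if l = k then 1 else 0) \<cdot> \<iota> l" by auto
    have "\<kappa> 0 \<cdot> c = h \<cdot> c"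
    proof (rule At_cover_eqI)
      show "\<kappa> 0 \<cdot> c \<in> Hom B X T" "h \<cdot> c \<in> Hom B X T" using \<kappa> h c Comp_in_Hom by blast+
      fix C s assume C: "C \<in> At" "s \<in> Hom B C X"
      then have cs: "c \<cdot> s \<in> Hom B C Q" using c Comp_in_Hom by blast
      obtain l v where l: "l < n" "v \<in> Hom B C (A l)" "c \<cdot> s = \<iota> l \<cdot> v"
        using atom_coproduct_factor[OF At_atom[OF C(1)] A(2) cs] .
      have "l \<noteq> k"
      proof
        assume lk: "l = k"
        obtain z where z: "z \<in> F C" using F_nonempty[OF C(1)] by blast
        have "app v z \<in> F (A k)" using app_closed[OF C(1) A(1)[OF k(1)] _ z] l lk by simp
        \<comment> \<open>As \<open>F (A k)\<close> is a single orbit, a point of C can be found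
          whose value under \<open>v\<close> is \<open>a\<close> itself; then \<open>y\<close> lies
          in the image after all.\<close>
        then obtain g where g: "g \<in> carrier G" "act g (app v z) = a"
          using transitive[OF A(1)[OF k(1)] _ k(2)] by blast
        have v: "v \<in> Hom B C (A k)" using l lk by simp
        have gz: "act g z \<in> F C" using act_closed[OF g(1) C(1) z] .
        have "app v (act g z) = a" using g act_app[OF g(1) C(1) A(1)[OF k(1)] v z] by simp
        then have "y = germ (act g z) (\<iota> k \<cdot> v)"
          using germ_app[OF C(1) A(1)[OF k(1)] gz v \<iota>[OF k(1)]] k by simp
        also have "\<dots> = E_map c (germ (act g z) s)"
          using E_map_germ[OF C(1) gz C(2) c] l lk by simp
        finally show False using y germ_in_E[OF C(1) gz C(2)] by blast
      qed
      then have "h \<cdot> \<iota> l = \<kappa> 0 \<cdot> \<iota> l" using h l by simp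
      then have "h \<cdot> (\<iota> l \<cdot> v) = \<kappa> 0 \<cdot> (\<iota> l \<cdot> v)"
        using Comp_extend[OF _ \<iota>[OF l(1)] h(1) l(2)] Comp_assoc[OF l(2) \<iota>[OF l(1)] \<kappa>(1)] by metis
      then show "(\<kappa> 0 \<cdot> c) \<cdot> s = (h \<cdot> c) \<cdot> s"
        using l Comp_assoc[OF C(2) c \<kappa>(1)] Comp_assoc[OF C(2) c h(1)] by simp
    qed
    then have "\<kappa> 0 = h" using epi[OF \<kappa>(1) h(1)] by simp
    then have "\<kappa> 0 \<cdot> \<iota> k = \<kappa> 1 \<cdot> \<iota> k" using h(2)[OF k(1)] by simp
    then show False
      using atom_coproduct_inj[OF At_atom[OF A(1)[OF k(1)]] T, of 0 1 "\<iota> k" "\<iota> k"] \<iota>[OF k(1)] by simp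
  qed
qed

text \<open>The kernel pair of \<open>p\<close> is an effective equivalence relation, and the comparison map from its
  quotient to \<open>A\<close> is a monomorphism, hence an isomorphism.\<close>

lemma atom_map_regular:
  assumes A: "A \<in> At" and C: "C \<in> At" and p: "p \<in> Hom B C A" and g: "g \<in> Hom B C Y"
    and eq: "\<And>W r s. \<lbrakk>W \<in> At; r \<in> Hom B W C; s \<in> Hom B W C; p \<cdot> r = p \<cdot> s\<rbrakk> \<Longrightarrow> g \<cdot> r = g \<cdot> s"
  shows "\<exists>f \<in> Hom B A Y. f \<cdot> p = g"
proof -
  have CO: "C \<in> Obj B" using p Hom_simps by blast
  obtain R p1 p2 where R: "is_pullback B p p R p1 p2" using pullback_exists[OF p p] .
  note p12 = pullbackD[OF R p p]
  have lift: "\<exists>h \<in> Hom B T R. p1 \<cdot> h = r \<and> p2 \<cdot> h = s"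
    if "r \<in> Hom B T C" "s \<in> Hom B T C" "p \<cdot> r = p \<cdot> s" for T r s
    using pullback_lift[OF R, of r T s] that p by (auto simp: Hom_simps)
  obtain P a b where P: "is_product2 B C C P a b" using product_exists[OF CO CO] .
  have ab: "a \<in> Hom B P C" "b \<in> Hom B P C" using P by (auto simp: is_product2_def)
  obtain m where m: "m \<in> Hom B R P" "a \<cdot> m = p1" "b \<cdot> m = p2"
    using product2_pair[OF P p12(1,2)] .
  have mono: "is_monic B m"
  proof (rule monic_atomI[OF m(1)])
    fix T r s assume T: "is_atom B T" "r \<in> Hom B T R" "s \<in> Hom B T R" "m \<cdot> r = m \<cdot> s"
    show "r = s"
      by (rule pullback_eqI[OF R T(2,3)])
        (use m T ab Comp_assoc[OF T(2) m(1)] Comp_assoc[OF T(3) m(1)] in metis)+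
  qed
  have "is_equiv_relation B C P a b R m"
    unfolding is_equiv_relation_def Let_def m(2,3)
  proof (intro conjI allI impI)
    show "\<exists>r\<in>Hom B C R. p1 \<cdot> r = Ide B C \<and> p2 \<cdot> r = Ide B C"
      by (rule lift) (use CO Ide_in_Hom in auto)
    show "\<exists>s\<in>Hom B R R. p1 \<cdot> s = p2 \<and> p2 \<cdot> s = p1"
      by (rule lift) (use p12 in auto)
    fix K v w assume K: "is_pullback B p2 p1 K v w"
    note vw = pullbackD[OF K p12(2,1)]
    have "p \<cdot> (p1 \<cdot> v) = p \<cdot> (p2 \<cdot> v)" "p \<cdot> (p1 \<cdot> w) = p \<cdot> (p2 \<cdot> w)"
      using Comp_extend[OF p12(3,1) p] vw p12 p by (simp_all add: cat_simps)
    then show "\<exists>t\<in>Hom B K R. p1 \<cdot> t = p1 \<cdot> v \<and> p2 \<cdot> t = p2 \<cdot> w"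
      using vw p12 by (intro lift) (auto simp: cat_simps)
  qed (fact P m(1) mono)+
  then obtain Q c where Q: "is_coequalizer B p1 p2 Q c" "is_pullback B c c R p1 p2"
    using effective m unfolding equiv_relations_effective_def by metis
  have c: "c \<in> Hom B C Q" "c \<cdot> p1 = c \<cdot> p2"
    using Q(1) p12 by (auto simp: is_coequalizer_def Hom_simps)
  have QO: "Q \<in> Obj B" using c Hom_simps by blast
  have desc: "\<exists>!h. h \<in> Hom B Q T \<and> h \<cdot> c = v" if "v \<in> Hom B C T" "v \<cdot> p1 = v \<cdot> p2" for v T
    using Q(1) p12 that Hom_simps(5)[OF that(1)] by (auto simp: is_coequalizer_def Hom_simps)
  have surj: "E_map c ` E C = E Q" using E_epi[OF c(1) coequalizer_epi[OF Q(1)]] .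
  obtain h where h: "h \<in> Hom B Q A" "h \<cdot> c = p" using desc[OF p p12(3)] by blast
  \<comment> \<open>Injectivity is checked on points: two points of Q lift to C, their lifts agree
    under \<open>p\<close>, hence they come from one point of R, and \<open>c\<close> equalizes the
    projections of R.\<close>
  have mono_h: "is_monic B h"
    unfolding monic_E_iff[OF h(1)]
  proof (rule inj_onI)
    fix x y assume xy: "x \<in> E Q" "y \<in> E Q" "E_map h x = E_map h y"
    have "x \<in> E_map c ` E C" "y \<in> E_map c ` E C" using xy surj by simp_all
    then obtain x' y' where xy': "x' \<in> E C" "x = E_map c x'" "y' \<in> E C" "y = E_map c y'"
      by blast
    have "E_map p x' = E_map p y'"
      using xy(3) xy' E_map_Comp[OF c(1) h(1) xy'(1)] E_map_Comp[OF c(1) h(1) xy'(3)] h(2) by simp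
    then obtain z where z: "z \<in> E R" "E_map p1 z = x'" "E_map p2 z = y'"
      using E_pullback[OF R p p xy'(1,3)] by metis
    have "x = E_map (c \<cdot> p1) z" "y = E_map (c \<cdot> p2) z"
      using xy' z E_map_Comp[OF p12(1) c(1) z(1)] E_map_Comp[OF p12(2) c(1) z(1)] by simp_all
    then show "x = y" using c by simp
  qed
  obtain s where s: "s \<in> Hom B A Q" "s \<cdot> h = Ide B Q"
    using monic_onto_atom[OF h(1) mono_h At_atom[OF A] At_atom[OF C] c(1)] .
  have "g \<cdot> p1 = g \<cdot> p2"
  proof (rule At_cover_eqI)
    show "g \<cdot> p1 \<in> Hom B R Y" "g \<cdot> p2 \<in> Hom B R Y" using g p12 Comp_in_Hom by blast+
    fix W v assume W: "W \<in> At" "v \<in> Hom B W R"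
    have pv: "p1 \<cdot> v \<in> Hom B W C" "p2 \<cdot> v \<in> Hom B W C" using W p12 Comp_in_Hom by blast+
    have "p \<cdot> (p1 \<cdot> v) = p \<cdot> (p2 \<cdot> v)"
      using Comp_extend[OF p12(3,1) p W(2)] Comp_assoc[OF W(2) p12(2) p] by simp
    then have "g \<cdot> (p1 \<cdot> v) = g \<cdot> (p2 \<cdot> v)" using eq[OF W(1) pv] by simp
    then show "(g \<cdot> p1) \<cdot> v = (g \<cdot> p2) \<cdot> v"
      using Comp_assoc[OF W(2) p12(1) g] Comp_assoc[OF W(2) p12(2) g] by simp
  qed
  then obtain g' where g': "g' \<in> Hom B Q Y" "g' \<cdot> c = g" using desc[OF g] by blast
  show ?thesis
  proof
    show "g' \<cdot> s \<in> Hom B A Y" using g' s Comp_in_Hom by blast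
    have "s \<cdot> p = c"
      using h(2) Comp_extend[OF s(2) h(1) s(1) c(1)] Ide_Comp[OF c(1)] by simp
    then show "(g' \<cdot> s) \<cdot> p = g" using Comp_assoc[OF p s(1) g'(1)] g'(2) by simp
  qed
qed

text \<open>Represent \<open>y\<close> by an arrow \<open>g\<close> at a point \<open>c\<close>
  above \<open>a\<close>, with \<open>p\<close> carrying \<open>c\<close> to \<open>a\<close>. If
  \<open>p \<cdot> r = p \<cdot> s\<close>, group elements h, k that move \<open>c\<close> to the
  values of \<open>r\<close> and \<open>s\<close> differ by an element fixing \<open>a\<close>,
  hence fixing \<open>y\<close>, so that \<open>g \<cdot> r = g \<cdot> s\<close>. Thus
  \<open>g\<close> descends along \<open>p\<close> by \<open>atom_map_regular\<close>.\<close>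

lemma germ_full:
  assumes A: "A \<in> At" "a \<in> F A" and y: "y \<in> E Y"
    and stab: "\<And>g. \<lbrakk>g \<in> carrier G; act g a = a\<rbrakk> \<Longrightarrow> E_act g y = y"
  shows "\<exists>f \<in> Hom B A Y. y = germ a f"
proof -
  interpret G: group G by (rule group_G)
  have AO: "A \<in> Obj B" using At_atom[OF A(1)] by (simp add: is_atom_def)
  \<comment> \<open>The tautological germ of the identity at \<open>a\<close> is put over the same
    point as \<open>y\<close>, in order that this point lies above \<open>a\<close>;
    \<open>pc\<close> confirms it.\<close>
  obtain C c p g where C: "C \<in> At" "c \<in> F C" "p \<in> Hom B C A" "g \<in> Hom B C Y"
    "germ a (Ide B A) = germ c p" "y = germ c g"
    using E_cases2[OF germ_in_E[OF A Ide_in_Hom[OF AO]] y] .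
  have "germ c p = germ (app p c) (Ide B A)"
    using germ_app[OF C(1) A(1) C(2,3) Ide_in_Hom[OF AO]] Ide_Comp[OF C(3)] by simp
  then have "germ_eq (a, Ide B A) (app p c, Ide B A)"
    using germ_eq_iff[OF A(1,1,2) app_closed[OF C(1) A(1) C(3,2)] Ide_in_Hom[OF AO] Ide_in_Hom[OF AO]] C
    by simp
  then obtain D d r s where D: "D \<in> At" "d \<in> F D" "r \<in> Hom B D A" "s \<in> Hom B D A"
    "app r d = a" "app s d = app p c" "Ide B A \<cdot> r = Ide B A \<cdot> s"
    using germ_eqE[OF _ Ide_in_Hom[OF AO] Ide_in_Hom[OF AO]] by metis
  then have pc: "app p c = a" using Ide_Comp by metis
  have "\<exists>f \<in> Hom B A Y. f \<cdot> p = g"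
  proof (rule atom_map_regular[OF A(1) C(1,3,4)])
    fix W r s
    assume W: "W \<in> At" and r: "r \<in> Hom B W C" and s: "s \<in> Hom B W C" and rs: "p \<cdot> r = p \<cdot> s"
    obtain w where w: "w \<in> F W" using F_nonempty[OF W] by blast
    have rw: "app r w \<in> F C" "app s w \<in> F C" using app_closed[OF W C(1)] r s w by auto
    obtain h k where h: "h \<in> carrier G" "act h c = app r w" and k: "k \<in> carrier G" "act k c = app s w"
      using transitive[OF C(1,2)] rw by blast
    have ki: "inv\<^bsub>G\<^esub> k \<in> carrier G" using k by simp
    have a: "act h a = app p (app r w)" "act k a = app p (app s w)"
      using act_app[OF h(1) C(1) A(1) C(3,2)] act_app[OF k(1) C(1) A(1) C(3,2)] h k pc by simp_all
    have "app p (app r w) = app p (app s w)"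
      using app_Comp[OF W C(1) A(1) r C(3) w] app_Comp[OF W C(1) A(1) s C(3) w] rs by simp
    then have "act h a = act k a" using a by simp
    then have "act (inv\<^bsub>G\<^esub> k \<otimes>\<^bsub>G\<^esub> h) a = a"
      using act_mult[OF ki h(1) A] act_mult[OF ki k(1) A] act_one[OF A] k by simp
    then have "E_act (inv\<^bsub>G\<^esub> k \<otimes>\<^bsub>G\<^esub> h) y = y" using stab h ki by simp
    then have "E_act k (E_act (inv\<^bsub>G\<^esub> k) (E_act h y)) = E_act k y"
      using E_act_mult[OF ki h(1) y] by simp
    then have "E_act h y = E_act k y"
      using E_act_mult[OF k(1) ki E_act_closed[OF h(1) y]] E_act_one[OF E_act_closed[OF h(1) y]] k
          by simp
    then have "germ (app r w) g = germ (app s w) g"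
      using E_act_germ[OF C(1,2,4) h(1)] E_act_germ[OF C(1,2,4) k(1)] h k C(6) by simp
    then have "germ w (g \<cdot> r) = germ w (g \<cdot> s)"
      using germ_app[OF W C(1) w r C(4)] germ_app[OF W C(1) w s C(4)] by simp
    then show "g \<cdot> r = g \<cdot> s"
      using germ_inject[OF W w Comp_in_Hom[OF r C(4)] Comp_in_Hom[OF s C(4)]] by simp
  qed
  then obtain f where f: "f \<in> Hom B A Y" "f \<cdot> p = g" by blast
  have "y = germ a f" using germ_app[OF C(1) A(1) C(2,3) f(1)] pc f C by simp
  then show ?thesis using f by blast
qed

text \<open>On each summand an equivariant map is determined by the image of one point, which is
  fixed by the stabilizer of that point; \<open>germ_full\<close> turns it into an arrow.\<close>

lemma E_full:
  assumes XO: "X \<in> Obj B" and YO: "Y \<in> Obj B" and \<phi>: "\<And>x. x \<in> E X \<Longrightarrow> \<phi> x \<in> E Y"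
    and equiv: "\<And>g x. \<lbrakk>g \<in> carrier G; x \<in> E X\<rbrakk> \<Longrightarrow> \<phi> (E_act g x) = E_act g (\<phi> x)"
  shows "\<exists>f \<in> Hom B X Y. \<forall>x \<in> E X. E_map f x = \<phi> x"
proof -
  obtain n A \<iota> where A: "\<And>k. k < (n::nat) \<Longrightarrow> A k \<in> At" "is_coproduct B {..<n} A X \<iota>"
    using At_decomposition[OF XO] by metis
  note \<iota> = coproduct_inj_Hom[OF A(2), simplified]
  have "\<exists>f. f \<in> Hom B (A k) Y \<and> (\<forall>a \<in> F (A k). \<phi> (germ a (\<iota> k)) = germ a f)" if k: "k < n" for k
  proof -
    obtain a where a: "a \<in> F (A k)" using F_nonempty[OF A(1)[OF k]] by blast
    have x: "germ a (\<iota> k) \<in> E X" using germ_in_E[OF A(1)[OF k] a \<iota>[OF k]] .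
    have "E_act g (\<phi> (germ a (\<iota> k))) = \<phi> (germ a (\<iota> k))" if "g \<in> carrier G" "act g a = a" for g
      using equiv[OF that(1) x] E_act_germ[OF A(1)[OF k] a \<iota>[OF k] that(1)] that(2) by simp
    then have "\<exists>f \<in> Hom B (A k) Y. \<phi> (germ a (\<iota> k)) = germ a f"
      by (intro germ_full[OF A(1)[OF k] a \<phi>[OF x]])
    then obtain f where f: "f \<in> Hom B (A k) Y" "\<phi> (germ a (\<iota> k)) = germ a f" by blast
    have "\<phi> (germ b (\<iota> k)) = germ b f" if b: "b \<in> F (A k)" for b
    proof -
      obtain g where g: "g \<in> carrier G" "act g a = b" using transitive[OF A(1)[OF k] a b] by blast
      show ?thesis
        using equiv[OF g(1) x] E_act_germ[OF A(1)[OF k] a \<iota>[OF k] g(1)]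
          E_act_germ[OF A(1)[OF k] a f(1) g(1)] f(2) g(2) by simp
    qed
    then show ?thesis using f(1) by blast
  qed
  then obtain f where f: "\<forall>k. k < n \<longrightarrow> f k \<in> Hom B (A k) Y \<and>
      (\<forall>a \<in> F (A k). \<phi> (germ a (\<iota> k)) = germ a (f k))"
    by metis
  then have fH: "f k \<in> Hom B (A k) Y" if "k \<in> {..<n}" for k using that by simp
  obtain h where h: "h \<in> Hom B X Y" "\<And>k. k \<in> {..<n} \<Longrightarrow> h \<cdot> \<iota> k = f k"
    using coproduct_desc[OF A(2) fH YO] by blast
  have "E_map h x = \<phi> x" if x: "x \<in> E X" for x
  proof -
    obtain k a where k: "k < n" "a \<in> F (A k)" "x = germ a (\<iota> k)"
      using E_coproduct_cases[OF A x] .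
    then show ?thesis using E_map_germ[OF A(1)[OF k(1)] k(2) \<iota>[OF k(1)] h(1)] h(2)[of k] f by simp
  qed
  then show ?thesis using h(1) by blast
qed

text \<open>Invert the injective map \<open>E_map m\<close> on its image; the equivariant map so
  obtained comes from an arrow by \<open>E_full\<close>.\<close>

lemma E_lift:
  assumes m: "m \<in> Hom B R P" "is_monic B m" and f: "f \<in> Hom B T P"
    and sub: "\<And>x. x \<in> E T \<Longrightarrow> E_map f x \<in> E_map m ` E R"
  obtains h where "h \<in> Hom B T R" "m \<cdot> h = f"
proof -
  have O: "T \<in> Obj B" "R \<in> Obj B" using m f Hom_simps by blast+
  have inj: "inj_on (E_map m) (E R)" using monic_E_iff[OF m(1)] m(2) by simp
  define \<phi> where "\<phi> x = inv_into (E R) (E_map m) (E_map f x)" for x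
  have \<phi>: "\<phi> x \<in> E R" "E_map m (\<phi> x) = E_map f x" if "x \<in> E T" for x
    using sub[OF that] by (auto simp: \<phi>_def inv_into_into f_inv_into_f)
  have "\<phi> (E_act g x) = E_act g (\<phi> x)" if g: "g \<in> carrier G" and x: "x \<in> E T" for g x
  proof (rule inj_onD[OF inj])
    show "E_map m (\<phi> (E_act g x)) = E_map m (E_act g (\<phi> x))"
      using \<phi>[OF E_act_closed[OF g x]] \<phi>[OF x] E_map_act[OF m(1) g] E_map_act[OF f g x] by simp
  qed (use \<phi> E_act_closed g x in auto)
  then have "\<exists>h \<in> Hom B T R. \<forall>x \<in> E T. E_map h x = \<phi> x"
    by (intro E_full[OF O \<phi>(1)])
  then obtain h where h: "h \<in> Hom B T R" "\<And>x. x \<in> E T \<Longrightarrow> E_map h x = \<phi> x" by blast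
  have "m \<cdot> h = f"
    by (rule E_faithful[OF Comp_in_Hom[OF h(1) m(1)] f])
      (use h \<phi> E_map_Comp[OF h(1) m(1)] in simp)
  then show thesis using that h(1) by blast
qed

text \<open>A stable subset is a union of orbits, the orbits are the sets \<open>F (A k)\<close>,
  and the coproduct of the corresponding summands is the subobject.\<close>

lemma E_subobject:
  assumes PO: "P \<in> Obj B" and S: "S \<subseteq> E P"
    and stable: "\<And>g x. \<lbrakk>g \<in> carrier G; x \<in> S\<rbrakk> \<Longrightarrow> E_act g x \<in> S"
  obtains R m where "m \<in> Hom B R P" "is_monic B m" "E_map m ` E R = S"
proof -
  obtain n A \<iota> where A: "\<And>k. k < (n::nat) \<Longrightarrow> A k \<in> At" "is_coproduct B {..<n} A P \<iota>"
    using At_decomposition[OF PO] by metis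
  note \<iota> = coproduct_inj_Hom[OF A(2), simplified]
  define K where "K = {k. k < n \<and> (\<exists>a \<in> F (A k). germ a (\<iota> k) \<in> S)}"
  have K: "germ a (\<iota> k) \<in> S" if kK: "k \<in> K" and a: "a \<in> F (A k)" for k a
  proof -
    obtain b where b: "k < n" "b \<in> F (A k)" "germ b (\<iota> k) \<in> S" using kK unfolding K_def by blast
    obtain g where "g \<in> carrier G" "act g b = a" using transitive[OF A(1)[OF b(1)] b(2) a] by blast
    then show ?thesis using stable b E_act_germ[OF A(1)[OF b(1)] b(2) \<iota>[OF b(1)]] by metis
  qed
  have "finite K" by (simp add: K_def)
  \<comment> \<open>Finite coproducts are indexed by initial segments of the naturals, so K is
    renumbered.\<close>
  then obtain e where e: "bij_betw e {0..<card K} K" using ex_bij_betw_nat_finite by blast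
  have eK: "e j \<in> K" "e j < n" if "j < card K" for j
    using bij_betwE[OF e] that by (auto simp: K_def)
  have "\<forall>j<card K. A (e j) \<in> Obj B" using eK A(1) At_atom by (auto simp: is_atom_def)
  then obtain R \<kappa> where R: "is_coproduct B {..<card K} (A \<circ> e) R \<kappa>"
    using finite_coproducts unfolding has_finite_coproducts_def by (metis comp_apply)
  note \<kappa> = coproduct_inj_Hom[OF R, simplified]
  have "(\<iota> \<circ> e) j \<in> Hom B ((A \<circ> e) j) P" if "j \<in> {..<card K}" for j using \<iota> eK that by simp
  from coproduct_desc[OF R this PO] obtain m where
    m: "m \<in> Hom B R P" "\<And>j. j \<in> {..<card K} \<Longrightarrow> m \<cdot> \<kappa> j = (\<iota> \<circ> e) j" by metis
  have mono: "is_monic B m"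
  proof (rule monic_atomI[OF m(1)])
    fix T r s assume T: "is_atom B T" "r \<in> Hom B T R" "s \<in> Hom B T R" "m \<cdot> r = m \<cdot> s"
    obtain i r' where i: "i < card K" "r' \<in> Hom B T ((A \<circ> e) i)" "r = \<kappa> i \<cdot> r'"
      using atom_coproduct_factor[OF T(1) R T(2)] .
    obtain j s' where j: "j < card K" "s' \<in> Hom B T ((A \<circ> e) j)" "s = \<kappa> j \<cdot> s'"
      using atom_coproduct_factor[OF T(1) R T(3)] .
    have "m \<cdot> r = \<iota> (e i) \<cdot> r'" "m \<cdot> s = \<iota> (e j) \<cdot> s'"
      using Comp_assoc[OF i(2) _ m(1), of "\<kappa> i"] Comp_assoc[OF j(2) _ m(1), of "\<kappa> j"] \<kappa> i j m(2)
          by simp_all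
    then have "e i = e j \<and> r' = s'"
      using atom_coproduct_inj[OF T(1) A(2) eK(2)[OF i(1)] eK(2)[OF j(1)]] T(4) i j by simp
    moreover from this have "i = j" using e i(1) j(1) by (auto simp: bij_betw_def inj_on_def)
    ultimately show "r = s" using i j by simp
  qed
  have R_At: "(A \<circ> e) j \<in> At" if "j < card K" for j using A(1) eK(2)[OF that] by simp
  have m\<kappa>: "E_map m (germ a (\<kappa> j)) = germ a (\<iota> (e j))" if "j < card K" "a \<in> F (A (e j))" for j a
    using E_map_germ[OF R_At[OF that(1)] _ _ m(1), of a "\<kappa> j"] \<kappa> m(2) that by simp
  have "E_map m ` E R = S"
  proof
    show "E_map m ` E R \<subseteq> S"
    proof (rule image_subsetI)
      fix x assume "x \<in> E R"
      then obtain j a where "j < card K" "a \<in> F ((A \<circ> e) j)" "x = germ a (\<kappa> j)"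
        using E_coproduct_cases[OF R_At R] by metis
      then show "E_map m x \<in> S" using m\<kappa> K eK by simp
    qed
    show "S \<subseteq> E_map m ` E R"
    proof
      fix x assume x: "x \<in> S"
      then obtain k a where k: "k < n" "a \<in> F (A k)" "x = germ a (\<iota> k)"
        using E_coproduct_cases[OF A] S by (metis subsetD)
      then have "k \<in> K" using x by (auto simp: K_def)
      then obtain j where j: "j < card K" "k = e j"
        using e unfolding bij_betw_def by (metis atLeastLessThan_iff imageE)
      then have "germ a (\<kappa> j) \<in> E R" using germ_in_E[OF R_At[OF j(1)]] \<kappa> k by simp
      moreover have "E_map m (germ a (\<kappa> j)) = x" using m\<kappa> j k by simp
      ultimately show "x \<in> E_map m ` E R" by blast
    qed
  qed
  then show thesis using that m(1) mono by blast
qed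

section \<open>The topology of G and its admissibility\<close>

definition point_topology :: "'g topology" where
  "point_topology = topology (\<lambda>N. N \<subseteq> carrier G \<and>
     (\<forall>g \<in> N. \<exists>A \<in> At. \<exists>x \<in> F A. \<forall>h \<in> carrier G. act h x = act g x \<longrightarrow> h \<in> N))"

text \<open>A single point suffices in place of a finite set: by \<open>joint\<close> two points are
  images of a third one, whose stabilizer lies in both of theirs. This gives closure under
  intersection.\<close>

lemma openin_point_topology:
  "openin point_topology N \<longleftrightarrow> N \<subseteq> carrier G \<and>
     (\<forall>g \<in> N. \<exists>A \<in> At. \<exists>x \<in> F A. \<forall>h \<in> carrier G. act h x = act g x \<longrightarrow> h \<in> N)"
proof -
  have "istopology (\<lambda>N. N \<subseteq> carrier G \<and>
     (\<forall>g \<in> N. \<exists>A \<in> At. \<exists>x \<in> F A. \<forall>h \<in> carrier G. act h x = act g x \<longrightarrow> h \<in> N))" (is "istopology ?P")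
    unfolding istopology_def
  proof (intro conjI allI impI)
    fix N M assume N: "?P N" and M: "?P M"
    show "N \<inter> M \<subseteq> carrier G" using N by blast
    show "\<forall>g \<in> N \<inter> M. \<exists>A \<in> At. \<exists>x \<in> F A. \<forall>h \<in> carrier G. act h x = act g x \<longrightarrow> h \<in> N \<inter> M"
    proof
      fix g assume g: "g \<in> N \<inter> M"
      then have gG: "g \<in> carrier G" using N by blast
      obtain A x where A: "A \<in> At" "x \<in> F A" "\<forall>h \<in> carrier G. act h x = act g x \<longrightarrow> h \<in> N"
        using g N by blast
      obtain A' y where A': "A' \<in> At" "y \<in> F A'" "\<forall>h \<in> carrier G. act h y = act g y \<longrightarrow> h \<in> M"
        using g M by blast
      obtain C z p q where C: "C \<in> At" "z \<in> F C" "p \<in> Hom B C A" "q \<in> Hom B C A'"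
        "app p z = x" "app q z = y"
        using joint[OF A(1) A'(1) A(2) A'(2)] by blast
      have "act h x = act g x \<and> act h y = act g y" if "h \<in> carrier G" "act h z = act g z" for h
        using act_app[OF that(1) C(1) A(1) C(3,2)] act_app[OF that(1) C(1) A'(1) C(4,2)]
          act_app[OF gG C(1) A(1) C(3,2)] act_app[OF gG C(1) A'(1) C(4,2)] C that by simp
      then show "\<exists>A \<in> At. \<exists>x \<in> F A. \<forall>h \<in> carrier G. act h x = act g x \<longrightarrow> h \<in> N \<inter> M"
        using C A A' by blast
    qed
  next
    fix \<K> assume \<K>: "\<forall>N \<in> \<K>. ?P N"
    then show "\<Union>\<K> \<subseteq> carrier G" by blast
    show "\<forall>g \<in> \<Union>\<K>. \<exists>A \<in> At. \<exists>x \<in> F A. \<forall>h \<in> carrier G. act h x = act g x \<longrightarrow> h \<in> \<Union>\<K>"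
    proof
      fix g assume "g \<in> \<Union>\<K>"
      then obtain N where N: "N \<in> \<K>" "g \<in> N" by blast
      then obtain A x where A: "A \<in> At" "x \<in> F A" "\<forall>h \<in> carrier G. act h x = act g x \<longrightarrow> h \<in> N"
        using \<K> by blast
      then show "\<exists>A \<in> At. \<exists>x \<in> F A. \<forall>h \<in> carrier G. act h x = act g x \<longrightarrow> h \<in> \<Union>\<K>"
        using N by blast
    qed
  qed
  then show ?thesis unfolding point_topology_def by (simp add: topology_inverse')
qed

lemma At_nonempty: "At \<noteq> {}"
  using final_exists final_atom At_rep by blast

lemma topspace_point_topology: "topspace point_topology = carrier G"
proof
  show "topspace point_topology \<subseteq> carrier G" unfolding topspace_def openin_point_topology by blast
  have "openin point_topology (carrier G)"
    unfolding openin_point_topology using At_nonempty F_nonempty by blast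
  then show "carrier G \<subseteq> topspace point_topology" by (rule openin_subset)
qed

lemma openin_coset:
  assumes "A \<in> At" "x \<in> F A" "y \<in> F A"
  shows "openin point_topology {h \<in> carrier G. act h x = y}"
  unfolding openin_point_topology using assms by blast

lemma topological_group_G: "topological_group G point_topology"
  unfolding topological_group_def
proof (intro conjI)
  interpret G: group G by (rule group_G)
  show "continuous_map (prod_topology point_topology point_topology) point_topology
     (\<lambda>(x, y). x \<otimes>\<^bsub>G\<^esub> y)"
    unfolding continuous_map_def topspace_prod_topology topspace_point_topology
  proof (intro conjI allI impI)
    fix N assume N: "openin point_topology N"
    let ?M = "{z \<in> carrier G \<times> carrier G. (case z of (x, y) \<Rightarrow> x \<otimes>\<^bsub>G\<^esub> y) \<in> N}"
    show "openin (prod_topology point_topology point_topology) ?M"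
      unfolding openin_prod_topology_alt
    proof (intro allI impI)
      fix g h assume "(g, h) \<in> ?M"
      then have gh: "g \<in> carrier G" "h \<in> carrier G" "g \<otimes>\<^bsub>G\<^esub> h \<in> N" by auto
      obtain A x where A: "A \<in> At" "x \<in> F A"
        "\<And>k. \<lbrakk>k \<in> carrier G; act k x = act (g \<otimes>\<^bsub>G\<^esub> h) x\<rbrakk> \<Longrightarrow> k \<in> N"
        using N gh(3) unfolding openin_point_topology by blast
      have hx: "act h x \<in> F A" using act_closed[OF gh(2) A(1,2)] .
      show "\<exists>U V. openin point_topology U \<and> openin point_topology V \<and> g \<in> U \<and> h \<in> V \<and> U \<times> V \<subseteq> ?M"
      proof (intro exI conjI)
        \<comment> \<open>The factor near \<open>g\<close> is controlled at the moved point
          \<open>act h x\<close>, the one near \<open>h\<close> at \<open>x\<close>.\<close>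
        show "openin point_topology {k \<in> carrier G. act k (act h x) = act g (act h x)}"
          using openin_coset[OF A(1) hx act_closed[OF gh(1) A(1) hx]] .
        show "openin point_topology {k \<in> carrier G. act k x = act h x}"
          using openin_coset[OF A(1,2) hx] .
        show "{k \<in> carrier G. act k (act h x) = act g (act h x)} \<times> {k \<in> carrier G. act k x =
            act h x} \<subseteq> ?M"
          using A(3) gh act_mult[OF _ _ A(1,2)] by auto
      qed (use gh in auto)
    qed
  qed auto
  show "continuous_map point_topology point_topology (\<lambda>x. inv\<^bsub>G\<^esub> x)"
    unfolding continuous_map_def topspace_point_topology
  proof (intro conjI allI impI)
    fix N assume N: "openin point_topology N"
    show "openin point_topology {x \<in> carrier G. inv\<^bsub>G\<^esub> x \<in> N}"
      unfolding openin_point_topology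
    proof (intro conjI ballI)
      fix g assume g: "g \<in> {x \<in> carrier G. inv\<^bsub>G\<^esub> x \<in> N}"
      then obtain A x where A: "A \<in> At" "x \<in> F A"
        "\<And>k. \<lbrakk>k \<in> carrier G; act k x = act (inv\<^bsub>G\<^esub> g) x\<rbrakk> \<Longrightarrow> k \<in> N"
        using N unfolding openin_point_topology by blast
      have gG: "g \<in> carrier G" "inv\<^bsub>G\<^esub> g \<in> carrier G" using g by auto
      let ?y = "act (inv\<^bsub>G\<^esub> g) x"
      have y: "?y \<in> F A" using act_closed[OF gG(2) A(1,2)] .
      have gy: "act g ?y = x"
        using act_mult[OF gG A(1,2)] act_one[OF A(1,2)] gG by simp
      have "h \<in> {x \<in> carrier G. inv\<^bsub>G\<^esub> x \<in> N}" if h: "h \<in> carrier G" "act h ?y = act g ?y" for h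
      proof -
        have "act (inv\<^bsub>G\<^esub> h) x = act (inv\<^bsub>G\<^esub> h) (act h ?y)" using h gy by simp
        also have "\<dots> = ?y" using act_mult[OF _ h(1) A(1) y, of "inv\<^bsub>G\<^esub> h"] act_one[OF A(1) y] h by simp
        finally show ?thesis using A(3)[of "inv\<^bsub>G\<^esub> h"] h by simp
      qed
      then show "\<exists>A \<in> At. \<exists>x \<in> F A. \<forall>h \<in> carrier G. act h x = act g x \<longrightarrow> h \<in> {x \<in> carrier G. inv\<^bsub>G\<^esub> x \<in> N}"
        using A(1) y by blast
    qed auto
  qed auto
qed (simp_all add: group_G topspace_point_topology)

lemma Hausdorff_G: "Hausdorff_space point_topology"
  unfolding Hausdorff_space_def topspace_point_topology
proof (intro allI impI)
  fix g h assume gh: "g \<in> carrier G \<and> h \<in> carrier G \<and> g \<noteq> h"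
  then obtain A x where A: "A \<in> At" "x \<in> F A" "act g x \<noteq> act h x" using act_faithful by blast
  show "\<exists>U V. openin point_topology U \<and> openin point_topology V \<and> g \<in> U \<and> h \<in> V \<and> disjnt U V"
    by (rule exI[of _ "{k \<in> carrier G. act k x = act g x}"],
        rule exI[of _ "{k \<in> carrier G. act k x = act h x}"])
      (use A gh openin_coset act_closed in \<open>auto simp: disjnt_def\<close>)
qed

lemma stabilizer_subgroup:
  assumes "A \<in> At" "x \<in> F A"
  shows "subgroup {h \<in> carrier G. act h x = x} G"
proof -
  interpret G: group G by (rule group_G)
  have "act (inv\<^bsub>G\<^esub> h) x = x" if "h \<in> carrier G" "act h x = x" for h
    using act_mult[OF _ that(1) assms, of "inv\<^bsub>G\<^esub> h"] act_one[OF assms] that by simp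
  then show ?thesis
    by unfold_locales (use assms act_mult act_one in auto)
qed

lemma non_archimedean_G: "non_archimedean G point_topology"
  unfolding non_archimedean_def
proof (intro allI impI)
  fix N assume N: "openin point_topology N \<and> \<one>\<^bsub>G\<^esub> \<in> N"
  then obtain A x where A: "A \<in> At" "x \<in> F A"
    "\<And>k. \<lbrakk>k \<in> carrier G; act k x = act \<one>\<^bsub>G\<^esub> x\<rbrakk> \<Longrightarrow> k \<in> N"
    unfolding openin_point_topology by blast
  then show "\<exists>U. open_subgroup G point_topology U \<and> U \<subseteq> N"
    by (intro exI[of _ "{h \<in> carrier G. act h x = x}"])
      (auto simp: open_subgroup_def stabilizer_subgroup openin_coset act_one)
qed

text \<open>The double cosets of the stabilizers of \<open>x \<in> F A\<close> and \<open>y \<in> F A'\<close> are the orbits of \<open>G\<close> on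
  \<open>F A' \<times> F A\<close>, that is, the components of \<open>A' \<times> A\<close>.\<close>

lemma roelcke_precompact_G: "roelcke_precompact G point_topology"
  unfolding roelcke_precompact_def
proof (intro allI impI)
  interpret G: group G by (rule group_G)
  fix U V assume UV: "open_subgroup G point_topology U \<and> open_subgroup G point_topology V"
  then have sub: "subgroup U G" "subgroup V G" by (auto simp: open_subgroup_def)
  obtain A x where A: "A \<in> At" "x \<in> F A" "\<And>k. \<lbrakk>k \<in> carrier G; act k x = x\<rbrakk> \<Longrightarrow> k \<in> U"
    using UV subgroup.one_closed[OF sub(1)] act_one unfolding open_subgroup_def openin_point_topology
    by metis
  obtain A' y where A': "A' \<in> At" "y \<in> F A'" "\<And>k. \<lbrakk>k \<in> carrier G; act k y = y\<rbrakk> \<Longrightarrow> k \<in> V"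
    using UV subgroup.one_closed[OF sub(2)] act_one unfolding open_subgroup_def openin_point_topology
    by metis
  have O: "A' \<in> Obj B" "A \<in> Obj B" using A A' At_atom by (auto simp: is_atom_def)
  obtain P p q where P: "is_product2 B A' A P p q" using product_exists[OF O] .
  have pq: "p \<in> Hom B P A'" "q \<in> Hom B P A" "P \<in> Obj B" using P by (auto simp: is_product2_def)
  obtain n D \<iota> where D: "\<And>k. k < (n::nat) \<Longrightarrow> D k \<in> At" "is_coproduct B {..<n} D P \<iota>"
    using At_decomposition[OF pq(3)] by metis
  note \<iota> = coproduct_inj_Hom[OF D(2), simplified]
  \<comment> \<open>\<open>k\<close> is a component of A' x A that contains the pair of
    \<open>y\<close> and \<open>act g x\<close>, and \<open>w\<close> is a point of it above this
    pair.\<close>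
  have "\<exists>k w. k < n \<and> w \<in> F (D k) \<and> app (p \<cdot> \<iota> k) w = y \<and> app (q \<cdot> \<iota> k) w = act g x"
    if g: "g \<in> carrier G" for g
  proof -
    obtain C c r s where C: "C \<in> At" "c \<in> F C" "r \<in> Hom B C A'" "s \<in> Hom B C A"
      "app r c = y" "app s c = act g x"
      using joint[OF A'(1) A(1) A'(2) act_closed[OF g A(1,2)]] by blast
    obtain h where h: "h \<in> Hom B C P" "p \<cdot> h = r" "q \<cdot> h = s" using product2_pair[OF P C(3,4)] .
    obtain k v where k: "k < n" "v \<in> Hom B C (D k)" "h = \<iota> k \<cdot> v"
      using atom_coproduct_factor[OF At_atom[OF C(1)] D(2) h(1)] .
    have pk: "p \<cdot> \<iota> k \<in> Hom B (D k) A'" "q \<cdot> \<iota> k \<in> Hom B (D k) A" using pq \<iota>[OF k(1)] Comp_in_Hom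
        by blast+
    have "r = (p \<cdot> \<iota> k) \<cdot> v" "s = (q \<cdot> \<iota> k) \<cdot> v"
      using Comp_assoc[OF k(2) \<iota>[OF k(1)] pq(1)] Comp_assoc[OF k(2) \<iota>[OF k(1)] pq(2)] k(3) h by simp_all
    then have "app (p \<cdot> \<iota> k) (app v c) = y" "app (q \<cdot> \<iota> k) (app v c) = act g x"
      using app_Comp[OF C(1) D(1)[OF k(1)] A'(1) k(2) pk(1) C(2)]
        app_Comp[OF C(1) D(1)[OF k(1)] A(1) k(2) pk(2) C(2)] C by simp_all
    then show ?thesis using app_closed[OF C(1) D(1)[OF k(1)] k(2) C(2)] k(1) by blast
  qed
  then obtain \<kappa> w where \<kappa>: "\<forall>g. g \<in> carrier G \<longrightarrow> \<kappa> g < n \<and> w g \<in> F (D (\<kappa> g)) \<and>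
      app (p \<cdot> \<iota> (\<kappa> g)) (w g) = y \<and> app (q \<cdot> \<iota> (\<kappa> g)) (w g) = act g x"
    by metis
  \<comment> \<open>An element \<open>h\<close> that carries \<open>w g\<close> to
    \<open>w g'\<close> fixes \<open>y\<close>, so it lies in V, and it takes \<open>act g x\<close>
    to \<open>act g' x\<close>, so that the product of \<open>h\<close> and \<open>g\<close> differs
    from \<open>g'\<close> by an element of U.\<close>
  have same: "g' \<in> V <#>\<^bsub>G\<^esub> (g <#\<^bsub>G\<^esub> U)"
    if g: "g \<in> carrier G" and g': "g' \<in> carrier G" and eq: "\<kappa> g = \<kappa> g'" for g g'
  proof -
    let ?k = "\<kappa> g"
    have k: "?k < n" "w g \<in> F (D ?k)" "w g' \<in> F (D ?k)" using \<kappa> g g' eq by metis+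
    obtain h where h: "h \<in> carrier G" "act h (w g) = w g'" using transitive[OF D(1)[OF k(1)] k(2,3)]
        by blast
    have pk: "p \<cdot> \<iota> ?k \<in> Hom B (D ?k) A'" "q \<cdot> \<iota> ?k \<in> Hom B (D ?k) A"
      using pq \<iota>[OF k(1)] Comp_in_Hom by blast+
    have "act h y = y"
      using act_app[OF h(1) D(1)[OF k(1)] A'(1) pk(1) k(2)] \<kappa> g g' eq h by metis
    then have hV: "h \<in> V" using A' h by blast
    have "act h (act g x) = act g' x"
      using act_app[OF h(1) D(1)[OF k(1)] A(1) pk(2) k(2)] \<kappa> g g' eq h by metis
    then have hg: "act (h \<otimes>\<^bsub>G\<^esub> g) x = act g' x" using act_mult[OF h(1) g A(1,2)] by simp
    define t where "t = inv\<^bsub>G\<^esub> (h \<otimes>\<^bsub>G\<^esub> g) \<otimes>\<^bsub>G\<^esub> g'"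
    have hgG: "h \<otimes>\<^bsub>G\<^esub> g \<in> carrier G" using h g by simp
    have tG: "t \<in> carrier G" using g' hgG by (simp add: t_def)
    have "act t x = act (inv\<^bsub>G\<^esub> (h \<otimes>\<^bsub>G\<^esub> g)) (act (h \<otimes>\<^bsub>G\<^esub> g) x)"
      using act_mult[OF _ g' A(1,2), of "inv\<^bsub>G\<^esub> (h \<otimes>\<^bsub>G\<^esub> g)"] hg hgG by (simp add: t_def)
    also have "\<dots> = x"
      using act_mult[OF _ hgG A(1,2), of "inv\<^bsub>G\<^esub> (h \<otimes>\<^bsub>G\<^esub> g)"] act_one[OF A(1,2)] hgG by simp
    finally have "t \<in> U" using A(3) tG by blast
    moreover have "g' = h \<otimes>\<^bsub>G\<^esub> (g \<otimes>\<^bsub>G\<^esub> t)"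
    proof -
      have "h \<otimes>\<^bsub>G\<^esub> (g \<otimes>\<^bsub>G\<^esub> t) = (h \<otimes>\<^bsub>G\<^esub> g) \<otimes>\<^bsub>G\<^esub> t" using h g tG by (simp add: G.m_assoc)
      also have "\<dots> = g'" using hgG g' by (simp add: t_def flip: G.m_assoc)
      finally show ?thesis by simp
    qed
    ultimately show ?thesis using hV unfolding set_mult_def l_coset_def by blast
  qed
  have "V <#>\<^bsub>G\<^esub> (g <#\<^bsub>G\<^esub> U) = V <#>\<^bsub>G\<^esub> (g' <#\<^bsub>G\<^esub> U)"
    if g: "g \<in> carrier G" and g': "g' \<in> carrier G" and eq: "\<kappa> g = \<kappa> g'" for g g'
  proof -
    \<comment> \<open>Used in both directions, this turns the membership obtained in
      \<open>same\<close> into equality of double cosets.\<close>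
    have "V <#>\<^bsub>G\<^esub> (h' <#\<^bsub>G\<^esub> U) \<subseteq> V <#>\<^bsub>G\<^esub> (h <#\<^bsub>G\<^esub> U)"
      if h: "h \<in> carrier G" "h' \<in> V <#>\<^bsub>G\<^esub> (h <#\<^bsub>G\<^esub> U)" for h h'
    proof -
      obtain v t where vt: "v \<in> V" "t \<in> U" "h' = v \<otimes>\<^bsub>G\<^esub> (h \<otimes>\<^bsub>G\<^esub> t)"
        using h unfolding set_mult_def l_coset_def by blast
      have vG: "v \<in> carrier G" "t \<in> carrier G" using vt subgroup.mem_carrier sub by metis+
      show ?thesis
      proof
        fix z assume "z \<in> V <#>\<^bsub>G\<^esub> (h' <#\<^bsub>G\<^esub> U)"
        then obtain v' t' where vt': "v' \<in> V" "t' \<in> U" "z = v' \<otimes>\<^bsub>G\<^esub> (h' \<otimes>\<^bsub>G\<^esub> t')"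
          unfolding set_mult_def l_coset_def by blast
        have vG': "v' \<in> carrier G" "t' \<in> carrier G" using vt' subgroup.mem_carrier sub by metis+
        have "z = (v' \<otimes>\<^bsub>G\<^esub> v) \<otimes>\<^bsub>G\<^esub> (h \<otimes>\<^bsub>G\<^esub> (t \<otimes>\<^bsub>G\<^esub> t'))"
          using vt vt' vG vG' h by (simp add: G.m_assoc)
        moreover have "v' \<otimes>\<^bsub>G\<^esub> v \<in> V" "t \<otimes>\<^bsub>G\<^esub> t' \<in> U"
          using vt vt' sub subgroup.m_closed by metis+
        ultimately show "z \<in> V <#>\<^bsub>G\<^esub> (h <#\<^bsub>G\<^esub> U)" unfolding set_mult_def l_coset_def by blast
      qed
    qed
    then show ?thesis using same[OF g g' eq] same[OF g' g eq[symmetric]] g g' by blast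
  qed
  then have "V <#>\<^bsub>G\<^esub> (g <#\<^bsub>G\<^esub> U) =
      V <#>\<^bsub>G\<^esub> ((SOME g'. g' \<in> carrier G \<and> \<kappa> g' = \<kappa> g) <#\<^bsub>G\<^esub> U)" if "g \<in> carrier G" for g
    using someI[of "\<lambda>g'. g' \<in> carrier G \<and> \<kappa> g' = \<kappa> g" g] that by metis
  then have "{V <#>\<^bsub>G\<^esub> (g <#\<^bsub>G\<^esub> U) | g. g \<in> carrier G} \<subseteq>
      (\<lambda>k. V <#>\<^bsub>G\<^esub> ((SOME g'. g' \<in> carrier G \<and> \<kappa> g' = k) <#\<^bsub>G\<^esub> U)) ` {..<n}"
    using \<kappa> by blast
  then show "finite {V <#>\<^bsub>G\<^esub> (g <#\<^bsub>G\<^esub> U) | g. g \<in> carrier G}"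
    using finite_surj[OF finite_lessThan] by blast
qed

lemma admissible_G: "admissible_group G point_topology"
  by (simp add: admissible_group_def topological_group_G Hausdorff_G non_archimedean_G
      roelcke_precompact_G)

section \<open>The equivalence with finitary smooth sets\<close>

definition E_gset :: "'o \<Rightarrow> ('g, ('p \<times> 'a) set) gset" where
  "E_gset X = (E X, \<lambda>g\<in>carrier G. \<lambda>x\<in>E X. E_act g x)"

lemma E_gset_smooth:
  assumes XO: "X \<in> Obj B"
  shows "E_gset X \<in> smooth_gsets G point_topology"
proof -
  let ?\<phi> = "\<lambda>g\<in>carrier G. \<lambda>x\<in>E X. E_act g x"
  have "group_action G (E X) ?\<phi>"
    by (rule group_action_restrict[OF group_G E_act_closed E_act_mult E_act_one])
  moreover have "openin point_topology (stabilizer G ?\<phi> x)" if x: "x \<in> E X" for x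
  proof -
    obtain A a f where A: "A \<in> At" "a \<in> F A" "f \<in> Hom B A X" "x = germ a f"
      using E_cases[OF x] .
    have "h \<in> stabilizer G ?\<phi> x"
      if "g \<in> stabilizer G ?\<phi> x" "h \<in> carrier G" "act h a = act g a" for g h
      using that x E_act_germ[OF A(1-3)] A(4) by (auto simp: stabilizer_def)
    moreover have "stabilizer G ?\<phi> x \<subseteq> carrier G" by (auto simp: stabilizer_def)
    ultimately show ?thesis unfolding openin_point_topology using A(1,2) by blast
  qed
  moreover have "finite (orbits G (E X) ?\<phi>)"
  proof -
    obtain n A \<iota> where A: "\<And>k. k < (n::nat) \<Longrightarrow> A k \<in> At" "is_coproduct B {..<n} A X \<iota>"
      using At_decomposition[OF XO] by metis
    have "orbit G ?\<phi> x \<in> (\<lambda>k. (\<lambda>a. germ a (\<iota> k)) ` F (A k)) ` {..<n}" if x: "x \<in> E X" for x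
    proof -
      obtain k a where k: "k < n" "a \<in> F (A k)" "x = germ a (\<iota> k)" using E_coproduct_cases[OF A x] .
      have "orbit G ?\<phi> x = (\<lambda>a. germ a (\<iota> k)) ` (\<lambda>g. act g a) ` carrier G"
        using x E_act_coproduct[OF A k(1,2)] k(3) by (auto simp: orbit_def)
      moreover have "(\<lambda>g. act g a) ` carrier G = F (A k)"
        using transitive[OF A(1)[OF k(1)] k(2)] act_closed[OF _ A(1)[OF k(1)] k(2)] by blast
      ultimately have "orbit G ?\<phi> x = (\<lambda>a. germ a (\<iota> k)) ` F (A k)" by simp
      then show ?thesis using k(1) by blast
    qed
    then have "orbits G (E X) ?\<phi> \<subseteq> (\<lambda>k. (\<lambda>a. germ a (\<iota> k)) ` F (A k)) ` {..<n}"
      by (auto simp: orbits_def)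
    then show ?thesis using finite_surj[OF finite_lessThan] by blast
  qed
  ultimately show ?thesis by (auto simp: E_gset_def smooth_gsets_def)
qed

text \<open>Cover \<open>D\<close> by \<open>E X\<close>, where \<open>X\<close> is a coproduct of atoms, one for each orbit. The kernel of this
  cover is \<open>E R\<close> for a subobject \<open>R\<close> of \<open>X \<times> X\<close>, and \<open>D\<close> is recovered from the quotient of \<open>X\<close> by
  \<open>R\<close>.\<close>

lemma E_ess_surj:
  assumes D: "(D, \<rho>) \<in> smooth_gsets G point_topology"
  obtains Q \<chi> where "Q \<in> Obj B" "bij_betw \<chi> (E Q) D"
    "\<And>g x. \<lbrakk>g \<in> carrier G; x \<in> E Q\<rbrakk> \<Longrightarrow> \<chi> (E_act g x) = \<rho> g (\<chi> x)"
proof -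
  interpret G: group G by (rule group_G)
  interpret D: group_action G D \<rho> using D by (simp add: smooth_gsets_def)
  have \<rho>: "\<rho> g d \<in> D" if "g \<in> carrier G" "d \<in> D" for g d using D.element_image that by blast
  have \<rho>_mult: "\<rho> (g \<otimes>\<^bsub>G\<^esub> h) d = \<rho> g (\<rho> h d)"
    if "g \<in> carrier G" "h \<in> carrier G" "d \<in> D" for g h d
    using D.composition_rule that by blast
  have \<rho>_one: "\<rho> \<one>\<^bsub>G\<^esub> d = d" if "d \<in> D" for d using D.id_eq_one that by (metis restrict_apply')
  have "finite (orbits G D \<rho>)" using D by (simp add: smooth_gsets_def)
  then obtain n :: nat and Orb where Orb: "orbits G D \<rho> = Orb ` {k. k < n}"
    using finite_conv_nat_seg_image by metis
  have "\<forall>k. \<exists>d. k < n \<longrightarrow> d \<in> D \<and> Orb k = orbit G \<rho> d" using Orb unfolding orbits_def by blast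
  then obtain d where d: "\<forall>k. k < n \<longrightarrow> d k \<in> D \<and> Orb k = orbit G \<rho> (d k)" by metis
  have reps: "\<exists>k<n. \<exists>g\<in>carrier G. x = \<rho> g (d k)" if x: "x \<in> D" for x
  proof -
    have "orbit G \<rho> x \<in> Orb ` {k. k < n}" using Orb x by (auto simp: orbits_def)
    then obtain k where k: "k < n" "orbit G \<rho> x = orbit G \<rho> (d k)" using d by auto
    then have "x \<in> orbit G \<rho> (d k)" using D.orbit_refl[OF x] by simp
    then show ?thesis using k(1) by (auto simp: orbit_def)
  qed
  \<comment> \<open>Since the stabilizer of \<open>d k\<close> is open, it contains the stabilizer
    of some point; so the orbit of \<open>d k\<close> is a quotient of the orbit
    \<open>F (A k)\<close> of that point.\<close>
  have "\<exists>A a. A \<in> At \<and> a \<in> F A \<and> (\<forall>h\<in>carrier G. act h a = a \<longrightarrow> \<rho> h (d k) = d k)" if k: "k < n" for k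
  proof -
    have dk: "d k \<in> D" using d k by blast
    have "openin point_topology (stabilizer G \<rho> (d k))" using D dk by (simp add: smooth_gsets_def)
    moreover have "\<one>\<^bsub>G\<^esub> \<in> stabilizer G \<rho> (d k)" using \<rho>_one[OF dk] by (simp add: stabilizer_def)
    ultimately obtain A a where A: "A \<in> At" "a \<in> F A"
      "\<forall>h\<in>carrier G. act h a = act \<one>\<^bsub>G\<^esub> a \<longrightarrow> h \<in> stabilizer G \<rho> (d k)"
      unfolding openin_point_topology by blast
    then show ?thesis using act_one[OF A(1,2)] by (auto simp: stabilizer_def)
  qed
  then obtain A a where Aa: "\<forall>k. k < n \<longrightarrow> A k \<in> At \<and> a k \<in> F (A k) \<and>
      (\<forall>h\<in>carrier G. act h (a k) = a k \<longrightarrow> \<rho> h (d k) = d k)" by metis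
  then have A: "A k \<in> At" and a: "a k \<in> F (A k)" if "k < n" for k using that by auto
  have "\<forall>k<n. A k \<in> Obj B" using A At_atom by (auto simp: is_atom_def)
  then obtain X \<iota> where X: "is_coproduct B {..<n} A X \<iota>"
    using finite_coproducts unfolding has_finite_coproducts_def by metis
  have XO: "X \<in> Obj B" using X by (simp add: is_coproduct_def)
  \<comment> \<open>Every element of \<open>E X\<close> has the form \<open>pt k g\<close>, and the
    cover \<open>\<chi>0\<close> is to send it to \<open>\<rho> g (d k)\<close>; \<open>wd\<close>
    shows independence of the choice of k and g.\<close>
  define pt where "pt k g = germ (act g (a k)) (\<iota> k)" for k g
  have pt: "pt k g \<in> E X" "E_act h (pt k g) = pt k (h \<otimes>\<^bsub>G\<^esub> g)"
    if k: "k < n" and g: "g \<in> carrier G" and h: "h \<in> carrier G" for k g h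
  proof -
    have ga: "act g (a k) \<in> F (A k)" by (rule act_closed[OF g A[OF k] a[OF k]])
    show "pt k g \<in> E X"
      unfolding pt_def using germ_in_E[OF A[OF k] ga] coproduct_inj_Hom[OF X, of k] k by simp
    show "E_act h (pt k g) = pt k (h \<otimes>\<^bsub>G\<^esub> g)"
      unfolding pt_def using E_act_coproduct[OF A X k ga h] act_mult[OF h g A[OF k] a[OF k]] by simp
  qed
  have pt_cases: "\<exists>k g. k < n \<and> g \<in> carrier G \<and> x = pt k g" if x: "x \<in> E X" for x
  proof -
    obtain k b where k: "k < n" "b \<in> F (A k)" "x = germ b (\<iota> k)" using E_coproduct_cases[OF A X x] .
    then show ?thesis unfolding pt_def using transitive[OF A[OF k(1)] a[OF k(1)] k(2)] by blast
  qed
  have wd: "\<rho> g (d k) = \<rho> h (d l)"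
    if g: "g \<in> carrier G" and h: "h \<in> carrier G" and k: "k < n" and l: "l < n" and e: "pt k g =
        pt l h" for g h k l
  proof -
    note ak = A[OF k] a[OF k]
    have e': "k = l" "act g (a k) = act h (a l)"
      using germ_coproduct_inject[OF A X k l act_closed[OF g ak] act_closed[OF h A[OF l] a[OF l]]] e
      by (auto simp: pt_def)
    have hi: "inv\<^bsub>G\<^esub> h \<in> carrier G" "inv\<^bsub>G\<^esub> h \<otimes>\<^bsub>G\<^esub> g \<in> carrier G" using h g by simp_all
    have "act (inv\<^bsub>G\<^esub> h \<otimes>\<^bsub>G\<^esub> g) (a k) = act (inv\<^bsub>G\<^esub> h \<otimes>\<^bsub>G\<^esub> h) (a k)"
      using act_mult[OF hi(1) g ak] act_mult[OF hi(1) h ak] e' by simp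
    then have "act (inv\<^bsub>G\<^esub> h \<otimes>\<^bsub>G\<^esub> g) (a k) = a k" using act_one[OF ak] h by simp
    then have "\<rho> (inv\<^bsub>G\<^esub> h \<otimes>\<^bsub>G\<^esub> g) (d k) = d k" using Aa k hi(2) by blast
    then have "\<rho> (h \<otimes>\<^bsub>G\<^esub> (inv\<^bsub>G\<^esub> h \<otimes>\<^bsub>G\<^esub> g)) (d k) = \<rho> h (d k)"
      using \<rho>_mult[OF h hi(2)] d k by simp
    moreover have "h \<otimes>\<^bsub>G\<^esub> (inv\<^bsub>G\<^esub> h \<otimes>\<^bsub>G\<^esub> g) = g" using h g by (simp flip: G.m_assoc)
    ultimately show ?thesis using e' by simp
  qed
  define \<chi>0 where "\<chi>0 x = (SOME t. \<exists>k<n. \<exists>g\<in>carrier G. x = pt k g \<and> t = \<rho> g (d k))" for x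
  have \<chi>0_pt: "\<chi>0 (pt k g) = \<rho> g (d k)" if k: "k < n" and g: "g \<in> carrier G" for k g
    unfolding \<chi>0_def
  proof (rule some_equality)
    show "\<exists>l<n. \<exists>h\<in>carrier G. pt k g = pt l h \<and> \<rho> g (d k) = \<rho> h (d l)" using k g by blast
    fix t assume "\<exists>l<n. \<exists>h\<in>carrier G. pt k g = pt l h \<and> t = \<rho> h (d l)"
    then obtain l h where "l < n" "h \<in> carrier G" "pt k g = pt l h" "t = \<rho> h (d l)" by blast
    then show "t = \<rho> g (d k)" using wd[OF g _ k] by simp
  qed
  have \<chi>0_act: "\<chi>0 (E_act h x) = \<rho> h (\<chi>0 x)" if h: "h \<in> carrier G" and x: "x \<in> E X" for h x
  proof -
    obtain k g where k: "k < n" "g \<in> carrier G" "x = pt k g" using pt_cases[OF x] by blast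
    then show ?thesis using pt(2)[OF k(1,2) h] \<chi>0_pt \<rho>_mult[OF h k(2)] d h by simp
  qed
  have \<chi>0_image: "\<chi>0 ` E X = D"
  proof
    show "\<chi>0 ` E X \<subseteq> D"
    proof (rule image_subsetI)
      fix x assume "x \<in> E X"
      then obtain k g where k: "k < n" "g \<in> carrier G" "x = pt k g" using pt_cases by blast
      then show "\<chi>0 x \<in> D" using \<chi>0_pt[OF k(1,2)] \<rho>[OF k(2)] d by simp
    qed
    show "D \<subseteq> \<chi>0 ` E X"
    proof
      fix x assume "x \<in> D"
      then obtain k g where k: "k < n" "g \<in> carrier G" "x = \<rho> g (d k)" using reps by blast
      then show "x \<in> \<chi>0 ` E X"
        using \<chi>0_pt[OF k(1,2)] pt(1)[OF k(1,2) G.one_closed]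
            by (intro image_eqI[of _ _ "pt k g"]) simp_all
    qed
  qed
  obtain P p q where P: "is_product2 B X X P p q" using product_exists[OF XO XO] .
  have pq: "p \<in> Hom B P X" "q \<in> Hom B P X" "P \<in> Obj B" using P by (auto simp: is_product2_def)
  define S where "S = {z \<in> E P. \<chi>0 (E_map p z) = \<chi>0 (E_map q z)}"
  have "E_act g z \<in> S" if "g \<in> carrier G" "z \<in> S" for g z
    using that E_act_closed E_map_act[OF pq(1)] E_map_act[OF pq(2)] \<chi>0_act E_map_closed[OF pq(1)]
      E_map_closed[OF pq(2)] by (simp add: S_def)
  then obtain R m where m: "m \<in> Hom B R P" "is_monic B m" "E_map m ` E R = S"
    using E_subobject[OF pq(3), of S] by (metis (no_types, lifting) S_def mem_Collect_eq subsetI)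
  define p' q' where "p' = p \<cdot> m" and "q' = q \<cdot> m"
  have pq': "p' \<in> Hom B R X" "q' \<in> Hom B R X" using pq m Comp_in_Hom by (auto simp: p'_def q'_def)
  have kernel: "\<chi>0 (E_map p' z) = \<chi>0 (E_map q' z)" if z: "z \<in> E R" for z
    using m(3) z E_map_Comp[OF m(1) pq(1) z] E_map_Comp[OF m(1) pq(2) z]
        by (auto simp: p'_def q'_def S_def)
  \<comment> \<open>Arrows into R are pairs of arrows to X that \<open>\<chi>0\<close> does not
    distinguish on points; reflexivity, symmetry and transitivity of R are three instances.\<close>
  have lift: "\<exists>h \<in> Hom B T R. p' \<cdot> h = r \<and> q' \<cdot> h = s"
    if r: "r \<in> Hom B T X" and s: "s \<in> Hom B T X"
      and rs: "\<And>x. x \<in> E T \<Longrightarrow> \<chi>0 (E_map r x) = \<chi>0 (E_map s x)" for T r s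
  proof -
    obtain f where f: "f \<in> Hom B T P" "p \<cdot> f = r" "q \<cdot> f = s" using product2_pair[OF P r s] .
    have "E_map f x \<in> E_map m ` E R" if x: "x \<in> E T" for x
      using m(3) rs[OF x] E_map_closed[OF f(1) x] E_map_Comp[OF f(1) pq(1) x]
        E_map_Comp[OF f(1) pq(2) x] f by (simp add: S_def)
    then obtain h where h: "h \<in> Hom B T R" "m \<cdot> h = f" using E_lift[OF m(1,2) f(1)] by blast
    then show ?thesis
      using f Comp_assoc[OF h(1) m(1) pq(1)] Comp_assoc[OF h(1) m(1) pq(2)] by (auto simp: p'_def q'_def)
  qed
  have "is_equiv_relation B X P p q R m"
    unfolding is_equiv_relation_def Let_def p'_def[symmetric] q'_def[symmetric]
  proof (intro conjI allI impI)
    show "\<exists>r\<in>Hom B X R. p' \<cdot> r = Ide B X \<and> q' \<cdot> r = Ide B X"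
      by (rule lift) (use XO Ide_in_Hom in auto)
    show "\<exists>s\<in>Hom B R R. p' \<cdot> s = q' \<and> q' \<cdot> s = p'"
      by (rule lift) (use pq' kernel in auto)
    fix K v w assume K: "is_pullback B q' p' K v w"
    note vw = pullbackD[OF K pq'(2,1)]
    show "\<exists>t\<in>Hom B K R. p' \<cdot> t = p' \<cdot> v \<and> q' \<cdot> t = q' \<cdot> w"
    proof (rule lift)
      show "p' \<cdot> v \<in> Hom B K X" "q' \<cdot> w \<in> Hom B K X" using vw pq' Comp_in_Hom by blast+
      fix x assume x: "x \<in> E K"
      show "\<chi>0 (E_map (p' \<cdot> v) x) = \<chi>0 (E_map (q' \<cdot> w) x)"
        using kernel[OF E_map_closed[OF vw(1) x]] kernel[OF E_map_closed[OF vw(2) x]] vw(3)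
          E_map_Comp[OF vw(1) pq'(1) x] E_map_Comp[OF vw(1) pq'(2) x]
          E_map_Comp[OF vw(2) pq'(1) x] E_map_Comp[OF vw(2) pq'(2) x] by simp
    qed
  qed (fact P m(1,2))+
  then obtain Q c where Q: "is_coequalizer B p' q' Q c" "is_pullback B c c R p' q'"
    using effective unfolding equiv_relations_effective_def p'_def q'_def by metis
  have c: "c \<in> Hom B X Q" "c \<cdot> p' = c \<cdot> q'"
    using Q(1) pq' by (auto simp: is_coequalizer_def Hom_simps)
  have QO: "Q \<in> Obj B" using c Hom_simps by blast
  have surj: "E_map c ` E X = E Q" using E_epi[OF c(1) coequalizer_epi[OF Q(1)]] .
  \<comment> \<open>That R is the kernel pair of \<open>c\<close> gives one direction, that
    \<open>c\<close> coequalizes the projections of R gives the other.\<close>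
  have ker_c: "E_map c x = E_map c y \<longleftrightarrow> \<chi>0 x = \<chi>0 y" if x: "x \<in> E X" and y: "y \<in> E X" for x y
  proof
    assume "E_map c x = E_map c y"
    then obtain z where z: "z \<in> E R" "E_map p' z = x" "E_map q' z = y"
      using E_pullback[OF Q(2) c(1) c(1) x y] by metis
    then show "\<chi>0 x = \<chi>0 y" using kernel by blast
  next
    assume e: "\<chi>0 x = \<chi>0 y"
    obtain z where z: "z \<in> E P" "E_map p z = x" "E_map q z = y" using E_product[OF P x y] .
    then have "z \<in> E_map m ` E R" using e m(3) by (simp add: S_def)
    then obtain z' where z': "z' \<in> E R" "z = E_map m z'" by blast
    then have "x = E_map p' z'" "y = E_map q' z'"
      using z E_map_Comp[OF m(1) pq(1) z'(1)] E_map_Comp[OF m(1) pq(2) z'(1)]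
      by (simp_all add: p'_def q'_def)
    then show "E_map c x = E_map c y"
      using E_map_Comp[OF pq'(1) c(1) z'(1)] E_map_Comp[OF pq'(2) c(1) z'(1)] c(2) by simp
  qed
  define \<chi> where "\<chi> y = \<chi>0 (inv_into (E X) (E_map c) y)" for y
  have \<chi>: "\<chi> (E_map c x) = \<chi>0 x" if x: "x \<in> E X" for x
  proof -
    have im: "E_map c x \<in> E_map c ` E X" using x by blast
    show ?thesis
      unfolding \<chi>_def using ker_c[OF inv_into_into[OF im] x] f_inv_into_f[OF im] by simp
  qed
  have "inj_on \<chi> (E Q)"
    unfolding surj[symmetric]
  proof (rule inj_onI, elim imageE)
    fix y y' x x' assume "\<chi> y = \<chi> y'" "y = E_map c x" "x \<in> E X" "y' = E_map c x'" "x' \<in> E X"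
    then show "y = y'" using \<chi> ker_c by simp
  qed
  moreover have "\<chi> ` E Q = D"
    unfolding surj[symmetric] image_image using \<chi> \<chi>0_image by auto
  moreover have "\<chi> (E_act g y) = \<rho> g (\<chi> y)" if g: "g \<in> carrier G" and y: "y \<in> E Q" for g y
  proof -
    obtain x where x: "x \<in> E X" "y = E_map c x" using y surj by blast
    then show ?thesis
      using \<chi>[OF x(1)] \<chi>[OF E_act_closed[OF g x(1)]] E_map_act[OF c(1) g x(1)] \<chi>0_act[OF g x(1)]
      by simp
  qed
  ultimately show thesis using that QO by (simp add: bij_betw_def)
qed

text \<open>\<open>E_gset X\<close> lives on classes of pairs of a point and an arrow, whereas the
  objects of the target category are carried by sets of elements of
  \<open>'g set \<times> nat\<close>. Hence each \<open>E_gset X\<close> is replaced by a copy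
  \<open>Fo X\<close>, and \<open>\<theta> X\<close>, \<open>\<psi> X\<close> translate to and
  fro.\<close>

lemma equivalent_SG:
  "equivalent_categories B (SG G point_topology :: (('g, 'g set \<times> nat) gset, ('g, 'g set \<times> nat) gmap) cat)"
  (is "equivalent_categories B ?SG")
proof -
  have "\<exists>Y \<in> (smooth_gsets G point_topology :: ('g, 'g set \<times> nat) gset set).
      \<exists>f. equivariant G (E_gset X) Y f \<and> bij_betw f (E X) (fst Y)" if "X \<in> Obj B" for X
    using smooth_gset_copy[OF E_gset_smooth[OF that]] by (simp add: E_gset_def)
  then obtain Fo :: "'o \<Rightarrow> ('g, 'g set \<times> nat) gset" and \<theta> where
    Fo_\<theta>: "\<And>X. X \<in> Obj B \<Longrightarrow> Fo X \<in> smooth_gsets G point_topology \<and>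
      equivariant G (E_gset X) (Fo X) (\<theta> X) \<and> bij_betw (\<theta> X) (E X) (fst (Fo X))"
    by metis
  define \<psi> where "\<psi> X = inv_into (E X) (\<theta> X)" for X
  have Fo: "Fo X \<in> smooth_gsets G point_topology" if "X \<in> Obj B" for X using Fo_\<theta>[OF that] by blast
  have \<theta>: "\<theta> X x \<in> fst (Fo X)" "\<psi> X (\<theta> X x) = x" if "X \<in> Obj B" "x \<in> E X" for X x
    using Fo_\<theta>[OF that(1)] that(2) by (auto simp: \<psi>_def bij_betw_def)
  have \<psi>: "\<psi> X y \<in> E X" "\<theta> X (\<psi> X y) = y" if "X \<in> Obj B" "y \<in> fst (Fo X)" for X y
    using Fo_\<theta>[OF that(1)] that(2)
    by (auto simp: \<psi>_def bij_betw_def inv_into_into f_inv_into_f)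
  have \<theta>_act: "\<theta> X (E_act g x) = snd (Fo X) g (\<theta> X x)" if "X \<in> Obj B" "x \<in> E X" "g \<in> carrier G" for X x g
    using Fo_\<theta>[OF that(1)] that(2,3) by (auto simp: equivariant_def E_gset_def)
  have \<psi>_act: "\<psi> X (snd (Fo X) g y) = E_act g (\<psi> X y)"
    if X: "X \<in> Obj B" and y: "y \<in> fst (Fo X)" and g: "g \<in> carrier G" for X y g
    using \<theta>_act[OF X \<psi>(1)[OF X y] g] \<psi>(2)[OF X y] \<theta>(2)[OF X E_act_closed[OF g \<psi>(1)[OF X y]]] by simp
  have Fo_act: "snd (Fo X) g y \<in> fst (Fo X)"
    if X: "X \<in> Obj B" and y: "y \<in> fst (Fo X)" and g: "g \<in> carrier G" for X y g
    using \<theta>_act[OF X \<psi>(1)[OF X y] g] \<psi>(2)[OF X y] \<theta>(1)[OF X E_act_closed[OF g \<psi>(1)[OF X y]]] by simp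
  define Fa where "Fa f = (Fo (Dom B f), (\<lambda>y\<in>fst (Fo (Dom B f)). \<theta> (Cod B f) (E_map f (\<psi> (Dom B f) y))),
      Fo (Cod B f))" for f
  have Fa: "Fa f = (Fo X, (\<lambda>y\<in>fst (Fo X). \<theta> Y (E_map f (\<psi> X y))), Fo Y)" if "f \<in> Hom B X Y" for f X Y
    using that by (simp add: Fa_def Hom_simps)
  have Fa_Hom: "Fa f \<in> Hom ?SG (Fo X) (Fo Y)" if f: "f \<in> Hom B X Y" for f X Y
  proof -
    have O: "X \<in> Obj B" "Y \<in> Obj B" using Hom_simps[OF f] by blast+
    have "equivariant G (Fo X) (Fo Y) (\<lambda>y\<in>fst (Fo X). \<theta> Y (E_map f (\<psi> X y)))"
      unfolding equivariant_def
    proof (intro conjI ballI)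
      show "(\<lambda>y\<in>fst (Fo X). \<theta> Y (E_map f (\<psi> X y))) \<in> fst (Fo X) \<rightarrow>\<^sub>E fst (Fo Y)"
        using \<theta>(1)[OF O(2) E_map_closed[OF f \<psi>(1)[OF O(1)]]] by auto
      fix g y assume gy: "g \<in> carrier G" "y \<in> fst (Fo X)"
      then show "(\<lambda>y\<in>fst (Fo X). \<theta> Y (E_map f (\<psi> X y))) (snd (Fo X) g y) =
          snd (Fo Y) g ((\<lambda>y\<in>fst (Fo X). \<theta> Y (E_map f (\<psi> X y))) y)"
        using Fo_act[OF O(1)] \<psi>_act[OF O(1)] E_map_act[OF f gy(1) \<psi>(1)[OF O(1)]]
          \<theta>_act[OF O(2) E_map_closed[OF f \<psi>(1)[OF O(1)]]] by simp
    qed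
    then show ?thesis using Fa[OF f] Fo O by (auto simp: Hom_def SG_def)
  qed
  show ?thesis
  proof (rule equivalent_categoriesI[OF category_axioms category_SG, where Fo = Fo and Fa = Fa])
    show "is_functor B ?SG Fo Fa"
      unfolding is_functor_def
    proof (intro conjI ballI impI)
      fix X assume X: "X \<in> Obj B"
      show "Fo X \<in> Obj ?SG" using Fo[OF X] by (simp add: SG_def)
      show "Fa (Ide B X) = Ide ?SG (Fo X)"
        using Fa[OF Ide_in_Hom[OF X]] E_map_Ide \<psi>[OF X] by (auto simp: SG_def restrict_def)
    next
      fix f assume f: "f \<in> Arr B"
      then have f': "f \<in> Hom B (Dom B f) (Cod B f)" by (simp add: Hom_def)
      then show "Fa f \<in> Hom ?SG (Fo (Dom B f)) (Fo (Cod B f))" by (rule Fa_Hom)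
      fix g assume g: "g \<in> Arr B" "Cod B f = Dom B g"
      then have g': "g \<in> Hom B (Cod B f) (Cod B g)" by (simp add: Hom_def)
      have O: "Dom B f \<in> Obj B" "Cod B f \<in> Obj B" using Hom_simps[OF f'] by blast+
      show "Fa (g \<cdot> f) = Fa g \<cdot>\<^bsub>?SG\<^esub> Fa f"
        unfolding Fa[OF f'] Fa[OF g'] Fa[OF Comp_in_Hom[OF f' g']]
        using E_map_Comp[OF f' g'] \<theta>[OF O(2) E_map_closed[OF f']] \<psi>[OF O(1)]
        by (auto simp: SG_def compose_def restrict_def)
    qed
    fix X Y f g assume f: "f \<in> Hom B X Y" and g: "g \<in> Hom B X Y" and fg: "Fa f = Fa g"
    have O: "X \<in> Obj B" "Y \<in> Obj B" using Hom_simps[OF f] by blast+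
    show "f = g"
    proof (rule E_faithful[OF f g])
      fix x assume x: "x \<in> E X"
      have "(\<lambda>y\<in>fst (Fo X). \<theta> Y (E_map f (\<psi> X y))) (\<theta> X x) =
          (\<lambda>y\<in>fst (Fo X). \<theta> Y (E_map g (\<psi> X y))) (\<theta> X x)"
        using fg Fa[OF f] Fa[OF g] by simp
      then have "\<theta> Y (E_map f x) = \<theta> Y (E_map g x)" using \<theta>[OF O(1) x] by simp
      then show "E_map f x = E_map g x"
        using \<theta>(2)[OF O(2) E_map_closed[OF f x]] \<theta>(2)[OF O(2) E_map_closed[OF g x]] by metis
    qed
  next
    fix X Y h assume O: "X \<in> Obj B" "Y \<in> Obj B" and h: "h \<in> Hom ?SG (Fo X) (Fo Y)"
    obtain k where k: "h = (Fo X, k, Fo Y)" "equivariant G (Fo X) (Fo Y) k"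
      using h by (auto simp: Hom_def SG_def)
    have kY: "k y \<in> fst (Fo Y)" if "y \<in> fst (Fo X)" for y using k that by (auto simp: equivariant_def)
    have "\<psi> Y (k (\<theta> X (E_act g x))) = E_act g (\<psi> Y (k (\<theta> X x)))"
      if g: "g \<in> carrier G" and x: "x \<in> E X" for g x
      using \<theta>_act[OF O(1) x g] k(2) g \<theta>(1)[OF O(1) x] \<psi>_act[OF O(2) kY[OF \<theta>(1)[OF O(1) x]] g]
      by (simp add: equivariant_def)
    then have "\<exists>f \<in> Hom B X Y. \<forall>x \<in> E X. E_map f x = \<psi> Y (k (\<theta> X x))"
      by (intro E_full[OF O \<psi>(1)[OF O(2) kY[OF \<theta>(1)[OF O(1)]]]])
    then obtain f where f: "f \<in> Hom B X Y" "\<And>x. x \<in> E X \<Longrightarrow> E_map f x = \<psi> Y (k (\<theta> X x))" by blast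
    have "(\<lambda>y\<in>fst (Fo X). \<theta> Y (E_map f (\<psi> X y))) = k"
    proof (rule extensionalityI[of _ "fst (Fo X)"])
      show "k \<in> extensional (fst (Fo X))" using k(2) by (simp add: equivariant_def PiE_def)
      fix y assume y: "y \<in> fst (Fo X)"
      then show "(\<lambda>y\<in>fst (Fo X). \<theta> Y (E_map f (\<psi> X y))) y = k y"
        using f(2)[OF \<psi>(1)[OF O(1) y]] \<psi>(2)[OF O(1) y] \<psi>(2)[OF O(2) kY[OF y]] by simp
    qed simp
    then show "\<exists>f \<in> Hom B X Y. Fa f = h" using f(1) Fa[OF f(1)] k(1) by auto
  next
    fix Y assume "Y \<in> Obj ?SG"
    then have Y: "Y \<in> smooth_gsets G point_topology" by (simp add: SG_def)
    obtain D \<rho> where D: "Y = (D, \<rho>)" by fastforce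
    obtain Q \<chi> where Q: "Q \<in> Obj B" "bij_betw \<chi> (E Q) D"
      "\<And>g x. \<lbrakk>g \<in> carrier G; x \<in> E Q\<rbrakk> \<Longrightarrow> \<chi> (E_act g x) = \<rho> g (\<chi> x)"
      using E_ess_surj Y D by metis
    have "equivariant G (Fo Q) Y (\<lambda>y\<in>fst (Fo Q). \<chi> (\<psi> Q y))"
      using Q Fo_act[OF Q(1)] \<psi>_act[OF Q(1)] \<psi>(1)[OF Q(1)] D
      by (auto simp: equivariant_def bij_betw_def)
    moreover have "bij_betw (\<psi> Q) (fst (Fo Q)) (E Q)"
      using Fo_\<theta>[OF Q(1)] unfolding \<psi>_def by (simp add: bij_betw_inv_into)
    then have "bij_betw (\<chi> \<circ> \<psi> Q) (fst (Fo Q)) D" using Q(2) by (rule bij_betw_trans)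
    then have "bij_betw (\<lambda>y\<in>fst (Fo Q). \<chi> (\<psi> Q y)) (fst (Fo Q)) D"
      by (rule bij_betw_cong[THEN iffD1, rotated]) simp
    ultimately have "isomorphic ?SG (Fo Q) Y"
      using SG_isomorphicI[OF Fo[OF Q(1)] Y] D by simp
    then show "\<exists>X \<in> Obj B. isomorphic ?SG (Fo X) Y" using Q(1) by blast
  qed
qed

end

section \<open>Finite models\<close>

text \<open>A letter is a symbol (h, f, g, k) with a flag, where \<open>False\<close> stands for the
  inverse; the last argument is the rest of the word, to which the letter is applied. As words are
  not reduced, \<open>word_inverse\<close> is an inverse only up to the later identification of
  names.\<close>

datatype 'b word = One | App bool "'b word" 'b 'b 'b "'b word"

primrec word_append :: "'b word \<Rightarrow> 'b word \<Rightarrow> 'b word" where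
  "word_append One v = v"
| "word_append (App b h f g k w) v = App b h f g k (word_append w v)"

primrec word_inverse :: "'b word \<Rightarrow> 'b word" where
  "word_inverse One = One"
| "word_inverse (App b h f g k w) = word_append (word_inverse w) (App (\<not> b) h f g k One)"

text \<open>Words inside letters count as well, so that h is lighter than every word with a letter
  built from h.\<close>

primrec word_weight :: "'b word \<Rightarrow> nat" where
  "word_weight One = 0"
| "word_weight (App b h f g k w) = Suc (word_weight h) + word_weight w"

type_synonym 'b symbol = "'b word \<times> 'b \<times> 'b \<times> 'b"
type_synonym ('o, 'b) name = "'b word \<times> 'o"

definition apply_symbol :: "bool \<Rightarrow> 'b symbol \<Rightarrow> ('o, 'b) name \<Rightarrow> ('o, 'b) name" where
  "apply_symbol b = (\<lambda>(h, f, g, k) (w, X). (App b h f g k w, X))"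

definition apply_word :: "'b word \<Rightarrow> ('o, 'b) name \<Rightarrow> ('o, 'b) name" where
  "apply_word w v = (word_append w (fst v), snd v)"

text \<open>The name \<open>v'\<close> is to denote the image under \<open>s\<close> of the point named \<open>v\<close>. Words are not
  reduced, so there are two ways to see this from the names.\<close>

definition linked :: "'b symbol \<Rightarrow> ('o, 'b) name \<Rightarrow> ('o, 'b) name \<Rightarrow> bool" where
  "linked s v v' \<longleftrightarrow> v' = apply_symbol True s v \<or> v = apply_symbol False s v'"

lemma word_append_One [simp]: "word_append w One = w"
  by (induction w) auto

lemma word_append_assoc: "word_append (word_append u v) w = word_append u (word_append v w)"
  by (induction u) auto

lemma apply_word_simps [simp]:
  "apply_word One v = v"
  "apply_word (App b h f g k w) v = apply_symbol b (h, f, g, k) (apply_word w v)"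
  "apply_word (word_append w w') v = apply_word w (apply_word w' v)"
  "snd (apply_word w v) = snd v"
  "apply_word w (One, X) = (w, X)"
  by (simp_all add: apply_word_def apply_symbol_def word_append_assoc)

lemma snd_apply_symbol [simp]: "snd (apply_symbol b s v) = snd v"
  by (simp add: apply_symbol_def split: prod.splits)

lemma linked_snd: "linked s v v' \<Longrightarrow> snd v' = snd v"
  by (auto simp: linked_def)

lemma apply_symbol_neq [simp]: "apply_symbol b s v \<noteq> v" "v \<noteq> apply_symbol b s v"
proof -
  have "word_weight (fst (apply_symbol b s v)) > word_weight (fst v)"
    by (simp add: apply_symbol_def split: prod.splits)
  then show "apply_symbol b s v \<noteq> v" "v \<noteq> apply_symbol b s v" by auto
qed

lemma apply_symbol_inject: "apply_symbol b s v = apply_symbol b' s' v' \<Longrightarrow> b = b' \<and> s = s' \<and> v = v'"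
  by (auto simp: apply_symbol_def split: prod.splits)

context atom_representatives
begin

section \<open>Names, symbols and the order of interpretation\<close>

definition span :: "'a \<Rightarrow> 'a \<Rightarrow> 'a \<Rightarrow> bool" where
  "span f g k \<longleftrightarrow> f \<in> Arr B \<and> g \<in> Arr B \<and> k \<in> Arr B \<and> Dom B g = Dom B f \<and> Dom B k = Dom B f \<and>
     Dom B f \<in> At \<and> Cod B f \<in> At \<and> Cod B g \<in> At \<and> Cod B k \<in> At"

primrec wf_word :: "'a word \<Rightarrow> bool" where
  "wf_word One \<longleftrightarrow> True"
| "wf_word (App b h f g k w) \<longleftrightarrow> wf_word h \<and> span f g k \<and> wf_word w"

definition Names :: "('o, 'a) name set" where
  "Names = {(w, X). wf_word w \<and> X \<in> At}"

definition Symbols :: "'a symbol set" where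
  "Symbols = {(h, f, g, k). wf_word h \<and> span f g k}"

fun target :: "'a symbol \<Rightarrow> ('o, 'a) name" where
  "target (h, f, g, k) = (App True h f g k One, Cod B k)"

text \<open>The names that a model has to interpret before \<open>v\<close>. The defining property of a symbol must be
  imposed before any other of its values is fixed, hence its target comes first.\<close>

fun preds :: "('o, 'a) name \<Rightarrow> ('o, 'a) name set" where
  "preds (One, X) = {}"
| "preds (App b h f g k w, X) = insert (w, X)
     (if (App b h f g k w, X) = target (h, f, g, k) then {(One, Cod B f), (h, Cod B g)}
      else {target (h, f, g, k)})"

text \<open>Doubling the weight leaves a spare bit, which places the target of a symbol before all
  other names whose outermost letter is this symbol or its inverse, yet after the names that the
  symbol refers to. The value 1 for the empty word is this bit, as such a name is never a
  target.\<close>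

fun rank :: "('o, 'a) name \<Rightarrow> nat" where
  "rank (One, X) = 1"
| "rank (App b h f g k w, X) = 2 * word_weight (App b h f g k w) +
     (if (App b h f g k w, X) = target (h, f, g, k) then 0 else 1)"

lemma rank_le: "rank (w, X) \<le> 2 * word_weight w + 1"
  by (cases w) auto

lemma rank_preds: "p \<in> preds v \<Longrightarrow> rank p < rank v"
proof (cases v rule: preds.cases)
  case (2 b h f g k w X)
  assume p: "p \<in> preds v"
  show ?thesis
  proof (cases "(App b h f g k w, X) = target (h, f, g, k)")
    case True
    then have "p \<in> {(One, X), (One, Cod B f), (h, Cod B g)}" "w = One" using p 2 by auto
    then show ?thesis using True 2 rank_le[of h "Cod B g"] by auto
  next
    case False
    then have "p = (w, X) \<or> p = target (h, f, g, k)" using p 2 by auto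
    then show ?thesis using False 2 rank_le[of w X] by auto
  qed
qed auto

lemma apply_symbol_Names: "\<lbrakk>s \<in> Symbols; v \<in> Names\<rbrakk> \<Longrightarrow> apply_symbol b s v \<in> Names"
  by (auto simp: apply_symbol_def Symbols_def Names_def)

lemma wf_word_append [simp]: "wf_word (word_append v w) \<longleftrightarrow> wf_word v \<and> wf_word w"
  by (induction v) auto

lemma wf_word_inverse [simp]: "wf_word (word_inverse w) \<longleftrightarrow> wf_word w"
  by (induction w) auto

lemma apply_word_Names: "\<lbrakk>wf_word w; v \<in> Names\<rbrakk> \<Longrightarrow> apply_word w v \<in> Names"
  by (auto simp: apply_word_def Names_def)

lemma target_Names: "s \<in> Symbols \<Longrightarrow> target s \<in> Names"
  by (auto simp: Symbols_def Names_def span_def)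

lemma preds_Names: "v \<in> Names \<Longrightarrow> preds v \<subseteq> Names"
  by (cases v rule: preds.cases) (auto simp: Names_def span_def)

lemma finite_preds: "finite (preds v)"
  by (cases v rule: preds.cases) auto

lemma preds_apply_symbol:
  "v \<in> preds (apply_symbol b s v)"
  "apply_symbol b s v \<noteq> target s \<Longrightarrow> target s \<in> preds (apply_symbol b s v)"
  by (auto simp: apply_symbol_def split: prod.splits)

lemma preds_target: "preds (target (h, f, g, k)) = {(One, Cod B k), (One, Cod B f), (h, Cod B g)}"
  by auto

lemma target_apply_symbol: "target (h, f, g, k) = apply_symbol True (h, f, g, k) (One, Cod B k)"
  by (simp add: apply_symbol_def)

definition closed_names :: "('o, 'a) name set \<Rightarrow> bool" where
  "closed_names T \<longleftrightarrow> finite T \<and> T \<subseteq> Names \<and> (\<forall>v \<in> T. preds v \<subseteq> T)"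

lemma closed_names_UN:
  "\<lbrakk>finite I; \<And>i. i \<in> I \<Longrightarrow> closed_names (T i)\<rbrakk> \<Longrightarrow> closed_names (\<Union>i\<in>I. T i)"
  unfolding closed_names_def by blast

text \<open>Predecessors are finite in number and of smaller \<open>rank\<close>, so adding them
  repeatedly comes to an end.\<close>

lemma closed_names_exists:
  assumes "finite S" "S \<subseteq> Names"
  shows "\<exists>T. S \<subseteq> T \<and> closed_names T"
proof -
  have "v \<in> Names \<Longrightarrow> \<exists>T. v \<in> T \<and> closed_names T" for v
  proof (induction v rule: measure_induct_rule[of rank])
    case (less v)
    have "\<exists>T. p \<in> T \<and> closed_names T" if "p \<in> preds v" for p
      using less.IH[OF rank_preds[OF that]] preds_Names[OF less.prems] that by blast
    then obtain T where T: "\<forall>p. p \<in> preds v \<longrightarrow> p \<in> T p \<and> closed_names (T p)" by metis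
    then have "closed_names (\<Union>p\<in>preds v. T p)" by (intro closed_names_UN finite_preds) auto
    then have "closed_names (insert v (\<Union>p\<in>preds v. T p))"
      using T less.prems unfolding closed_names_def by blast
    then show ?case by blast
  qed
  then have "\<forall>v. \<exists>T. v \<in> S \<longrightarrow> v \<in> T \<and> closed_names T" using assms by blast
  then obtain T where T: "\<forall>v. v \<in> S \<longrightarrow> v \<in> T v \<and> closed_names (T v)" by metis
  then have "closed_names (\<Union>v\<in>S. T v)" by (intro closed_names_UN assms) auto
  then show ?thesis using T by blast
qed

text \<open>The tuples of the \<open>v\<close> and of their images \<open>v'\<close> under \<open>s\<close> have the same type: both arise from
  one tuple of arrows \<open>\<kappa>\<close> out of an atom \<open>W\<close>.\<close>

definition compatible :: "'a symbol \<Rightarrow> ('o, 'a) name set \<Rightarrow> 'o \<Rightarrow> (('o, 'a) name \<Rightarrow> 'a) \<Rightarrow> bool" where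
  "compatible s T Z \<eta> \<longleftrightarrow> (\<exists>W \<alpha> \<beta> \<kappa>. is_atom B W \<and> \<alpha> \<in> Hom B Z W \<and> \<beta> \<in> Hom B Z W \<and>
     (\<forall>v \<in> T. \<forall>v' \<in> T. linked s v v' \<longrightarrow>
        \<kappa> v v' \<in> Hom B W (snd v) \<and> \<eta> v = \<kappa> v v' \<cdot> \<alpha> \<and> \<eta> v' = \<kappa> v v' \<cdot> \<beta>))"

text \<open>The hypothesis is about all refinements \<open>Z'\<close> of \<open>Z\<close>, so that it cannot become true later,
  when the value of the target is already fixed.\<close>

definition obeys :: "'a symbol \<Rightarrow> ('o, 'a) name set \<Rightarrow> 'o \<Rightarrow> (('o, 'a) name \<Rightarrow> 'a) \<Rightarrow> bool" where
  "obeys = (\<lambda>(h, f, g, k) T Z \<eta>. target (h, f, g, k) \<in> T \<longrightarrow>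
     (\<exists>Z' e z. is_atom B Z' \<and> e \<in> Hom B Z' Z \<and> z \<in> Hom B Z' (Dom B f) \<and>
        f \<cdot> z = \<eta> (One, Cod B f) \<cdot> e \<and> g \<cdot> z = \<eta> (h, Cod B g) \<cdot> e) \<longrightarrow>
     (\<exists>z \<in> Hom B Z (Dom B f). f \<cdot> z = \<eta> (One, Cod B f) \<and> g \<cdot> z = \<eta> (h, Cod B g) \<and>
        k \<cdot> z = \<eta> (target (h, f, g, k))))"

definition model :: "('o, 'a) name set \<Rightarrow> 'o \<Rightarrow> (('o, 'a) name \<Rightarrow> 'a) \<Rightarrow> bool" where
  "model T Z \<eta> \<longleftrightarrow> is_atom B Z \<and> (\<forall>v \<in> T. \<eta> v \<in> Hom B Z (snd v)) \<and>
     (\<forall>s \<in> Symbols. compatible s T Z \<eta> \<and> obeys s T Z \<eta>)"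

section \<open>Adding one name to a model\<close>

lemma compatible_extend:
  assumes c: "compatible s T Z \<eta>" and Z: "is_atom B Z" and e: "e \<in> Hom B Z' Z"
    and \<eta>': "\<And>v. v \<in> T \<Longrightarrow> \<eta>' v = \<eta> v \<cdot> e"
    and links: "\<And>v v'. \<lbrakk>v \<in> T'; v' \<in> T'; linked s v v'\<rbrakk> \<Longrightarrow> v \<in> T \<and> v' \<in> T"
  shows "compatible s T' Z' \<eta>'"
proof -
  obtain W \<alpha> \<beta> \<kappa> where W: "is_atom B W" "\<alpha> \<in> Hom B Z W" "\<beta> \<in> Hom B Z W"
    "\<forall>v \<in> T. \<forall>v' \<in> T. linked s v v' \<longrightarrow>
        \<kappa> v v' \<in> Hom B W (snd v) \<and> \<eta> v = \<kappa> v v' \<cdot> \<alpha> \<and> \<eta> v' = \<kappa> v v' \<cdot> \<beta>"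
    using c unfolding compatible_def by blast
  have "\<kappa> v v' \<in> Hom B W (snd v) \<and> \<eta>' v = \<kappa> v v' \<cdot> (\<alpha> \<cdot> e) \<and> \<eta>' v' = \<kappa> v v' \<cdot> (\<beta> \<cdot> e)"
    if v: "v \<in> T'" "v' \<in> T'" "linked s v v'" for v v'
  proof -
    have T: "v \<in> T" "v' \<in> T" using links[OF v] by auto
    then have k: "\<kappa> v v' \<in> Hom B W (snd v)" "\<eta> v = \<kappa> v v' \<cdot> \<alpha>" "\<eta> v' = \<kappa> v v' \<cdot> \<beta>"
      using W(4) v(3) by auto
    then show ?thesis using \<eta>'[OF T(1)] \<eta>'[OF T(2)] Comp_assoc[OF e W(2) k(1)] Comp_assoc[OF e W(3) k(1)]
      by simp
  qed
  then show ?thesis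
    unfolding compatible_def using W(1) Comp_in_Hom[OF e W(2)] Comp_in_Hom[OF e W(3)] by blast
qed

text \<open>A refinement of Z' is one of Z as well, so the hypothesis passes down to Z; the solution
  found there is restricted along \<open>e\<close>.\<close>

lemma obeys_extend:
  assumes o: "obeys (h, f, g, k) T Z \<eta>" and s: "(h, f, g, k) \<in> Symbols" and e: "e \<in> Hom B Z' Z"
    and \<eta>: "\<And>v. v \<in> T \<Longrightarrow> \<eta> v \<in> Hom B Z (snd v)" and \<eta>': "\<And>v. v \<in> T \<Longrightarrow> \<eta>' v = \<eta> v \<cdot> e"
    and T: "closed_names T" "target (h, f, g, k) \<in> T"
  shows "obeys (h, f, g, k) T' Z' \<eta>'"
  unfolding obeys_def case_prod_conv
proof (intro impI, elim exE conjE)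
  fix Z'' d z assume d: "is_atom B Z''" "d \<in> Hom B Z'' Z'" and z: "z \<in> Hom B Z'' (Dom B f)"
    "f \<cdot> z = \<eta>' (One, Cod B f) \<cdot> d" "g \<cdot> z = \<eta>' (h, Cod B g) \<cdot> d"
  have mem: "(One, Cod B f) \<in> T" "(h, Cod B g) \<in> T"
    using T preds_target[of h f g k] unfolding closed_names_def by blast+
  have fgk: "f \<in> Hom B (Dom B f) (Cod B f)" "g \<in> Hom B (Dom B f) (Cod B g)"
      "k \<in> Hom B (Dom B f) (Cod B k)"
    using s by (auto simp: Symbols_def span_def Hom_def)
  have \<eta>s: "\<eta> (One, Cod B f) \<in> Hom B Z (Cod B f)" "\<eta> (h, Cod B g) \<in> Hom B Z (Cod B g)"
    using \<eta> mem by fastforce+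
  have "f \<cdot> z = \<eta> (One, Cod B f) \<cdot> (e \<cdot> d)" "g \<cdot> z = \<eta> (h, Cod B g) \<cdot> (e \<cdot> d)"
    using z \<eta>'[OF mem(1)] \<eta>'[OF mem(2)] Comp_assoc[OF d(2) e \<eta>s(1)] Comp_assoc[OF d(2) e \<eta>s(2)]
        by simp_all
  then obtain y where y: "y \<in> Hom B Z (Dom B f)" "f \<cdot> y = \<eta> (One, Cod B f)" "g \<cdot> y = \<eta> (h, Cod B g)"
    "k \<cdot> y = \<eta> (target (h, f, g, k))"
    using o T(2) d(1) z(1) Comp_in_Hom[OF d(2) e] unfolding obeys_def case_prod_conv by blast
  show "\<exists>z\<in>Hom B Z' (Dom B f). f \<cdot> z = \<eta>' (One, Cod B f) \<and> g \<cdot> z = \<eta>' (h, Cod B g) \<and>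
      k \<cdot> z = \<eta>' (target (h, f, g, k))"
  proof (intro bexI conjI)
    show "y \<cdot> e \<in> Hom B Z' (Dom B f)" using Comp_in_Hom[OF e y(1)] .
    show "f \<cdot> (y \<cdot> e) = \<eta>' (One, Cod B f)" using Comp_assoc[OF e y(1) fgk(1)] y(2) \<eta>'[OF mem(1)] by simp
    show "g \<cdot> (y \<cdot> e) = \<eta>' (h, Cod B g)" using Comp_assoc[OF e y(1) fgk(2)] y(3) \<eta>'[OF mem(2)] by simp
    show "k \<cdot> (y \<cdot> e) = \<eta>' (target (h, f, g, k))"
      using Comp_assoc[OF e y(1) fgk(3)] y(4) \<eta>'[OF T(2)] by simp
  qed
qed

text \<open>Only the symbol in the outermost letter of \<open>t\<close> has to be reconsidered, and
  \<open>obeys\<close> only if \<open>t\<close> is its target. In a link the shorter name is a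
  predecessor of the longer one; as T is closed and omits \<open>t\<close>, a link between
  \<open>t\<close> and a name of T has \<open>t\<close> as the longer one. Everything else is
  restricted along \<open>e\<close>.\<close>

lemma model_insert:
  assumes T: "closed_names T" and m: "model T Z \<eta>" and t: "t \<notin> T" "preds t \<subseteq> T"
    and Z': "is_atom B Z'" and e: "e \<in> Hom B Z' Z" and y: "y \<in> Hom B Z' (snd t)"
    and \<eta>': "\<eta>' = (\<lambda>v. if v = t then y else \<eta> v \<cdot> e)"
    and c: "\<And>b s v. \<lbrakk>s \<in> Symbols; t = apply_symbol b s v\<rbrakk> \<Longrightarrow> compatible s (insert t T) Z' \<eta>'"
    and o: "\<And>s. \<lbrakk>s \<in> Symbols; target s = t\<rbrakk> \<Longrightarrow> obeys s (insert t T) Z' \<eta>'"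
  shows "model (insert t T) Z' \<eta>'"
proof -
  have Z: "is_atom B Z" and \<eta>: "\<And>v. v \<in> T \<Longrightarrow> \<eta> v \<in> Hom B Z (snd v)"
    and co: "\<And>s. s \<in> Symbols \<Longrightarrow> compatible s T Z \<eta>" "\<And>s. s \<in> Symbols \<Longrightarrow> obeys s T Z \<eta>"
    using m by (auto simp: model_def)
  have \<eta>'T: "\<eta>' v = \<eta> v \<cdot> e" if "v \<in> T" for v using that t(1) by (auto simp: \<eta>')
  have "\<eta>' v \<in> Hom B Z' (snd v)" if "v \<in> insert t T" for v
    using that y Comp_in_Hom[OF e \<eta>[of v]] by (cases "v = t") (simp_all add: \<eta>')
  moreover have "compatible s (insert t T) Z' \<eta>'" if s: "s \<in> Symbols" for s
  proof (cases "\<exists>b v. t = apply_symbol b s v")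
    case False
    have "v \<in> T \<and> v' \<in> T" if v: "v \<in> insert t T" "v' \<in> insert t T" "linked s v v'" for v v'
    proof -
      have "v' \<in> T \<and> v = t \<Longrightarrow> t \<in> T" if "v' = apply_symbol True s v"
        using T that preds_apply_symbol(1)[of v True s] unfolding closed_names_def by blast
      moreover have "v \<in> T \<and> v' = t \<Longrightarrow> t \<in> T" if "v = apply_symbol False s v'"
        using T that preds_apply_symbol(1)[of v' False s] unfolding closed_names_def by blast
      moreover have "v \<noteq> v'" using v(3) by (auto simp: linked_def)
      ultimately show ?thesis using v t(1) False unfolding linked_def by (metis insertE)
    qed
    then show ?thesis using compatible_extend[OF co(1)[OF s] Z e \<eta>'T] by blast
  qed (use c s in blast)
  moreover have "obeys s (insert t T) Z' \<eta>'" if s: "s \<in> Symbols" for s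
  proof (cases "target s = t")
    case False
    obtain h f g k where hs: "s = (h, f, g, k)" by (cases s)
    show ?thesis
    proof (cases "target s \<in> T")
      case True
      then show ?thesis using obeys_extend[OF _ _ e \<eta> \<eta>'T T, of h f g k] co(2)[OF s] s hs by blast
    next
      case not_in: False
      then show ?thesis using False hs by (auto simp: obeys_def)
    qed
  qed (use o s in blast)
  ultimately show ?thesis using Z' by (auto simp: model_def)
qed

lemma model_insert_base:
  assumes T: "closed_names T" and m: "model T Z \<eta>" and t: "(One, X) \<notin> T" and X: "X \<in> At"
  shows "\<exists>Z' \<eta>'. model (insert (One, X) T) Z' \<eta>'"
proof -
  have "is_atom B Z" using m by (simp add: model_def)
  then obtain Z' e y where Z': "is_atom B Z'" "e \<in> Hom B Z' Z" "y \<in> Hom B Z' X"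
    using atom_joint_cover[OF _ At_atom[OF X]] by metis
  have "(One, X) \<noteq> apply_symbol b s v" "target s \<noteq> (One, X)" for b s and v :: "('o, 'a) name"
    by (auto simp: apply_symbol_def split: prod.splits, cases s, simp)
  then show ?thesis
    using model_insert[OF T m t _ Z'(1,2) _ refl, of y] Z'(3)
        by (metis empty_subsetI preds.simps(1) snd_conv)
qed

text \<open>One member of a linked pair has \<open>s\<close> or its inverse as outermost letter, and
  such a name is the target of \<open>s\<close> or has the target as predecessor.\<close>

lemma no_link_before_target:
  assumes T: "closed_names T" and t: "target s \<notin> T" and v: "v \<in> T" "v' \<in> T"
  shows "\<not> linked s v v'"
proof
  assume "linked s v v'"
  then obtain b w where "apply_symbol b s w \<in> T" using v unfolding linked_def by blast
  then show False
    using T t preds_apply_symbol(2)[of b s w] unfolding closed_names_def by (metis subsetD)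
qed

text \<open>As \<open>s\<close> has no links yet, its target may take any value: the one that
  \<open>obeys\<close> asks for if some refinement satisfies the hypothesis, an arbitrary one
  otherwise.\<close>

lemma model_insert_target:
  assumes T: "closed_names T" and m: "model T Z \<eta>" and s: "s \<in> Symbols"
    and t: "target s \<notin> T" "preds (target s) \<subseteq> T"
  shows "\<exists>Z' \<eta>'. model (insert (target s) T) Z' \<eta>'"
proof -
  obtain h f g k where hs: "s = (h, f, g, k)" by (cases s)
  have fgk: "f \<in> Hom B (Dom B f) (Cod B f)" "g \<in> Hom B (Dom B f) (Cod B g)"
      "k \<in> Hom B (Dom B f) (Cod B k)"
    "Cod B k \<in> At"
    using s hs by (auto simp: Symbols_def span_def Hom_def)
  have Z: "is_atom B Z" and \<eta>: "\<And>v. v \<in> T \<Longrightarrow> \<eta> v \<in> Hom B Z (snd v)" using m by (auto simp: model_def)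
  define q :: "('o, 'a) name" where "q = (One, Cod B k)"
  have mem: "q \<in> T" "(One, Cod B f) \<in> T" "(h, Cod B g) \<in> T" using t(2) hs by (auto simp: q_def)
  have \<eta>s: "\<eta> (One, Cod B f) \<in> Hom B Z (Cod B f)" "\<eta> (h, Cod B g) \<in> Hom B Z (Cod B g)"
    "\<eta> q \<in> Hom B Z (Cod B k)"
    using \<eta>[OF mem(1)] \<eta>[OF mem(2)] \<eta>[OF mem(3)] by (auto simp: q_def)
  have t_eq: "target s = apply_symbol True s q" by (simp add: hs apply_symbol_def q_def)
  let ?R = "\<lambda>Z' e z. is_atom B Z' \<and> e \<in> Hom B Z' Z \<and> z \<in> Hom B Z' (Dom B f) \<and>
        f \<cdot> z = \<eta> (One, Cod B f) \<cdot> e \<and> g \<cdot> z = \<eta> (h, Cod B g) \<cdot> e"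
  obtain Z' e y where Z': "is_atom B Z'" "e \<in> Hom B Z' Z" "y \<in> Hom B Z' (Cod B k)"
    and R: "(\<exists>Z' e z. ?R Z' e z) \<Longrightarrow> \<exists>z \<in> Hom B Z' (Dom B f). f \<cdot> z = \<eta> (One, Cod B f) \<cdot> e \<and>
        g \<cdot> z = \<eta> (h, Cod B g) \<cdot> e \<and> k \<cdot> z = y"
  proof (cases "\<exists>Z' e z. ?R Z' e z")
    case True
    then obtain Z' e z where r: "?R Z' e z" by blast
    then have "k \<cdot> z \<in> Hom B Z' (Cod B k)" using Comp_in_Hom fgk(3) by blast
    then show ?thesis using that[of Z' e "k \<cdot> z"] r by blast
  next
    case False
    obtain Z' e y where "is_atom B Z'" "e \<in> Hom B Z' Z" "y \<in> Hom B Z' (Cod B k)"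
      using atom_joint_cover[OF Z At_atom[OF fgk(4)]] by metis
    then show ?thesis using that False by blast
  qed
  define \<eta>' where "\<eta>' = (\<lambda>v. if v = target s then y else \<eta> v \<cdot> e)"
  have \<eta>'T: "\<eta>' v = \<eta> v \<cdot> e" if "v \<in> T" for v using that t(1) by (auto simp: \<eta>'_def)
  have "model (insert (target s) T) Z' \<eta>'"
  proof (rule model_insert[OF T m t Z'(1,2) _ \<eta>'_def])
    show "y \<in> Hom B Z' (snd (target s))" using Z'(3) hs by simp
    fix s' assume s': "s' \<in> Symbols"
    {
      fix b v assume "target s = apply_symbol b s' v"
      then have bsv: "b = True" "s' = s" "v = q" using t_eq apply_symbol_inject by metis+
      have eqs: "v = q \<and> v' = target s"
        if v: "v \<in> insert (target s) T" "v' \<in> insert (target s) T" "linked s v v'" for v v'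
      proof -
        have "v = target s \<or> v' = target s" using no_link_before_target[OF T t(1)] v by blast
        moreover have False if "v = target s"
        proof (cases "v' = apply_symbol True s v")
          case True
          then have "v' \<in> T" using v(2) that by auto
          then show False
            using T t(1) True that preds_apply_symbol(1)[of v True s] unfolding closed_names_def by blast
        next
          case False
          then show False
            using v(3) that t_eq unfolding linked_def using apply_symbol_inject by metis
        qed
        ultimately have "v' = target s" "v \<noteq> target s" by auto
        then have vT: "v \<in> T" using v by blast
        have "v \<noteq> apply_symbol False s v'"
          using T t(1) vT \<open>v' = target s\<close> preds_apply_symbol(1)[of v' False s]
              unfolding closed_names_def by blast
        then have "apply_symbol True s v = apply_symbol True s q"
          using v(3) \<open>v' = target s\<close> t_eq unfolding linked_def by simp
        then show ?thesis using apply_symbol_inject \<open>v' = target s\<close> by metis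
      qed
      have q': "\<eta>' q = \<eta> q \<cdot> e" using \<eta>'T mem by blast
      have "compatible s (insert (target s) T) Z' \<eta>'"
        unfolding compatible_def
      proof (intro exI conjI ballI impI)
        \<comment> \<open>The only link leads from \<open>q\<close> to the target. Any two points of
          the atom \<open>Cod B k\<close> have the same type, so this atom serves as W, with the
          identity as \<open>\<kappa>\<close>.\<close>
        show "is_atom B (Cod B k)" using At_atom fgk by blast
        show "\<eta> q \<cdot> e \<in> Hom B Z' (Cod B k)" using Comp_in_Hom[OF Z'(2) \<eta>s(3)] .
        show "y \<in> Hom B Z' (Cod B k)" by (rule Z'(3))
        fix v v' assume "v \<in> insert (target s) T" "v' \<in> insert (target s) T" "linked s v v'"
        then have v: "v = q" "v' = target s" using eqs by blast+
        show "Ide B (Cod B k) \<in> Hom B (Cod B k) (snd v)"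
          using Ide_in_Hom[OF At_Obj[OF fgk(4)]] v by (simp add: q_def)
        show "\<eta>' v = Ide B (Cod B k) \<cdot> (\<eta> q \<cdot> e)"
          using v q' Ide_Comp[OF Comp_in_Hom[OF Z'(2) \<eta>s(3)]] by simp
        show "\<eta>' v' = Ide B (Cod B k) \<cdot> y" using v Ide_Comp[OF Z'(3)] by (simp add: \<eta>'_def)
      qed
      then show "compatible s' (insert (target s) T) Z' \<eta>'" using bsv by simp
    }
    assume "target s' = target s"
    then have s'_eq: "s' = s" using hs by (cases s') auto
    show "obeys s' (insert (target s) T) Z' \<eta>'"
      unfolding s'_eq hs obeys_def case_prod_conv
    proof (intro impI, elim exE conjE)
      fix Z'' d z assume d: "is_atom B Z''" "d \<in> Hom B Z'' Z'" and z: "z \<in> Hom B Z'' (Dom B f)"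
        "f \<cdot> z = \<eta>' (One, Cod B f) \<cdot> d" "g \<cdot> z = \<eta>' (h, Cod B g) \<cdot> d"
      have "?R Z'' (e \<cdot> d) z"
        using d z Comp_in_Hom[OF d(2) Z'(2)] \<eta>'T[OF mem(2)] \<eta>'T[OF mem(3)]
          Comp_assoc[OF d(2) Z'(2) \<eta>s(1)] Comp_assoc[OF d(2) Z'(2) \<eta>s(2)] by simp
      then obtain z' where z': "z' \<in> Hom B Z' (Dom B f)" "f \<cdot> z' = \<eta> (One, Cod B f) \<cdot> e"
        "g \<cdot> z' = \<eta> (h, Cod B g) \<cdot> e" "k \<cdot> z' = y"
        using R by blast
      have "\<eta>' (target (h, f, g, k)) = y" using hs by (simp add: \<eta>'_def)
      then show "\<exists>z\<in>Hom B Z' (Dom B f). f \<cdot> z = \<eta>' (One, Cod B f) \<and> g \<cdot> z = \<eta>' (h, Cod B g) \<and>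
          k \<cdot> z = \<eta>' (target (h, f, g, k))"
        using z' \<eta>'T[OF mem(2)] \<eta>'T[OF mem(3)] by metis
    qed
  qed
  then show ?thesis by blast
qed

text \<open>The data \<open>\<alpha>, \<beta> : Z \<rightarrow> W\<close> exhibit a partial automorphism. Over the fibre product of \<open>\<alpha>\<close> and
  \<open>\<beta>\<close>, every value of \<open>\<eta>\<close> acquires an image under it.\<close>

lemma model_insert_symbol:
  assumes T: "closed_names T" and m: "model T Z \<eta>" and s: "s \<in> Symbols"
    and t: "apply_symbol b s q \<notin> T" "preds (apply_symbol b s q) \<subseteq> T" "apply_symbol b s q \<noteq> target s"
  shows "\<exists>Z' \<eta>'. model (insert (apply_symbol b s q) T) Z' \<eta>'"
proof -
  let ?t = "apply_symbol b s q"
  have qT: "q \<in> T" using t(2) preds_apply_symbol(1) by blast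
  have Z: "is_atom B Z" and \<eta>: "\<And>v. v \<in> T \<Longrightarrow> \<eta> v \<in> Hom B Z (snd v)" using m by (auto simp: model_def)
  have comp: "compatible s T Z \<eta>" using m s by (simp add: model_def)
  obtain W \<alpha> \<beta> \<kappa> where W: "is_atom B W" "\<alpha> \<in> Hom B Z W" "\<beta> \<in> Hom B Z W"
    and \<kappa>: "\<And>v v'. \<lbrakk>v \<in> T; v' \<in> T; linked s v v'\<rbrakk> \<Longrightarrow>
        \<kappa> v v' \<in> Hom B W (snd v) \<and> \<eta> v = \<kappa> v v' \<cdot> \<alpha> \<and> \<eta> v' = \<kappa> v v' \<cdot> \<beta>"
    using comp unfolding compatible_def by blast
  obtain Z' d d' where Z': "is_atom B Z'" "d \<in> Hom B Z' Z" "d' \<in> Hom B Z' Z" "\<alpha> \<cdot> d' = \<beta> \<cdot> d"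
    using atom_amalgamation[OF Z Z W] by metis
  \<comment> \<open>For an inverse letter the projections exchange their roles: \<open>e\<close>
    restricts the old values, \<open>e'\<close> gives the value of the new name.\<close>
  define e where "e = (if b then d else d')"
  define e' where "e' = (if b then d' else d)"
  have e: "e \<in> Hom B Z' Z" "e' \<in> Hom B Z' Z" using Z' by (simp_all add: e_def e'_def)
  define \<eta>' where "\<eta>' = (\<lambda>v. if v = ?t then \<eta> q \<cdot> e' else \<eta> v \<cdot> e)"
  have \<eta>'T: "\<eta>' v = \<eta> v \<cdot> e" if "v \<in> T" for v using that t(1) by (auto simp: \<eta>'_def)
  have \<eta>'t: "\<eta>' ?t = \<eta> q \<cdot> e'" by (simp add: \<eta>'_def)
  have links: "(v \<in> T \<and> v' \<in> T) \<or> (b \<and> v = q \<and> v' = ?t) \<or> (\<not> b \<and> v = ?t \<and> v' = q)"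
    if v: "v \<in> insert ?t T" "v' \<in> insert ?t T" "linked s v v'" for v v'
  proof (cases "v' = apply_symbol True s v")
    case True
    then have "v \<noteq> v'" by auto
    moreover have "v' \<in> T \<Longrightarrow> v \<in> T"
      using T True preds_apply_symbol(1)[of v True s] unfolding closed_names_def by blast
    moreover have "v' = ?t \<Longrightarrow> b \<and> v = q" using True apply_symbol_inject by metis
    ultimately show ?thesis using v(1,2) by blast
  next
    case False
    then have v': "v = apply_symbol False s v'" using v(3) by (simp add: linked_def)
    then have "v \<noteq> v'" by auto
    moreover have "v \<in> T \<Longrightarrow> v' \<in> T"
      using T v' preds_apply_symbol(1)[of v' False s] unfolding closed_names_def by blast
    moreover have "v = ?t \<Longrightarrow> \<not> b \<and> v' = q" using v' apply_symbol_inject by metis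
    ultimately show ?thesis using v(1,2) by blast
  qed
  have comp': "compatible s (insert ?t T) Z' \<eta>'"
    unfolding compatible_def
  proof (intro exI conjI ballI impI)
    \<comment> \<open>Now Z itself is the common atom: \<open>d\<close> and \<open>d'\<close> are
      two copies of the whole tuple, the second being the image of the first under \<open>s\<close>,
      and the arrows out of W are old values of \<open>\<eta>\<close>.\<close>
    show "is_atom B Z" "d \<in> Hom B Z' Z" "d' \<in> Hom B Z' Z" by (fact Z Z'(2,3))+
    fix v v' assume v: "v \<in> insert ?t T" "v' \<in> insert ?t T" "linked s v v'"
    let ?\<kappa> = "if b then \<eta> v else \<eta> v'"
    consider "v \<in> T" "v' \<in> T" | "b" "v = q" "v' = ?t" | "\<not> b" "v = ?t" "v' = q"
      using links[OF v] by blast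
    then have "?\<kappa> \<in> Hom B Z (snd v) \<and> \<eta>' v = ?\<kappa> \<cdot> d \<and> \<eta>' v' = ?\<kappa> \<cdot> d'"
    proof cases
      case 1
      note k = \<kappa>[OF 1 v(3)]
      have "\<eta> v \<cdot> d' = \<eta> v' \<cdot> d"
        using k Comp_assoc[OF Z'(3) W(2)] Comp_assoc[OF Z'(2) W(3)] Z'(4) by metis
      moreover have "snd v' = snd v" using linked_snd[OF v(3)] .
      ultimately show ?thesis
        using \<eta>[OF 1(1)] \<eta>[OF 1(2)] \<eta>'T[OF 1(1)] \<eta>'T[OF 1(2)] by (simp add: e_def)
    next
      case 2
      then show ?thesis using \<eta>[OF qT] \<eta>'T[OF qT] \<eta>'t by (simp add: e_def e'_def)
    next
      case 3
      then show ?thesis using \<eta>[OF qT] \<eta>'T[OF qT] \<eta>'t by (simp add: e_def e'_def)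
    qed
    then show "?\<kappa> \<in> Hom B Z (snd v)" "\<eta>' v = ?\<kappa> \<cdot> d" "\<eta>' v' = ?\<kappa> \<cdot> d'" by blast+
  qed
  have "model (insert ?t T) Z' \<eta>'"
  proof (rule model_insert[OF T m t(1,2) Z'(1) e(1) _ \<eta>'_def])
    show "\<eta> q \<cdot> e' \<in> Hom B Z' (snd ?t)" using Comp_in_Hom[OF e(2) \<eta>[OF qT]] by simp
    fix s' assume s': "s' \<in> Symbols"
    show "compatible s' (insert ?t T) Z' \<eta>'" if "?t = apply_symbol b' s' v" for b' v
      using comp' apply_symbol_inject[OF that] by simp
    assume "target s' = ?t"
    then have "s' = s" using target_apply_symbol apply_symbol_inject by (metis prod_cases4)
    then show "obeys s' (insert ?t T) Z' \<eta>'" using t(3) \<open>target s' = ?t\<close> by simp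
  qed
  then show ?thesis by blast
qed

text \<open>A name of maximal rank is a predecessor of no other, so the set stays closed without it,
  and one of the three insertion lemmas puts it back.\<close>

lemma model_exists: "closed_names T \<Longrightarrow> \<exists>Z \<eta>. model T Z \<eta>"
proof (induction "card T" arbitrary: T)
  case 0
  then have T: "T = {}" by (auto simp: closed_names_def)
  obtain Z where Z: "is_atom B Z" using final_exists final_atom by blast
  have O: "Z \<in> Obj B" using Z by (simp add: is_atom_def)
  have "compatible s {} Z \<eta>" "obeys s {} Z \<eta>" for s \<eta>
    using Z Ide_in_Hom[OF O] by (auto simp: compatible_def obeys_def split: prod.splits)
  then have "model T Z (\<lambda>_. undefined)" using Z T by (simp add: model_def)
  then show ?case by blast
next
  case (Suc n)
  have fin: "finite T" "T \<noteq> {}" using Suc by (auto simp: closed_names_def)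
  have "Max (rank ` T) \<in> rank ` T" using fin by (intro Max_in) auto
  then obtain t where tT: "t \<in> T" "Max (rank ` T) = rank t" by blast
  then have t: "t \<in> T" "\<And>v. v \<in> T \<Longrightarrow> rank v \<le> rank t"
    using fin(1) by (auto simp flip: tT(2))
  define T' where "T' = T - {t}"
  have TN: "T \<subseteq> Names" and pT: "\<And>v. v \<in> T \<Longrightarrow> preds v \<subseteq> T"
    using Suc.prems by (auto simp: closed_names_def)
  have no_t: "t \<notin> preds v" if "v \<in> T" for v using rank_preds[of t v] t(2)[OF that] by auto
  have T': "closed_names T'"
    unfolding closed_names_def T'_def using fin TN pT no_t by blast
  have ins: "T = insert t T'" "t \<notin> T'" "preds t \<subseteq> T'"
    using t pT[OF t(1)] no_t[OF t(1)] by (auto simp: T'_def)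
  have "card T' = n" using Suc.hyps(2) fin t(1) by (simp add: T'_def)
  then obtain Z \<eta> where m: "model T' Z \<eta>" using Suc.hyps(1) T' by blast
  have tN: "t \<in> Names" using t TN by blast
  have "\<exists>Z' \<eta>'. model (insert t T') Z' \<eta>'"
  proof (cases t rule: preds.cases)
    case (1 X)
    then show ?thesis using model_insert_base[OF T' m] ins tN by (simp add: Names_def)
  next
    case (2 b h f g k w X)
    have s: "(h, f, g, k) \<in> Symbols" using tN 2 by (simp add: Names_def Symbols_def)
    show ?thesis
    proof (cases "t = target (h, f, g, k)")
      case True
      then show ?thesis using model_insert_target[OF T' m s] ins by simp
    next
      case False
      have "t = apply_symbol b (h, f, g, k) (w, X)" using 2 by (simp add: apply_symbol_def)
      then show ?thesis using model_insert_symbol[OF T' m s, of b "(w, X)"] ins False by simp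
    qed
  qed
  then show ?case using ins by simp
qed

end

section \<open>The limit of the finite models\<close>

text \<open>Zorn's lemma for families of sets that generate a proper filter. The union of a chain is
  again such a family, because a contradiction already arises from a finite subfamily, which lies in
  one member of the chain.\<close>

lemma ultrafilter_below:
  fixes F :: "'i filter"
  assumes F: "F \<noteq> bot"
  obtains U where "U \<le> F" "U \<noteq> bot" "\<And>P. eventually P U \<or> eventually (\<lambda>x. \<not> P x) U"
proof -
  define \<Phi> :: "'i set set \<Rightarrow> 'i filter" where "\<Phi> \<S> = (INF S\<in>\<S>. principal S)" for \<S>
  define \<F> where "\<F> = {S. eventually (\<lambda>x. x \<in> S) F}"
  let ?C = "{\<S>. \<F> \<subseteq> \<S> \<and> \<Phi> \<S> \<noteq> bot}"
  have anti: "\<Phi> \<S> \<le> \<Phi> \<T>" if "\<T> \<subseteq> \<S>" for \<S> \<T>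
    unfolding \<Phi>_def using that by (rule INF_superset_mono) simp
  have "F \<le> \<Phi> \<F>" unfolding \<Phi>_def by (rule INF_greatest) (simp add: \<F>_def le_principal)
  then have "\<Phi> \<F> \<noteq> bot" using F by (metis bot_unique)
  then have "\<F> \<in> ?C" by simp
  then have ne: "?C \<noteq> {}" by blast
  have chain: "\<Union>\<C> \<in> ?C" if \<C>: "\<C> \<noteq> {}" "subset.chain ?C \<C>" for \<C>
  proof -
    have sub: "\<C> \<subseteq> ?C" using \<C>(2) by (simp add: subset_chain_def)
    have "\<Phi> (\<Union>\<C>) \<noteq> bot"
    proof
      assume "\<Phi> (\<Union>\<C>) = bot"
      then have "eventually (\<lambda>_. False) (INF S\<in>\<Union>\<C>. principal S)" by (simp add: \<Phi>_def)
      then have "\<exists>X\<subseteq>\<Union>\<C>. finite X \<and> eventually (\<lambda>_. False) (\<Phi> X)"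
        unfolding \<Phi>_def by (rule eventually_INF[THEN iffD1])
      then obtain X where X: "X \<subseteq> \<Union>\<C>" "finite X" "eventually (\<lambda>_. False) (\<Phi> X)"
        by blast
      obtain \<S> where \<S>: "\<S> \<in> \<C>" "X \<subseteq> \<S>"
        using finite_subset_Union_chain[OF X(2,1) \<C>] by blast
      have "\<Phi> X = bot" using X(3) by (simp add: trivial_limit_def)
      then have "\<Phi> \<S> = bot" using anti[OF \<S>(2)] bot_unique by metis
      then show False using \<S>(1) sub by blast
    qed
    then show ?thesis using \<C>(1) sub by blast
  qed
  have "\<exists>M\<in>?C. \<forall>\<S>\<in>?C. M \<subseteq> \<S> \<longrightarrow> \<S> = M"
    by (rule subset_Zorn_nonempty[OF ne chain])
  then obtain M where M: "M \<in> ?C" and maximal: "\<forall>\<S>\<in>?C. M \<subseteq> \<S> \<longrightarrow> \<S> = M" ..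
  have ev: "eventually P (\<Phi> M)" if "{x. P x} \<in> M" for P
  proof -
    have "\<Phi> M \<le> principal {x. P x}" unfolding \<Phi>_def by (rule INF_lower[OF that])
    then show ?thesis by (simp add: le_principal)
  qed
  show thesis
  proof (rule that[of "\<Phi> M"])
    show "\<Phi> M \<le> F"
    proof (rule filter_leI)
      fix P assume "eventually P F"
      then have "{x. P x} \<in> M" using M by (auto simp: \<F>_def)
      then show "eventually P (\<Phi> M)" by (rule ev)
    qed
    show "\<Phi> M \<noteq> bot" using M by simp
    fix P
    show "eventually P (\<Phi> M) \<or> eventually (\<lambda>x. \<not> P x) (\<Phi> M)"
    proof (rule disjCI)
      assume *: "\<not> eventually (\<lambda>x. \<not> P x) (\<Phi> M)"
      \<comment> \<open>Since the complement of P is not in the filter, adding P keeps it proper,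
        and maximality puts P in already.\<close>
      have "\<Phi> (insert {x. P x} M) = inf (principal {x. P x}) (\<Phi> M)" by (simp add: \<Phi>_def)
      also have "\<dots> \<noteq> bot"
        using * by (simp add: trivial_limit_def inf_commute[of "principal _"] eventually_inf_principal)
      finally have "insert {x. P x} M \<in> ?C" using M by auto
      from bspec[OF maximal this] have "insert {x. P x} M = M" by blast
      then show "eventually P (\<Phi> M)" using ev by blast
    qed
  qed
qed

text \<open>\<open>\<Gamma> v f w\<close> is to mean that \<open>f\<close> carries the point named
  \<open>v\<close> to the point named \<open>w\<close>. It is a relation because a point has many
  names; two names of one point are related by the identity. \<open>graph_total\<close> and
  \<open>graph_joint\<close> are only asked at base points, since words transport them to all
  others.\<close>

locale name_graph = atom_representatives u B At
  for u :: "'u itself" and B :: "('o, 'a, 'm) cat_scheme" (structure) and At :: "'o set" +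
  fixes \<Gamma> :: "('o, 'a) name \<Rightarrow> 'a \<Rightarrow> ('o, 'a) name \<Rightarrow> bool"
  assumes graph_refl: "v \<in> Names \<Longrightarrow> \<Gamma> v (Ide B (snd v)) v"
    and graph_sym: "\<lbrakk>v \<in> Names; w \<in> Names; snd v = snd w; \<Gamma> v (Ide B (snd v)) w\<rbrakk> \<Longrightarrow>
        \<Gamma> w (Ide B (snd w)) v"
    and graph_Comp: "\<lbrakk>v \<in> Names; w \<in> Names; x \<in> Names; f \<in> Hom B (snd v) (snd w);
        f' \<in> Hom B (snd w) (snd x);
        \<Gamma> v f w; \<Gamma> w f' x\<rbrakk> \<Longrightarrow> \<Gamma> v (f' \<cdot> f) x"
    and graph_free: "\<lbrakk>v \<in> Names; w \<in> Names; f \<in> Hom B (snd v) (snd w); f' \<in> Hom B (snd v) (snd w);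
        \<Gamma> v f w; \<Gamma> v f' w\<rbrakk> \<Longrightarrow> f = f'"
    and graph_unique: "\<lbrakk>v \<in> Names; w \<in> Names; w' \<in> Names; snd w' = snd w; f \<in> Hom B (snd v) (snd w);
        \<Gamma> v f w; \<Gamma> v f w'\<rbrakk> \<Longrightarrow> \<Gamma> w (Ide B (snd w)) w'"
    and graph_symbol: "\<lbrakk>s \<in> Symbols; v \<in> Names; w \<in> Names; f \<in> Hom B (snd v) (snd w); \<Gamma> v f w\<rbrakk> \<Longrightarrow>
        \<Gamma> (apply_symbol b s v) f (apply_symbol b s w)"
    and graph_cancel: "\<lbrakk>s \<in> Symbols; v \<in> Names\<rbrakk> \<Longrightarrow>
        \<Gamma> (apply_symbol b s (apply_symbol (\<not> b) s v)) (Ide B (snd v)) v"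
    and graph_total: "\<lbrakk>X \<in> At; Y \<in> At; f \<in> Hom B X Y\<rbrakk> \<Longrightarrow> \<exists>w \<in> Names. snd w = Y \<and> \<Gamma> (One, X) f w"
    and graph_joint: "\<lbrakk>X \<in> At; v \<in> Names\<rbrakk> \<Longrightarrow>
        \<exists>z \<in> Names. \<exists>f \<in> Hom B (snd z) X. \<exists>f' \<in> Hom B (snd z) (snd v). \<Gamma> z f (One, X) \<and> \<Gamma> z f' v"

context atom_representatives
begin

text \<open>Both arrows from Z to W are epi, so an equation between arrows out of W can be read off
  at one end of the links and then holds at the other.\<close>

lemma compatible_transfer:
  assumes c: "compatible s T Z \<eta>" and Z: "is_atom B Z" and mem: "v \<in> T" "w \<in> T" "v' \<in> T" "w' \<in> T"
    and l: "linked s v v' \<and> linked s w w' \<or> linked s v' v \<and> linked s w' w"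
    and f: "f \<in> Hom B (snd v) (snd w)" and eq: "f \<cdot> \<eta> v = \<eta> w"
  shows "f \<cdot> \<eta> v' = \<eta> w'"
proof -
  obtain W \<alpha> \<beta> \<kappa> where W: "is_atom B W" "\<alpha> \<in> Hom B Z W" "\<beta> \<in> Hom B Z W"
    and \<kappa>: "\<And>v v'. \<lbrakk>v \<in> T; v' \<in> T; linked s v v'\<rbrakk> \<Longrightarrow>
        \<kappa> v v' \<in> Hom B W (snd v) \<and> \<eta> v = \<kappa> v v' \<cdot> \<alpha> \<and> \<eta> v' = \<kappa> v v' \<cdot> \<beta>"
    using c unfolding compatible_def by blast
  have transfer: "f \<cdot> (k \<cdot> \<alpha>') = k' \<cdot> \<alpha>'"
    if "k \<in> Hom B W (snd v)" "k' \<in> Hom B W (snd w)" "f \<cdot> (k \<cdot> \<beta>') = k' \<cdot> \<beta>'"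
      "\<alpha>' \<in> Hom B Z W" "\<beta>' \<in> Hom B Z W" for k k' \<alpha>' \<beta>'
  proof -
    have "(f \<cdot> k) \<cdot> \<beta>' = k' \<cdot> \<beta>'" using that Comp_assoc[OF that(5,1) f] by simp
    then have "f \<cdot> k = k'" using atom_epi[OF Z W(1) that(5) Comp_in_Hom[OF that(1) f] that(2)] by simp
    then show ?thesis using Comp_assoc[OF that(4,1) f] by simp
  qed
  show ?thesis
    using l
  proof
    assume l: "linked s v v' \<and> linked s w w'"
    note k = \<kappa>[of v v'] \<kappa>[of w w']
    show ?thesis using transfer[of "\<kappa> v v'" "\<kappa> w w'" \<alpha> \<beta>] k l mem eq W by simp
  next
    assume l: "linked s v' v \<and> linked s w' w"
    note k = \<kappa>[of v' v] \<kappa>[of w' w]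
    have "snd v' = snd v" "snd w' = snd w" using linked_snd l by metis+
    then show ?thesis using transfer[of "\<kappa> v' v" "\<kappa> w' w" \<beta> \<alpha>] k l mem eq W by simp
  qed
qed

text \<open>Each condition on \<open>\<Gamma>\<close> involves finitely many names. For all but the
  last, any proper filter would do, as they hold in each model of these names; in
  \<open>graph_joint\<close> the component may vary with the model, and the ultrafilter fixes
  one.\<close>

lemma name_graph_exists: "\<exists>\<Gamma>. name_graph u B At \<Gamma>"
proof -
  define good where "good S T Z \<eta> \<longleftrightarrow> S \<subseteq> T \<and> closed_names T \<and> model T Z \<eta>" for S T Z \<eta>
  have "\<forall>S. \<exists>T Z \<eta>. finite S \<and> S \<subseteq> Names \<longrightarrow> good S T Z \<eta>"
    using closed_names_exists model_exists unfolding good_def by meson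
  then obtain T Z \<eta> where T: "\<And>S. finite S \<and> S \<subseteq> Names \<Longrightarrow> good S (T S) (Z S) (\<eta> S)" by metis
  obtain U where U: "U \<le> finite_subsets_at_top Names" "U \<noteq> bot"
    "\<And>P. eventually P U \<or> eventually (\<lambda>x. \<not> P x) U"
    using ultrafilter_below[OF finite_subsets_at_top_neq_bot] by metis
  have ev: "eventually (\<lambda>S. good S0 (T S) (Z S) (\<eta> S)) U" if S0: "finite S0" "S0 \<subseteq> Names" for S0
  proof -
    have "eventually (\<lambda>S. good S0 (T S) (Z S) (\<eta> S)) (finite_subsets_at_top Names)"
      unfolding eventually_finite_subsets_at_top
      using S0 T unfolding good_def by (intro exI[of _ S0]) blast
    then show ?thesis by (rule filter_leD[OF U(1)])
  qed
  have good: "v \<in> S0 \<Longrightarrow> \<eta> S v \<in> Hom B (Z S) (snd v)" "is_atom B (Z S)" "v \<in> S0 \<Longrightarrow> v \<in> T S"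
    "s \<in> Symbols \<Longrightarrow> compatible s (T S) (Z S) (\<eta> S)" "s \<in> Symbols \<Longrightarrow> obeys s (T S) (Z S) (\<eta> S)"
    if "good S0 (T S) (Z S) (\<eta> S)" for S S0 v s
    using that unfolding good_def model_def by auto
  define \<Gamma> where "\<Gamma> v f w \<longleftrightarrow> eventually (\<lambda>S. f \<cdot> \<eta> S v = \<eta> S w) U" for v f w
  have "name_graph u B At \<Gamma>"
  proof unfold_locales
    fix v assume v: "v \<in> Names"
    show "\<Gamma> v (Ide B (snd v)) v"
      unfolding \<Gamma>_def using ev[of "{v}"] v
      by (auto elim!: eventually_mono dest!: good(1)[of _ _ v] simp: Ide_Comp)
    fix w assume w: "w \<in> Names" "snd v = snd w" "\<Gamma> v (Ide B (snd v)) w"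
    have "eventually (\<lambda>S. good {v, w} (T S) (Z S) (\<eta> S)) U" using ev[of "{v, w}"] v w by simp
    then show "\<Gamma> w (Ide B (snd w)) v"
      using w(3) unfolding \<Gamma>_def
    proof eventually_elim
      case (elim S)
      then show ?case
        using Ide_Comp[OF good(1)[OF elim(1), of v]] Ide_Comp[OF good(1)[OF elim(1), of w]] w(2) by simp
    qed
  next
    fix v w x f f' assume *: "v \<in> Names" "w \<in> Names" "x \<in> Names" "f \<in> Hom B (snd v) (snd w)"
      "f' \<in> Hom B (snd w) (snd x)" "\<Gamma> v f w" "\<Gamma> w f' x"
    have "eventually (\<lambda>S. good {v} (T S) (Z S) (\<eta> S)) U" using ev[of "{v}"] * by simp
    then show "\<Gamma> v (f' \<cdot> f) x"
      using *(6,7) unfolding \<Gamma>_def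
    proof eventually_elim
      case (elim S)
      then show ?case using Comp_assoc[OF good(1)[OF elim(1), of v] *(4,5)] by simp
    qed
  next
    fix v w f f' assume *: "v \<in> Names" "w \<in> Names" "f \<in> Hom B (snd v) (snd w)"
      "f' \<in> Hom B (snd v) (snd w)" "\<Gamma> v f w" "\<Gamma> v f' w"
    have "eventually (\<lambda>S. good {v} (T S) (Z S) (\<eta> S)) U" using ev[of "{v}"] * by simp
    then have "eventually (\<lambda>_. f = f') U"
      using *(5,6) unfolding \<Gamma>_def
    proof eventually_elim
      case (elim S)
      have "is_atom B (snd v)" using *(1) At_atom by (auto simp: Names_def)
      then show ?case
        using atom_epi[OF good(2)[OF elim(1)] _ good(1)[OF elim(1), of v] *(3,4)] elim by simp
    qed
    then show "f = f'" using U(2) by simp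
  next
    fix v w w' f assume *: "v \<in> Names" "w \<in> Names" "w' \<in> Names" "snd w' = snd w"
      "f \<in> Hom B (snd v) (snd w)" "\<Gamma> v f w" "\<Gamma> v f w'"
    have "eventually (\<lambda>S. good {w'} (T S) (Z S) (\<eta> S)) U" using ev[of "{w'}"] * by simp
    then show "\<Gamma> w (Ide B (snd w)) w'"
      using *(6,7) unfolding \<Gamma>_def
    proof eventually_elim
      case (elim S)
      then show ?case using Ide_Comp[OF good(1)[OF elim(1), of w']] *(4) by simp
    qed
  next
    fix s v w f b assume *: "s \<in> Symbols" "v \<in> Names" "w \<in> Names" "f \<in> Hom B (snd v) (snd w)" "\<Gamma> v f w"
    let ?S = "{v, w, apply_symbol b s v, apply_symbol b s w}"
    have "eventually (\<lambda>S. good ?S (T S) (Z S) (\<eta> S)) U"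
      using ev[of ?S] * apply_symbol_Names by simp
    then show "\<Gamma> (apply_symbol b s v) f (apply_symbol b s w)"
      using *(5) unfolding \<Gamma>_def
    proof eventually_elim
      case (elim S)
      show ?case
        by (rule compatible_transfer[OF good(4)[OF elim(1) *(1)] good(2)[OF elim(1)] _ _ _ _ _ *(4) elim(2)])
          (use good(3)[OF elim(1)] in \<open>cases b; auto simp: linked_def\<close>)+
    qed
  next
    fix s v b assume *: "s \<in> Symbols" "v \<in> Names"
    let ?m = "apply_symbol (\<not> b) s v"
    let ?S = "{v, ?m, apply_symbol b s ?m}"
    have "eventually (\<lambda>S. good ?S (T S) (Z S) (\<eta> S)) U"
      using ev[of ?S] * apply_symbol_Names by simp
    then show "\<Gamma> (apply_symbol b s ?m) (Ide B (snd v)) v"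
      unfolding \<Gamma>_def
    proof eventually_elim
      case (elim S)
      have O: "snd v \<in> Obj B" using *(2) At_Obj by (auto simp: Names_def)
      have I: "Ide B (snd v) \<in> Hom B (snd ?m) (snd ?m)" using Ide_in_Hom[OF O] by simp
      have e: "Ide B (snd v) \<cdot> \<eta> S ?m = \<eta> S ?m"
        using Ide_Comp[OF good(1)[OF elim, of ?m]] by simp
      show ?case
        by (rule compatible_transfer[OF good(4)[OF elim *(1)] good(2)[OF elim] _ _ _ _ _ I e])
          (use good(3)[OF elim] in \<open>cases b; auto simp: linked_def\<close>)+
    qed
  next
    fix X Y f assume *: "X \<in> At" "Y \<in> At" "f \<in> Hom B X Y"
    let ?I = "Ide B X"
    \<comment> \<open>With the empty word for h and identities for the two legs, the hypothesis of
      \<open>obeys\<close> is satisfied at once, so the target names the image of (1, X) under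
      \<open>f\<close>.\<close>
    define s where "s = (One :: 'a word, ?I, ?I, f)"
    have I: "?I \<in> Hom B X X" using Ide_in_Hom[OF At_Obj[OF *(1)]] .
    have s: "s \<in> Symbols" using * I by (auto simp: s_def Symbols_def span_def Hom_def)
    have t: "target s \<in> Names" "snd (target s) = Y"
      using target_Names[OF s] *(3) by (auto simp: s_def Hom_simps)
    let ?S = "{(One, X), target s}"
    have "eventually (\<lambda>S. good ?S (T S) (Z S) (\<eta> S)) U"
      using ev[of ?S] * t by (simp add: Names_def)
    then have "\<Gamma> (One, X) f (target s)"
      unfolding \<Gamma>_def
    proof eventually_elim
      case (elim S)
      have h: "\<eta> S (One, X) \<in> Hom B (Z S) X" using good(1)[OF elim, of "(One, X)"] by simp
      have ZI: "Ide B (Z S) \<in> Hom B (Z S) (Z S)" using Ide_in_Hom[OF Hom_simps(4)[OF h]] .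
      have dc: "Dom B ?I = X" "Cod B ?I = X" using I by (auto simp: Hom_simps)
      have "?I \<cdot> \<eta> S (One, X) = \<eta> S (One, X) \<cdot> Ide B (Z S)"
        using Ide_Comp[OF h] Comp_Ide[OF h] by simp
      then have "\<exists>z\<in>Hom B (Z S) X. ?I \<cdot> z = \<eta> S (One, X) \<and> ?I \<cdot> z = \<eta> S (One, X) \<and>
          f \<cdot> z = \<eta> S (target s)"
        using good(5)[OF elim s] good(3)[OF elim, of "target s"] good(2)[OF elim] h ZI
        unfolding obeys_def s_def case_prod_conv dc by blast
      then show ?case using Ide_Comp by metis
    qed
    then show "\<exists>w\<in>Names. snd w = Y \<and> \<Gamma> (One, X) f w" using t by blast
  next
    fix X v assume *: "X \<in> At" "v \<in> Names"
    obtain h Y where v: "v = (h, Y)" by fastforce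
    have hY: "wf_word h" "Y \<in> At" using * v by (auto simp: Names_def)
    obtain P p q where P: "is_product2 B X Y P p q" using product_exists[OF At_Obj[OF *(1)]
        At_Obj[OF hY(2)]] .
    have pq: "p \<in> Hom B P X" "q \<in> Hom B P Y" "P \<in> Obj B" using P by (auto simp: is_product2_def)
    obtain n D \<iota> where D: "\<And>k. k < (n::nat) \<Longrightarrow> D k \<in> At" "is_coproduct B {..<n} D P \<iota>"
      using At_decomposition[OF pq(3)] by metis
    note \<iota> = coproduct_inj_Hom[OF D(2), simplified]
    \<comment> \<open>One symbol for each component \<open>D k\<close> of X x Y, with the identity
      as last entry: if the pair of (1, X) and \<open>v\<close> lies in \<open>D k\<close>, the
      target of \<open>s k\<close> names a point of \<open>D k\<close> above both.\<close>
    define s where "s k = (h, p \<cdot> \<iota> k, q \<cdot> \<iota> k, Ide B (D k))" for k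
    have pk: "p \<cdot> \<iota> k \<in> Hom B (D k) X" "q \<cdot> \<iota> k \<in> Hom B (D k) Y" "Ide B (D k) \<in> Hom B (D k) (D k)"
        if "k < n" for k
      using Comp_in_Hom[OF \<iota>[OF that] pq(1)] Comp_in_Hom[OF \<iota>[OF that] pq(2)]
        Ide_in_Hom[OF At_Obj[OF D(1)[OF that]]] by auto
    have s: "s k \<in> Symbols" if "k < n" for k
      using pk[OF that] hY D(1)[OF that] *(1) by (auto simp: s_def Symbols_def span_def Hom_def)
    have t: "target (s k) \<in> Names" "snd (target (s k)) = D k" if "k < n" for k
      using target_Names[OF s[OF that]] pk(3)[OF that] by (auto simp: s_def Hom_simps)
    let ?S = "{(One, X), v} \<union> (\<lambda>k. target (s k)) ` {..<n}"
    let ?Q = "\<lambda>k S. (p \<cdot> \<iota> k) \<cdot> \<eta> S (target (s k)) = \<eta> S (One, X) \<and> (q \<cdot> \<iota> k) \<cdot> \<eta> S (target (s k)) =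
        \<eta> S v"
    have "eventually (\<lambda>S. good ?S (T S) (Z S) (\<eta> S)) U"
      using ev[of ?S] * t by (auto simp: Names_def)
    then have ex: "eventually (\<lambda>S. \<exists>k<n. ?Q k S) U"
    proof eventually_elim
      case (elim S)
      have h: "\<eta> S (One, X) \<in> Hom B (Z S) X" "\<eta> S (h, Y) \<in> Hom B (Z S) Y"
        using good(1)[OF elim, of "(One, X)"] good(1)[OF elim, of v] v by simp_all
      have ZI: "Ide B (Z S) \<in> Hom B (Z S) (Z S)" using Ide_in_Hom[OF Hom_simps(4)[OF h(1)]] .
      obtain r where r: "r \<in> Hom B (Z S) P" "p \<cdot> r = \<eta> S (One, X)" "q \<cdot> r = \<eta> S (h, Y)"
        using product2_pair[OF P h] .
      obtain k z where k: "k < n" "z \<in> Hom B (Z S) (D k)" "r = \<iota> k \<cdot> z"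
        using atom_coproduct_factor[OF good(2)[OF elim] D(2) r(1)] .
      have dc: "Dom B (p \<cdot> \<iota> k) = D k" "Cod B (p \<cdot> \<iota> k) = X" "Cod B (q \<cdot> \<iota> k) = Y"
        using pk[OF k(1)] by (auto simp: Hom_simps)
      have tT: "target (s k) \<in> T S" using good(3)[OF elim, of "target (s k)"] k(1) by blast
      have "(p \<cdot> \<iota> k) \<cdot> z = \<eta> S (One, X) \<cdot> Ide B (Z S)" "(q \<cdot> \<iota> k) \<cdot> z = \<eta> S (h, Y) \<cdot> Ide B (Z S)"
        using r k Comp_assoc[OF k(2) \<iota>[OF k(1)] pq(1)] Comp_assoc[OF k(2) \<iota>[OF k(1)] pq(2)]
          Comp_Ide[OF h(1)] Comp_Ide[OF h(2)] by simp_all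
      then obtain z' where z': "z' \<in> Hom B (Z S) (D k)" "(p \<cdot> \<iota> k) \<cdot> z' = \<eta> S (One, X)"
        "(q \<cdot> \<iota> k) \<cdot> z' = \<eta> S (h, Y)" "Ide B (D k) \<cdot> z' = \<eta> S (target (s k))"
        using good(5)[OF elim s[OF k(1)]] tT good(2)[OF elim] k(2) ZI
        unfolding obeys_def s_def case_prod_conv dc by blast
      then show ?case using Ide_Comp[OF z'(1)] k(1) v by metis
    qed
    \<comment> \<open>A finite disjunction that holds eventually along an ultrafilter has a disjunct
      that does.\<close>
    have "\<exists>k<n. eventually (?Q k) U"
    proof (rule ccontr)
      assume "\<not> ?thesis"
      then have "\<forall>k\<in>{..<n}. eventually (\<lambda>S. \<not> ?Q k S) U" using U(3) by blast
      then have "eventually (\<lambda>S. \<forall>k\<in>{..<n}. \<not> ?Q k S) U"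
          by (rule eventually_ball_finite[OF finite_lessThan])
      with ex have "eventually (\<lambda>_. False) U" by eventually_elim blast
      then show False using U(2) by simp
    qed
    then obtain k where k: "k < n" "eventually (?Q k) U" by blast
    have "\<Gamma> (target (s k)) (p \<cdot> \<iota> k) (One, X)" "\<Gamma> (target (s k)) (q \<cdot> \<iota> k) v"
      unfolding \<Gamma>_def using k(2) by (auto elim: eventually_mono)
    then show "\<exists>z\<in>Names. \<exists>f\<in>Hom B (snd z) X. \<exists>f'\<in>Hom B (snd z) (snd v). \<Gamma> z f (One, X) \<and> \<Gamma> z f' v"
      using t[OF k(1)] pk[OF k(1)] v by (intro bexI[of _ "target (s k)"]) auto
  qed
  then show ?thesis by blast
qed

end

section \<open>Points as classes of names, and the group of words\<close>

locale coded_name_graph = name_graph u B At \<Gamma>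
  for u :: "'u itself" and B :: "('o, 'a, 'm) cat_scheme" (structure) and At :: "'o set"
    and \<Gamma> :: "('o, 'a) name \<Rightarrow> 'a \<Rightarrow> ('o, 'a) name \<Rightarrow> bool" +
  fixes code :: "('o, 'a) name \<Rightarrow> 'u"
  assumes inj_code: "inj_on code Names"
begin

definition same :: "('o, 'a) name \<Rightarrow> ('o, 'a) name \<Rightarrow> bool" where
  "same v w \<longleftrightarrow> v \<in> Names \<and> w \<in> Names \<and> snd v = snd w \<and> \<Gamma> v (Ide B (snd v)) w"

text \<open>Classes are stored as sets of codes, so that points have type \<open>'u set\<close>
  whatever the types of objects and arrows are.\<close>

definition pt :: "('o, 'a) name \<Rightarrow> 'u set" where
  "pt v = code ` {w. same v w}"

definition points :: "'o \<Rightarrow> 'u set set" where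
  "points X = pt ` {v \<in> Names. snd v = X}"

definition pt_map :: "'a \<Rightarrow> 'u set \<Rightarrow> 'u set" where
  "pt_map f x = pt (SOME w. \<exists>v \<in> Names. x = pt v \<and> w \<in> Names \<and> snd v = Dom B f \<and> snd w = Cod B f \<and>
      \<Gamma> v f w)"

text \<open>Being the identity off the points, words with the same action on points become the same
  function, so that the group laws and faithfulness hold in \<open>pt_group\<close> as equations of
  functions.\<close>

definition pt_act :: "'a word \<Rightarrow> 'u set \<Rightarrow> 'u set" where
  "pt_act w x = (if x \<in> pt ` Names then pt (apply_word w (SOME v. v \<in> Names \<and> x = pt v)) else x)"

definition pt_group :: "('u set \<Rightarrow> 'u set) monoid" where
  "pt_group = \<lparr>carrier = pt_act ` {w. wf_word w}, mult = (\<circ>), one = id\<rparr>"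

lemma Names_Ide: "v \<in> Names \<Longrightarrow> Ide B (snd v) \<in> Hom B (snd v) (snd v)"
  using At_Obj by (auto simp: Names_def intro: Ide_in_Hom)

lemma same_refl: "v \<in> Names \<Longrightarrow> same v v"
  by (simp add: same_def graph_refl)

lemma same_sym: "same v w \<Longrightarrow> same w v"
  using graph_sym[of v w] unfolding same_def by metis

lemma same_trans:
  assumes "same v w" "same w x"
  shows "same v x"
proof -
  have *: "v \<in> Names" "w \<in> Names" "x \<in> Names" "snd v = snd w" "snd w = snd x"
    "\<Gamma> v (Ide B (snd w)) w" "\<Gamma> w (Ide B (snd w)) x"
    using assms by (auto simp: same_def)
  have "\<Gamma> v (Ide B (snd w) \<cdot> Ide B (snd w)) x"
    using graph_Comp[OF *(1-3) _ _ *(6,7)] Names_Ide[OF *(2)] * by simp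
  then show ?thesis using * Ide_Comp[OF Names_Ide[OF *(2)]] by (simp add: same_def)
qed

lemma pt_eq_iff: "\<lbrakk>v \<in> Names; w \<in> Names\<rbrakk> \<Longrightarrow> pt v = pt w \<longleftrightarrow> same v w"
proof
  assume v: "v \<in> Names" "w \<in> Names" and eq: "pt v = pt w"
  have "code w \<in> pt v" unfolding eq using same_refl[OF v(2)] by (auto simp: pt_def)
  then obtain w' where "same v w'" "code w = code w'" by (auto simp: pt_def)
  then show "same v w" using inj_onD[OF inj_code, of w w'] v by (auto simp: same_def)
next
  assume "same v w"
  then have "{x. same v x} = {x. same w x}" using same_sym same_trans by blast
  then show "pt v = pt w" by (simp add: pt_def)
qed

lemma graph_same:
  assumes "\<Gamma> v f w" "same v v'" "same w w'" and f: "f \<in> Hom B (snd v) (snd w)"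
  shows "\<Gamma> v' f w'"
proof -
  have v: "v \<in> Names" "v' \<in> Names" "snd v' = snd v" "\<Gamma> v' (Ide B (snd v)) v"
    using same_sym[OF assms(2)] by (auto simp: same_def)
  have w: "w \<in> Names" "w' \<in> Names" "snd w' = snd w" "\<Gamma> w (Ide B (snd w)) w'"
    using assms(3) by (auto simp: same_def)
  have "\<Gamma> v' (f \<cdot> Ide B (snd v)) w"
    using graph_Comp[OF v(2,1) w(1) _ f v(4) assms(1)] Names_Ide[OF v(1)] v(3) by simp
  then have "\<Gamma> v' f w" using Comp_Ide[OF f] by simp
  then have "\<Gamma> v' (Ide B (snd w) \<cdot> f) w'"
    using graph_Comp[OF v(2) w(1,2) _ _ _ w(4)] f Names_Ide[OF w(1)] v(3) w(3) by simp
  then show ?thesis using Ide_Comp[OF f] by simp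
qed

lemma pointsI: "v \<in> Names \<Longrightarrow> pt v \<in> points (snd v)"
  by (auto simp: points_def)

lemma pointsE:
  assumes "x \<in> points X"
  obtains v where "v \<in> Names" "snd v = X" "x = pt v"
  using assms by (auto simp: points_def)

lemma pt_map_pt:
  assumes v: "v \<in> Names" and w: "w \<in> Names" and f: "f \<in> Hom B (snd v) (snd w)" and g: "\<Gamma> v f w"
  shows "pt_map f (pt v) = pt w"
proof -
  let ?P = "\<lambda>w'. \<exists>v' \<in> Names. pt v = pt v' \<and> w' \<in> Names \<and> snd v' = Dom B f \<and> snd w' = Cod B f \<and>
      \<Gamma> v' f w'"
  have "?P w" using v w g f by (auto simp: Hom_simps)
  then have "?P (SOME w'. ?P w')" by (rule someI)
  then obtain v' where v': "v' \<in> Names" "pt v = pt v'" "(SOME w'. ?P w') \<in> Names"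
    "snd v' = snd v" "snd (SOME w'. ?P w') = snd w" "\<Gamma> v' f (SOME w'. ?P w')"
    using f by (auto simp: Hom_simps)
  have "same v' v" using pt_eq_iff[OF v v'(1)] v'(2) same_sym by simp
  then have "\<Gamma> v f (SOME w'. ?P w')"
    using graph_same[OF v'(6) _ same_refl[OF v'(3)]] f v'(4,5) by simp
  then have "\<Gamma> w (Ide B (snd w)) (SOME w'. ?P w')"
    using graph_unique[OF v w v'(3,5) f g] by simp
  then have "same w (SOME w'. ?P w')" using w v'(3,5) by (simp add: same_def)
  then show ?thesis unfolding pt_map_def using pt_eq_iff[OF w v'(3)] by simp
qed

lemma graph_word:
  assumes "wf_word x" "v \<in> Names" "w \<in> Names" "f \<in> Hom B (snd v) (snd w)" "\<Gamma> v f w"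
  shows "\<Gamma> (apply_word x v) f (apply_word x w)"
  using assms(1)
proof (induction x)
  case (App b h f' g k x)
  then have "(h, f', g, k) \<in> Symbols" "\<Gamma> (apply_word x v) f (apply_word x w)" "wf_word x"
    by (auto simp: Symbols_def)
  then show ?case using graph_symbol apply_word_Names assms by simp
qed (use assms in simp)

lemma same_word: "\<lbrakk>wf_word x; same v w\<rbrakk> \<Longrightarrow> same (apply_word x v) (apply_word x w)"
  using graph_word[of x v w "Ide B (snd v)"] Names_Ide apply_word_Names by (auto simp: same_def)

lemma same_inverse_word:
  assumes "wf_word x" "v \<in> Names"
  shows "same (apply_word (word_inverse x) (apply_word x v)) v"
    and "same (apply_word x (apply_word (word_inverse x) v)) v"
proof -
  have cancel: "same (apply_symbol b s (apply_symbol (\<not> b) s w)) w" if "s \<in> Symbols"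
      "w \<in> Names" for b s w
    using graph_cancel[OF that] apply_symbol_Names that by (simp add: same_def)
  have "wf_word x \<Longrightarrow> v \<in> Names \<Longrightarrow> same (apply_word (word_inverse x) (apply_word x v)) v" for v
  proof (induction x)
    case One
    then show ?case by (simp add: same_refl)
  next
    case (App b h f g k x)
    have s: "(h, f, g, k) \<in> Symbols" and x: "wf_word x" using App.prems by (auto simp: Symbols_def)
    have "same (apply_symbol (\<not> b) (h, f, g, k) (apply_symbol b (h, f, g, k) (apply_word x v))) (apply_word x v)"
      using cancel[OF s apply_word_Names[OF x App.prems(2)], of "\<not> b"] by simp
    then have "same (apply_word (word_inverse x)
        (apply_symbol (\<not> b) (h, f, g, k) (apply_symbol b (h, f, g, k) (apply_word x v)))) v"
      using same_trans[OF same_word App.IH(2)[OF x App.prems(2)]] x by simp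
    then show ?case by simp
  qed
  then show "same (apply_word (word_inverse x) (apply_word x v)) v" using assms by blast
  have "wf_word x \<Longrightarrow> v \<in> Names \<Longrightarrow> same (apply_word x (apply_word (word_inverse x) v)) v" for v
  proof (induction x arbitrary: v)
    case One
    then show ?case by (simp add: same_refl)
  next
    case (App b h f g k x)
    have s: "(h, f, g, k) \<in> Symbols" and x: "wf_word x" using App.prems by (auto simp: Symbols_def)
    let ?w = "apply_symbol (\<not> b) (h, f, g, k) v"
    have w: "?w \<in> Names" using apply_symbol_Names[OF s App.prems(2)] .
    have "same (apply_word (App b h f g k One) (apply_word x (apply_word (word_inverse x) ?w)))
        (apply_word (App b h f g k One) ?w)"
      by (rule same_word[OF _ App.IH(2)[OF x w]]) (use App.prems in auto)
    then have "same (apply_symbol b (h, f, g, k) (apply_word x (apply_word (word_inverse x) ?w)))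
        (apply_symbol b (h, f, g, k) ?w)" by simp
    then show ?case using same_trans[OF _ cancel[OF s App.prems(2)]] by simp
  qed
  then show "same (apply_word x (apply_word (word_inverse x) v)) v" using assms by blast
qed

lemma pt_act_pt:
  assumes "wf_word x" "v \<in> Names"
  shows "pt_act x (pt v) = pt (apply_word x v)"
proof -
  let ?v = "SOME v'. v' \<in> Names \<and> pt v = pt v'"
  have "?v \<in> Names \<and> pt v = pt ?v" by (rule someI[of _ v]) (use assms in simp)
  then have "same ?v v" "?v \<in> Names" using pt_eq_iff assms same_sym by blast+
  then have "pt (apply_word x ?v) = pt (apply_word x v)"
    using same_word[OF assms(1)] pt_eq_iff apply_word_Names assms by blast
  then show ?thesis using assms(2) by (simp add: pt_act_def)
qed

lemma pt_act_append:
  assumes "wf_word x" "wf_word y"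
  shows "pt_act x \<circ> pt_act y = pt_act (word_append x y)"
proof
  fix p
  show "(pt_act x \<circ> pt_act y) p = pt_act (word_append x y) p"
  proof (cases "p \<in> pt ` Names")
    case True
    then show ?thesis using assms by (auto simp: pt_act_pt apply_word_Names)
  qed (simp add: pt_act_def)
qed

lemma pt_act_One: "pt_act One = id"
proof
  fix p
  show "pt_act One p = id p"
  proof (cases "p \<in> pt ` Names")
    case True
    then show ?thesis by (auto simp: pt_act_pt)
  qed (simp add: pt_act_def)
qed

lemma pt_act_inverse:
  assumes "wf_word x"
  shows "pt_act (word_inverse x) \<circ> pt_act x = id"
proof
  fix p
  show "(pt_act (word_inverse x) \<circ> pt_act x) p = id p"
  proof (cases "p \<in> pt ` Names")
    case True
    then obtain v where v: "v \<in> Names" "p = pt v" by blast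
    then show ?thesis
      using assms same_inverse_word(1)[OF assms v(1)]
        pt_eq_iff[OF _ v(1), of "apply_word (word_inverse x) (apply_word x v)"]
      by (simp add: pt_act_pt apply_word_Names)
  qed (simp add: pt_act_def)
qed

lemma group_pt_group: "group pt_group"
proof (rule groupI)
  fix x assume "x \<in> carrier pt_group"
  then obtain w where w: "wf_word w" "x = pt_act w" by (auto simp: pt_group_def)
  then show "\<exists>y \<in> carrier pt_group. y \<otimes>\<^bsub>pt_group\<^esub> x = \<one>\<^bsub>pt_group\<^esub>"
    using pt_act_inverse[OF w(1)]
        by (intro bexI[of _ "pt_act (word_inverse w)"]) (auto simp: pt_group_def)
  fix y assume "y \<in> carrier pt_group"
  then obtain w' where w': "wf_word w'" "y = pt_act w'" by (auto simp: pt_group_def)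
  show "x \<otimes>\<^bsub>pt_group\<^esub> y \<in> carrier pt_group"
    using w w' by (auto simp: pt_group_def pt_act_append)
next
  show "\<one>\<^bsub>pt_group\<^esub> \<in> carrier pt_group"
    using pt_act_One by (auto simp: pt_group_def intro!: image_eqI[of _ _ One])
qed (auto simp: pt_group_def)

text \<open>Every point is the image of a base point under the word in its name. This gives
  transitivity, and it reduces totality and \<open>joint\<close> to base points.\<close>

lemma point_functor_points: "point_functor u B At points pt_map pt_group id"
proof (intro point_functor.intro point_functor_axioms.intro)
  show "atom_representatives u B At" by (rule atom_representatives_axioms)
  have graph_exists: "\<exists>w \<in> Names. snd w = Y \<and> \<Gamma> v f w"
    if v: "v \<in> Names" and Y: "Y \<in> At" and f: "f \<in> Hom B (snd v) Y" for v f Y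
  proof -
    have wX: "wf_word (fst v)" "snd v \<in> At" using v by (auto simp: Names_def split_beta)
    obtain w where w: "w \<in> Names" "snd w = Y" "\<Gamma> (One, snd v) f w"
      using graph_total[OF wX(2) Y f] by blast
    have "(One, snd v) \<in> Names" using wX by (simp add: Names_def)
    then have "\<Gamma> (apply_word (fst v) (One, snd v)) f (apply_word (fst v) w)"
      using graph_word[OF wX(1) _ w(1) _ w(3)] f w(2) by simp
    then show ?thesis using apply_word_Names[OF wX(1) w(1)] w(2)
        by (intro bexI[of _ "apply_word (fst v) w"]) simp_all
  qed
  have mapE: "\<exists>v w. v \<in> Names \<and> w \<in> Names \<and> snd v = A \<and> snd w = A' \<and> x = pt v \<and> \<Gamma> v f w \<and>
      pt_map f x = pt w"
    if A': "A' \<in> At" and f: "f \<in> Hom B A A'" and x: "x \<in> points A" for A A' f x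
  proof -
    obtain v where v: "v \<in> Names" "snd v = A" "x = pt v" using pointsE[OF x] .
    obtain w where w: "w \<in> Names" "snd w = A'" "\<Gamma> v f w" using graph_exists[OF v(1) A'] f v(2) by blast
    then show ?thesis using pt_map_pt[OF v(1) w(1) _ w(3)] f v by blast
  qed
  fix A assume A: "A \<in> At"
  have base: "(One, A) \<in> Names" using A by (simp add: Names_def)
  then show "points A \<noteq> {}" by (auto simp: points_def)
  {
    fix x assume x: "x \<in> points A"
    obtain v where v: "v \<in> Names" "snd v = A" "x = pt v" using pointsE[OF x] .
    show "pt_map (Ide B A) x = x"
      using pt_map_pt[OF v(1,1)] Names_Ide[OF v(1)] graph_refl[OF v(1)] v by simp
    show "id \<one>\<^bsub>pt_group\<^esub> x = x" by (simp add: pt_group_def)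
    {
      fix g assume "g \<in> carrier pt_group"
      then obtain w where w: "wf_word w" "g = pt_act w" by (auto simp: pt_group_def)
      show "id g x \<in> points A"
        using w v pt_act_pt[OF w(1) v(1)] pointsI[OF apply_word_Names[OF w(1) v(1)]] by simp
    }
    fix y assume y: "y \<in> points A"
    obtain w where w: "w \<in> Names" "snd w = A" "y = pt w" using pointsE[OF y] .
    \<comment> \<open>The inverse of the word of \<open>x\<close> takes \<open>x\<close> to the base
      point of A, and the word of \<open>y\<close> takes this to \<open>y\<close>.\<close>
    let ?g = "word_append (fst w) (word_inverse (fst v))"
    have wf: "wf_word (fst v)" "wf_word (fst w)" using v w by (auto simp: Names_def split_beta)
    have "same (apply_word (word_inverse (fst v)) (apply_word (fst v) (One, A))) (One, A)"
      by (rule same_inverse_word(1)[OF wf(1) base])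
    then have "same (apply_word (word_inverse (fst v)) v) (One, A)" using v(2) by (cases v) simp
    then have "same (apply_word (fst w) (apply_word (word_inverse (fst v)) v)) (apply_word (fst w) (One, A))"
      by (rule same_word[OF wf(2)])
    then have "same (apply_word ?g v) w" using w(2) by (cases w) simp
    moreover have "apply_word ?g v \<in> Names" by (rule apply_word_Names) (use wf v in simp_all)
    ultimately have "pt (apply_word ?g v) = pt w" using pt_eq_iff[OF _ w(1)] by blast
    then have "pt_act ?g x = y" using pt_act_pt[OF _ v(1), of ?g] v w wf by simp
    moreover have "pt_act ?g \<in> carrier pt_group" using wf by (simp add: pt_group_def)
    ultimately show "\<exists>g\<in>carrier pt_group. id g x = y" by (metis id_apply)
  }
  fix A' assume A': "A' \<in> At"
  {
    fix f x assume f: "f \<in> Hom B A A'" and x: "x \<in> points A"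
    obtain v w where vw: "v \<in> Names" "w \<in> Names" "snd v = A" "snd w = A'" "x = pt v" "\<Gamma> v f w"
        "pt_map f x = pt w"
      using mapE[OF A' f x] by blast
    show "pt_map f x \<in> points A'" using vw(4,7) pointsI[OF vw(2)] by simp
    {
      fix g assume "g \<in> carrier pt_group"
      then obtain y where y: "wf_word y" "g = pt_act y" by (auto simp: pt_group_def)
      have "\<Gamma> (apply_word y v) f (apply_word y w)" using graph_word[OF y(1) vw(1,2) _ vw(6)] f vw by simp
      then have "pt_map f (pt (apply_word y v)) = pt (apply_word y w)"
        using pt_map_pt[OF apply_word_Names[OF y(1) vw(1)] apply_word_Names[OF y(1) vw(2)]] f vw by simp
      then show "pt_map f (id g x) = id g (pt_map f x)"
        using y vw pt_act_pt[OF y(1) vw(1)] pt_act_pt[OF y(1) vw(2)] by simp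
    }
    {
      fix f' assume f': "f' \<in> Hom B A A'" and eq: "pt_map f x = pt_map f' x"
      obtain v' w' where vw': "v' \<in> Names" "w' \<in> Names" "snd v' = A" "snd w' = A'" "x = pt v'"
          "\<Gamma> v' f' w'"
        "pt_map f' x = pt w'"
        using mapE[OF A' f' x] by blast
      have "same v' v" "same w' w" using vw vw' eq pt_eq_iff by metis+
      then have "\<Gamma> v f' w" using graph_same[OF vw'(6)] f' vw' by simp
      then show "f = f'" using graph_free[OF vw(1,2) _ _ vw(6)] f f' vw by simp
    }
    fix A'' f' assume A'': "A'' \<in> At" and f': "f' \<in> Hom B A' A''"
    obtain z where z: "z \<in> Names" "snd z = A''" "\<Gamma> w f' z" using graph_exists[OF vw(2) A''] f' vw(4)
        by blast
    have "\<Gamma> v (f' \<cdot> f) z" using graph_Comp[OF vw(1,2) z(1) _ _ vw(6) z(3)] f f' vw z by simp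
    then have "pt_map (f' \<cdot> f) x = pt z"
      using pt_map_pt[OF vw(1) z(1)] Comp_in_Hom[OF f f'] vw z by simp
    moreover have "pt_map f' (pt w) = pt z" using pt_map_pt[OF vw(2) z(1) _ z(3)] f' vw z by simp
    ultimately show "pt_map (f' \<cdot> f) x = pt_map f' (pt_map f x)" using vw by simp
  }
  fix x y assume x: "x \<in> points A" and y: "y \<in> points A'"
  obtain v where v: "v \<in> Names" "snd v = A" "x = pt v" using pointsE[OF x] .
  obtain w where w: "w \<in> Names" "snd w = A'" "y = pt w" using pointsE[OF y] .
  have wf: "wf_word (fst v)" using v by (auto simp: Names_def split_beta)
  \<comment> \<open>Undoing the word of \<open>x\<close> moves \<open>x\<close> to the base point,
    where \<open>graph_joint\<close> applies; \<open>?z\<close> moves the point found there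
    back.\<close>
  let ?w = "apply_word (word_inverse (fst v)) w"
  have w': "?w \<in> Names" "snd ?w = A'" using apply_word_Names w wf by simp_all
  obtain z f f' where z: "z \<in> Names" "f \<in> Hom B (snd z) A" "f' \<in> Hom B (snd z) A'"
    "\<Gamma> z f (One, A)" "\<Gamma> z f' ?w"
    using graph_joint[OF A w'(1)] w'(2) by auto
  let ?z = "apply_word (fst v) z"
  have z': "?z \<in> Names" "snd ?z = snd z" using apply_word_Names[OF wf z(1)] by simp_all
  have "\<Gamma> ?z f (apply_word (fst v) (One, A))" using graph_word[OF wf z(1) base _ z(4)] z by simp
  then have zv: "\<Gamma> ?z f v" using v by (cases v) simp
  have "\<Gamma> ?z f' (apply_word (fst v) ?w)" using graph_word[OF wf z(1) w'(1) _ z(5)] z w' by simp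
  then have zw: "\<Gamma> ?z f' w"
    using graph_same[OF _ same_refl[OF z'(1)] same_inverse_word(2)[OF wf w(1)]] z w z' by simp
  have "pt_map f (pt ?z) = x" "pt_map f' (pt ?z) = y"
    using pt_map_pt[OF z'(1) v(1) _ zv] pt_map_pt[OF z'(1) w(1) _ zw] z z' v w by simp_all
  moreover have "snd z \<in> At" using z(1) by (auto simp: Names_def)
  ultimately show "\<exists>C\<in>At. \<exists>z\<in>points C. \<exists>p\<in>Hom B C A. \<exists>q\<in>Hom B C A'. pt_map p z = x \<and> pt_map q z = y"
    using z(2,3) z' pointsI[OF z'(1)] by (metis (no_types, lifting))
next
  show "group pt_group" by (rule group_pt_group)
  fix g h assume g: "g \<in> carrier pt_group" and h: "h \<in> carrier pt_group"
  show "id (g \<otimes>\<^bsub>pt_group\<^esub> h) x = id g (id h x)" for x by (simp add: pt_group_def)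
  assume eq: "\<And>A x. \<lbrakk>A \<in> At; x \<in> points A\<rbrakk> \<Longrightarrow> id g x = id h x"
  show "g = h"
  proof
    fix x
    show "g x = h x"
    proof (cases "x \<in> pt ` Names")
      case True
      then obtain v where v: "v \<in> Names" "x = pt v" by blast
      moreover have "snd v \<in> At" using v by (auto simp: Names_def)
      ultimately show ?thesis using eq[OF _ pointsI[OF v(1)]] by simp
    next
      case False
      then show ?thesis using g h by (auto simp: pt_group_def pt_act_def)
    qed
  qed
qed

end

section \<open>Coding names in \<open>'u\<close>\<close>

primrec word_code :: "('u \<times> 'u \<Rightarrow> 'u) \<Rightarrow> (nat \<Rightarrow> 'u) \<Rightarrow> ('b \<Rightarrow> 'u) \<Rightarrow> 'b word \<Rightarrow> 'u" where
  "word_code p c e One = p (c 0, c 0)"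
| "word_code p c e (App b h f g k w) =
     p (c (if b then 1 else 2), p (word_code p c e h, p (e f, p (e g, p (e k, word_code p c e w)))))"

text \<open>An infinite \<open>'u\<close> contains the naturals, which supply constructor tags, and
  its own square, which supplies pairing. Objects are coded by their identities, since
  \<open>e\<close> codes arrows only.\<close>

lemma (in atom_representatives) Names_code:
  assumes inf: "infinite (UNIV :: 'u set)"
    and e: "inj_on (e :: 'a \<Rightarrow> 'u) {f \<in> Arr B. Dom B f \<in> At \<and> Cod B f \<in> At}"
  obtains code :: "('o, 'a) name \<Rightarrow> 'u" where "inj_on code Names"
proof -
  obtain c :: "nat \<Rightarrow> 'u" where c: "inj c" using infinite_countable_subset[OF inf] by blast
  have "\<exists>p. bij_betw p (UNIV \<times> UNIV :: ('u \<times> 'u) set) (UNIV :: 'u set)"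
    using card_of_Times_same_infinite[OF inf] by (simp only: card_of_ordIso)
  then obtain p :: "'u \<times> 'u \<Rightarrow> 'u" where "inj p"
    using bij_betw_imp_inj_on UNIV_Times_UNIV by metis
  then have p: "p (a, b) = p (a', b') \<longleftrightarrow> a = a' \<and> b = b'" for a b a' b'
    by (simp add: inj_eq)
  have e_eq: "e f = e f' \<longleftrightarrow> f = f'"
    if "f \<in> Arr B" "Dom B f \<in> At" "Cod B f \<in> At" "f' \<in> Arr B" "Dom B f' \<in> At" "Cod B f' \<in> At" for f f'
    using inj_onD[OF e, of f f'] that by auto
  have c_eq: "c i = c j \<longleftrightarrow> i = j" for i j using c by (auto simp: inj_on_def)
  have words: "wf_word w \<Longrightarrow> wf_word w' \<Longrightarrow> word_code p c e w = word_code p c e w' \<Longrightarrow> w = w'" for w w'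
  proof (induction w arbitrary: w')
    case One
    then show ?case by (cases w') (auto simp: p c_eq split: if_splits)
  next
    case (App b h f g k w)
    show ?case
    proof (cases w')
      case One
      then show ?thesis using App.prems by (auto simp: p c_eq split: if_splits)
    next
      case w': (App b' h' f' g' k' v)
      have "b = b'" using App.prems(3) w' by (auto simp: p c_eq split: if_splits)
      moreover have "h = h'" "w = v" using App.IH App.prems w' by (auto simp: p)
      moreover have "f = f'" "g = g'" "k = k'"
        using App.prems w' by (auto simp: p span_def e_eq)
      ultimately show ?thesis using w' by simp
    qed
  qed
  have "inj_on (\<lambda>(w, X). p (word_code p c e w, e (Ide B X))) Names"
  proof (rule inj_onI, clarify)
    fix w X w' X' assume *: "(w, X) \<in> Names" "(w', X') \<in> Names"
      "p (word_code p c e w, e (Ide B X)) = p (word_code p c e w', e (Ide B X'))"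
    then have "X \<in> At" "X' \<in> At" by (auto simp: Names_def)
    then have I: "Ide B X = Ide B X'" and O: "X \<in> Obj B" "X' \<in> Obj B"
      using * e_eq[of "Ide B X" "Ide B X'"] At_Obj by (simp_all add: p cat_simps)
    have "X = Dom B (Ide B X)" using Hom_simps(2)[OF Ide_in_Hom[OF O(1)]] by simp
    also have "\<dots> = X'" unfolding I by (rule Hom_simps(2)[OF Ide_in_Hom[OF O(2)]])
    finally have "X = X'" .
    moreover have "w = w'" using words * by (auto simp: p Names_def)
    ultimately show "w = w' \<and> X = X'" by simp
  qed
  then show thesis by (rule that)
qed

theorem theorem1p2:
  fixes B :: "('o, 'a) cat"
  assumes "pre_galois TYPE('u) B"
  shows "\<exists>(G :: ('u set \<Rightarrow> 'u set) monoid) \<tau>.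
           admissible_group G \<tau> \<and>
           equivalent_categories B
             (SG G \<tau> :: (('u set \<Rightarrow> 'u set, ('u set \<Rightarrow> 'u set) set \<times> nat) gset,
                          ('u set \<Rightarrow> 'u set, ('u set \<Rightarrow> 'u set) set \<times> nat) gmap) cat)"
proof -
  interpret pre_galois "TYPE('u)" B by fact
  obtain S and e :: "'a \<Rightarrow> 'u" where S: "S \<subseteq> Obj B" "\<forall>X \<in> Obj B. \<exists>Y \<in> S. isomorphic B X Y"
    "inj_on e {f \<in> Arr B. Dom B f \<in> S \<and> Cod B f \<in> S}" "infinite (UNIV :: 'u set)"
    using infinite_universe .
  \<comment> \<open>Taking the representatives inside S keeps the arrows between them in the set on
    which \<open>e\<close> is injective.\<close>
  define At where "At = {A \<in> S. is_atom B A}"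
  interpret atom_representatives "TYPE('u)" B At
  proof unfold_locales
    show "\<exists>A \<in> At. isomorphic B X A" if X: "is_atom B X" for X
    proof -
      have "X \<in> Obj B" using X by (simp add: is_atom_def)
      then obtain Y where Y: "Y \<in> S" "isomorphic B X Y" using S(2) by blast
      then have "Y \<in> At" using is_atom_isomorphic[OF X Y(2)] by (simp add: At_def)
      then show ?thesis using Y(2) by blast
    qed
  qed (simp add: At_def)
  have "inj_on e {f \<in> Arr B. Dom B f \<in> At \<and> Cod B f \<in> At}"
    by (rule inj_on_subset[OF S(3)]) (auto simp: At_def)
  then obtain code :: "('o, 'a) name \<Rightarrow> 'u" where code: "inj_on code Names"
    using Names_code[OF S(4)] by blast
  obtain \<Gamma> where "name_graph TYPE('u) B At \<Gamma>" using name_graph_exists by blast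
  then interpret coded_name_graph "TYPE('u)" B At \<Gamma> code
    by (intro coded_name_graph.intro coded_name_graph_axioms.intro code)
  interpret point_functor "TYPE('u)" B At points pt_map pt_group id
    by (rule point_functor_points)
  show ?thesis using admissible_G equivalent_SG by blast
qed

end
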